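(* For every subspace arrangement $\mathcal V=V_1,\dots,V_n$, with $J=I_1I_2\cdots I_n$ where $I_i$ is the ideal of $S$ generated by $V_i$, the complex $\tilde{\mathcal K}_{D_{\mathcal V}}\otimes_T S$ is a minimal $S$-free resolution of $S/J$.
   Context: $K$ is an infinite field, $V$ a $K$-vector space of finite dimension, and $S=\mathrm{Sym}_K(V)$, a polynomial ring with the standard grading. $\mathcal V=V_1,\dots,V_n$ is a subspace arrangement, i.e. a finite collection of non-zero $K$-subspaces of $V$ (inclusions and equalities allowed); $d_i=\dim_K V_i$. $\mathbb N$ contains $0$ and $[u]=\{1,\dots,u\}$. A collection of bases of $\mathcal V$ is a family $\{f_{ij}: i\in[n], j\in[d_i]\}$ such that for each $i$, $f_{i1},\dots,f_{id_i}$ is an ordered $K$-basis of $V_i$. For $a\in\mathbb N^n$ with $a_i\le d_i$ for all $i$, put $W_a=\langle f_{ij}: i\in[n],\ j\in[a_i]\rangle\subseteq V$. We fix a collection of bases satisfying the following genericity assumption: for all $a\in\mathbb N^n$ with $a_i\le d_i$, the dimension of $W_a$ is the largest possible among all collections of bases of $\mathcal V$ (such collections exist since $K$ is infinite). $D=[d_1]\times\cdots\times[d_n]$ with the componentwise partial order. A poset ideal of $D$ is a subset $P\subseteq D$ such that $a\in D$, $b\in P$, $a\le b$ imply $a\in P$. For $A\subseteq[n]$ let $\operatorname{rk}_{\mathcal V}(A)=\dim_K\sum_{i\in A}V_i$, and set $D_{\mathcal V}=\{a\in D: \sum_{i\in T}a_i-|T|\le\operatorname{rk}_{\mathcal V}(T)-1\text{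 for every }\emptyset\ne T\subseteq[n]\}$, a poset ideal of $D$. Let $T=K[x_{ij}: i\in[n], j\in[d_i]]$, and regard $S$ as a $T$-module via the $K$-algebra map $T\to S$, $x_{ij}\mapsto f_{ij}$. For a poset ideal $P$ of $D$ the complex $\tilde{\mathcal K}_P$ of free $T$-modules is defined as follows. For $i\in[n]$ let $e_{i1},\dots,e_{id_i}$ be the canonical basis of $T^{d_i}$, and for non-empty $A_i=\{j_1<j_2<\cdots\}\subseteq[d_i]$ let $e_{A_i}=e_{ij_1}\wedge e_{ij_2}\wedge\cdots$. For $A=(A_1,\dots,A_n)$ with each $A_i\subseteq[d_i]$ non-empty let $e_A=e_{A_1}\otimes\cdots\otimes e_{A_n}$, placed in homological degree $\sum_{i=1}^n|A_i|-n$. The complex $\mathcal K_P$ is the free $T$-module with basis all $e_A$ such that $(\max A_1,\dots,\max A_n)\in P$, with differential $$\partial(e_A)=\sum_{i\in[n],\,|A_i|>1}\ \sum_{b\in A_i}(-1)^{\sigma(i,b)}x_{ib}\ e_{A_1}\otimes\cdots\otimes e_{A_i\setminus\{b\}}\otimes\cdots\otimes e_{A_n},$$ $$\sigma(i,b)=\sum_{j<i}(|A_j|-1)+|\{c\in A_i: c<b\}|.$$ (It is a subcomplex of the tensor product over $i$ of the Koszul complexes on $x_{i1},\dots,x_{id_i}$ with the $0$-th component removed and homologically shifted by one.) Finally $\tilde{\mathcal K}_P$ is obtained by augmenting $\mathcal K_P$ with the map $(\mathcal K_P)_0\to T$ sending $e_{1a_1}\otimes\cdots\otimes e_{na_n}$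 to $x_{1a_1}\cdots x_{na_n}$ for $a\in P$, with $T$ placed in homological degree $0$ and $(\mathcal K_P)_j$ in degree $j+1$. *)

theory Defs
  imports Complex_Main "HOL-Library.Poly_Mapping" "HOL-Library.FuncSet"
begin

section \<open>Polynomial rings\<close>

text \<open>
  The polynomial ring over \<open>'k\<close> in the variables \<open>'x\<close> is the monoid algebra of the
  monomials \<open>'x \<Rightarrow>\<^sub>0 nat\<close>; the ring operations are those of \<^theory>\<open>HOL-Library.Poly_Mapping\<close>.
\<close>

type_synonym ('x, 'k) mpoly = "('x \<Rightarrow>\<^sub>0 nat) \<Rightarrow>\<^sub>0 'k"

definition Const :: "'k::zero \<Rightarrow> ('x, 'k) mpoly"
  where "Const c = Poly_Mapping.single 0 c"

definition Var :: "'x \<Rightarrow> ('x, 'k::zero_neq_one) mpoly"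
  where "Var x = Poly_Mapping.single (Poly_Mapping.single x 1) 1"

definition mdeg :: "('x \<Rightarrow>\<^sub>0 nat) \<Rightarrow> nat"
  where "mdeg m = (\<Sum>x\<in>Poly_Mapping.keys m. Poly_Mapping.lookup m x)"

text \<open>Degrees are integers, so that a homogeneous polynomial of negative degree is \<open>0\<close>.\<close>

definition homogeneous :: "int \<Rightarrow> ('x, 'k::zero) mpoly \<Rightarrow> bool"
  where "homogeneous z p \<longleftrightarrow> (\<forall>m\<in>Poly_Mapping.keys p. int (mdeg m) = z)"

text \<open>The \<open>K\<close>-algebra map \<open>K[y] \<rightarrow> K[x]\<close> with \<open>y \<mapsto> g y\<close>.\<close>

definition subst :: "('y \<Rightarrow> ('x, 'k::comm_ring_1) mpoly) \<Rightarrow> ('y, 'k) mpoly \<Rightarrow> ('x, 'k) mpoly"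
  where "subst g p =
    (\<Sum>m\<in>Poly_Mapping.keys p. Const (Poly_Mapping.lookup p m) *
       (\<Prod>y\<in>Poly_Mapping.keys m. g y ^ Poly_Mapping.lookup m y))"

definition ideal_gen :: "'r::comm_ring_1 set \<Rightarrow> 'r set"
  where "ideal_gen X = module.span (*) X"

definition ideal_prod :: "'i set \<Rightarrow> ('i \<Rightarrow> 'r::comm_ring_1 set) \<Rightarrow> 'r set"
  where "ideal_prod N I = ideal_gen {\<Prod>i\<in>N. g i | g. \<forall>i\<in>N. g i \<in> I i}"

definition irrelevant_ideal :: "('x, 'k::comm_ring_1) mpoly set"
  where "irrelevant_ideal = ideal_gen (range Var)"

section \<open>Complexes of based free modules\<close>

text \<open>
  A complex \<open>\<dots> \<rightarrow> F\<^sub>1 \<rightarrow> F\<^sub>0\<close> of free modules is given by the basis \<open>gens C k\<close> of \<open>F\<^sub>k\<close>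
  and by the images \<open>bdry C k b\<close> of its members \<open>b\<close> in \<open>F\<^bsub>k-1\<^esub>\<close>.  An element of \<open>F\<^sub>k\<close> is its
  coordinate function, vanishing off \<open>gens C k\<close>.  All bases are finite.
  The value of \<open>bdry C 0\<close> plays no role.
\<close>

record ('b, 'r) based_complex =
  gens :: "nat \<Rightarrow> 'b set"
  bdry :: "nat \<Rightarrow> 'b \<Rightarrow> 'b \<Rightarrow> 'r"

definition unit_vec :: "'b \<Rightarrow> 'b \<Rightarrow> 'r::comm_ring_1"
  where "unit_vec b = (\<lambda>b'. if b' = b then 1 else 0)"

definition chains :: "('b, 'r::comm_ring_1) based_complex \<Rightarrow> nat \<Rightarrow> ('b \<Rightarrow> 'r) set"
  where "chains C k = {c. \<forall>b. b \<notin> gens C k \<longrightarrow> c b = 0}"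

definition diff :: "('b, 'r::comm_ring_1) based_complex \<Rightarrow> nat \<Rightarrow> ('b \<Rightarrow> 'r) \<Rightarrow> 'b \<Rightarrow> 'r"
  where "diff C k c = (\<lambda>b'. \<Sum>b\<in>gens C k. c b * bdry C k b b')"

definition is_complex :: "('b, 'r::comm_ring_1) based_complex \<Rightarrow> bool"
  where "is_complex C \<longleftrightarrow>
    (\<forall>k. finite (gens C k)) \<and>
    (\<forall>k. \<forall>b\<in>gens C (Suc k). bdry C (Suc k) b \<in> chains C k) \<and>
    (\<forall>k. \<forall>c\<in>chains C (Suc (Suc k)). diff C (Suc k) (diff C (Suc (Suc k)) c) = (\<lambda>_. 0))"

text \<open>
  \<open>C \<otimes>\<^sub>R R'\<close> along a ring homomorphism \<open>\<phi> :: R \<rightarrow> R'\<close>: since the modules are free, it is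
  the complex on the same bases whose matrices are the images of those of \<open>C\<close> under \<open>\<phi>\<close>.
\<close>

definition base_change ::
    "('r \<Rightarrow> 's) \<Rightarrow> ('b, 'r::comm_ring_1) based_complex \<Rightarrow> ('b, 's::comm_ring_1) based_complex"
  where "base_change \<phi> C = \<lparr>gens = gens C, bdry = (\<lambda>k b b'. \<phi> (bdry C k b b'))\<rparr>"

text \<open>
  \<open>augment C \<epsilon>\<close> shifts \<open>C\<close> by one and puts a free module of rank one, with basis \<open>None\<close>, in
  degree \<open>0\<close>; the new differential \<open>C\<^sub>0 \<rightarrow> R\<close> sends a basis element \<open>b\<close> to \<open>\<epsilon> b\<close>.
\<close>

definition augment ::
    "('b, 'r::comm_ring_1) based_complex \<Rightarrow> ('b \<Rightarrow> 'r) \<Rightarrow> ('b option, 'r) based_complex"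
  where "augment C \<epsilon> = \<lparr>
    gens = (\<lambda>k. case k of 0 \<Rightarrow> {None} | Suc j \<Rightarrow> Some ` gens C j),
    bdry = (\<lambda>k u v. case (k, u, v) of
        (Suc 0, Some b, None) \<Rightarrow> \<epsilon> b
      | (Suc (Suc j), Some b, Some b') \<Rightarrow> bdry C (Suc j) b b'
      | _ \<Rightarrow> 0)\<rparr>"

text \<open>
  \<open>C\<close> is a free resolution of \<open>R/J\<close> via \<open>\<pi>\<close>: the augmentation \<open>F\<^sub>0 \<rightarrow> R/J\<close> is the linear map
  sending a basis element \<open>b\<close> to the class of \<open>\<pi> b\<close>.
\<close>

definition free_resolution_via ::
    "('b, 'r::comm_ring_1) based_complex \<Rightarrow> 'r set \<Rightarrow> ('b \<Rightarrow> 'r) \<Rightarrow> bool"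
  where "free_resolution_via C J \<pi> \<longleftrightarrow>
    is_complex C \<and>
    (\<forall>k. {c \<in> chains C (Suc k). diff C (Suc k) c = (\<lambda>_. 0)}
         = diff C (Suc (Suc k)) ` chains C (Suc (Suc k))) \<and>
    {c \<in> chains C 0. (\<Sum>b\<in>gens C 0. c b * \<pi> b) \<in> J} = diff C (Suc 0) ` chains C (Suc 0) \<and>
    (\<forall>r. \<exists>c\<in>chains C 0. (\<Sum>b\<in>gens C 0. c b * \<pi> b) - r \<in> J)"

text \<open>
  Minimal graded free resolutions of \<open>S/J\<close>, \<open>S\<close> a standard graded polynomial ring.  The
  basis element \<open>b\<close> of \<open>F\<^sub>k\<close> has internal degree \<open>\<delta> k b\<close>; the augmentation and all
  differentials are homogeneous of degree \<open>0\<close>, and minimality is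
  \<open>\<partial>(F\<^bsub>k+1\<^esub>) \<subseteq> \<mm> F\<^sub>k\<close> for the irrelevant ideal \<open>\<mm>\<close>.
\<close>

definition minimal_free_resolution ::
    "('b, ('x, 'k::comm_ring_1) mpoly) based_complex \<Rightarrow> ('x, 'k) mpoly set \<Rightarrow> bool"
  where "minimal_free_resolution C J \<longleftrightarrow>
    (\<exists>\<pi>. \<exists>\<delta> :: nat \<Rightarrow> 'b \<Rightarrow> int.
       free_resolution_via C J \<pi> \<and>
       (\<forall>b\<in>gens C 0. homogeneous (\<delta> 0 b) (\<pi> b)) \<and>
       (\<forall>k. \<forall>b\<in>gens C (Suc k). \<forall>b'\<in>gens C k.
          homogeneous (\<delta> (Suc k) b - \<delta> k b') (bdry C (Suc k) b b'))) \<and>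
    (\<forall>k. \<forall>c\<in>chains C (Suc k). \<forall>b'\<in>gens C k. diff C (Suc k) c b' \<in> irrelevant_ideal)"

section \<open>Subspace arrangements\<close>

text \<open>
  Vector spaces are given by a scalar multiplication \<open>s :: 'k \<Rightarrow> 'v \<Rightarrow> 'v\<close>, and
  \<open>\<V>\<close> consists of \<open>Vs 1, \<dots>, Vs n\<close>; values of families outside the index range are irrelevant.
\<close>

definition vbasis :: "('k::field \<Rightarrow> 'v::ab_group_add \<Rightarrow> 'v) \<Rightarrow> ('x::finite \<Rightarrow> 'v) \<Rightarrow> bool"
  where "vbasis s bas \<longleftrightarrow>
    inj bas \<and> \<not> module.dependent s (range bas) \<and> module.span s (range bas) = UNIV"

definition subspace_arrangement ::
    "('k::field \<Rightarrow> 'v::ab_group_add \<Rightarrow> 'v) \<Rightarrow> nat \<Rightarrow> (nat \<Rightarrow> 'v set) \<Rightarrow> bool"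
  where "subspace_arrangement s n Vs \<longleftrightarrow>
    (\<forall>i\<in>{1..n}. module.subspace s (Vs i) \<and> Vs i \<noteq> {0})"

definition dims :: "('k::field \<Rightarrow> 'v::ab_group_add \<Rightarrow> 'v) \<Rightarrow> (nat \<Rightarrow> 'v set) \<Rightarrow> nat \<Rightarrow> nat"
  where "dims s Vs i = vector_space.dim s (Vs i)"

definition collection_of_bases ::
    "('k::field \<Rightarrow> 'v::ab_group_add \<Rightarrow> 'v) \<Rightarrow> nat \<Rightarrow> (nat \<Rightarrow> 'v set) \<Rightarrow> (nat \<Rightarrow> nat \<Rightarrow> 'v) \<Rightarrow> bool"
  where "collection_of_bases s n Vs f \<longleftrightarrow>
    (\<forall>i\<in>{1..n}. inj_on (f i) {1..dims s Vs i} \<and>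
       \<not> module.dependent s (f i ` {1..dims s Vs i}) \<and>
       module.span s (f i ` {1..dims s Vs i}) = Vs i)"

definition W ::
    "('k::field \<Rightarrow> 'v::ab_group_add \<Rightarrow> 'v) \<Rightarrow> nat \<Rightarrow> (nat \<Rightarrow> nat \<Rightarrow> 'v) \<Rightarrow> (nat \<Rightarrow> nat) \<Rightarrow> 'v set"
  where "W s n f a = module.span s {f i j | i j. i \<in> {1..n} \<and> j \<in> {1..a i}}"

definition generic_bases ::
    "('k::field \<Rightarrow> 'v::ab_group_add \<Rightarrow> 'v) \<Rightarrow> nat \<Rightarrow> (nat \<Rightarrow> 'v set) \<Rightarrow> (nat \<Rightarrow> nat \<Rightarrow> 'v) \<Rightarrow> bool"
  where "generic_bases s n Vs f \<longleftrightarrow>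
    collection_of_bases s n Vs f \<and>
    (\<forall>a. (\<forall>i\<in>{1..n}. a i \<le> dims s Vs i) \<longrightarrow>
       (\<forall>g. collection_of_bases s n Vs g \<longrightarrow>
          vector_space.dim s (W s n g a) \<le> vector_space.dim s (W s n f a)))"

definition rk ::
    "('k::field \<Rightarrow> 'v::ab_group_add \<Rightarrow> 'v) \<Rightarrow> (nat \<Rightarrow> 'v set) \<Rightarrow> nat set \<Rightarrow> nat"
  where "rk s Vs A = vector_space.dim s {\<Sum>i\<in>A. v i | v. \<forall>i\<in>A. v i \<in> Vs i}"

definition D_box :: "nat \<Rightarrow> (nat \<Rightarrow> nat) \<Rightarrow> (nat \<Rightarrow> nat) set"
  where "D_box n d = (\<Pi>\<^sub>E i\<in>{1..n}. {1..d i})"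

definition D_arr ::
    "('k::field \<Rightarrow> 'v::ab_group_add \<Rightarrow> 'v) \<Rightarrow> nat \<Rightarrow> (nat \<Rightarrow> 'v set) \<Rightarrow> (nat \<Rightarrow> nat) set"
  where "D_arr s n Vs = {a \<in> D_box n (dims s Vs).
    \<forall>T. T \<noteq> {} \<and> T \<subseteq> {1..n} \<longrightarrow>
      int (\<Sum>i\<in>T. a i) - int (card T) \<le> int (rk s Vs T) - 1}"

text \<open>
  \<open>Sym(V)\<close> is the polynomial ring on a basis \<open>bas\<close> of \<open>V\<close>; this is the embedding of \<open>V\<close> as
  its component of degree one, the linear map with \<open>bas x \<mapsto> Var x\<close>.
\<close>

definition linear_form ::
    "('k::field \<Rightarrow> 'v::ab_group_add \<Rightarrow> 'v) \<Rightarrow> ('x::finite \<Rightarrow> 'v) \<Rightarrow> 'v \<Rightarrow> ('x, 'k) mpoly"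
  where "linear_form s bas v =
    (\<Sum>x\<in>UNIV. Const (module.representation s (range bas) v (bas x)) * Var x)"

definition subspace_ideal ::
    "('k::field \<Rightarrow> 'v::ab_group_add \<Rightarrow> 'v) \<Rightarrow> ('x::finite \<Rightarrow> 'v) \<Rightarrow> 'v set \<Rightarrow> ('x, 'k) mpoly set"
  where "subspace_ideal s bas U = ideal_gen (linear_form s bas ` U)"

section \<open>The complexes of a poset ideal\<close>

text \<open>
  The variable \<open>x\<^bsub>ij\<^esub>\<close> of \<open>T\<close> is \<open>Var (i, j)\<close>; only those with \<open>i \<in> {1..n}\<close> and
  \<open>j \<in> {1..d i}\<close> occur below.  The basis element \<open>e\<^sub>A\<close> is represented by the family
  \<open>A = (A\<^sub>1, \<dots>, A\<^sub>n)\<close> itself.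
\<close>

definition K_sign :: "(nat \<Rightarrow> nat set) \<Rightarrow> nat \<Rightarrow> nat \<Rightarrow> nat"
  where "K_sign A i b = (\<Sum>j\<in>{1..<i}. card (A j) - 1) + card {c \<in> A i. c < b}"

definition K_complex ::
    "nat \<Rightarrow> (nat \<Rightarrow> nat) \<Rightarrow> (nat \<Rightarrow> nat) set
      \<Rightarrow> (nat \<Rightarrow> nat set, (nat \<times> nat, 'k::comm_ring_1) mpoly) based_complex"
  where "K_complex n d P = \<lparr>
    gens = (\<lambda>k. {A \<in> (\<Pi>\<^sub>E i\<in>{1..n}. Pow {1..d i} - {{}}).
        (\<lambda>i\<in>{1..n}. Max (A i)) \<in> P \<and> (\<Sum>i\<in>{1..n}. card (A i)) = k + n}),
    bdry = (\<lambda>k A B. \<Sum>i\<in>{i \<in> {1..n}. card (A i) > 1}. \<Sum>b\<in>A i.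
        (- 1) ^ K_sign A i b * Var (i, b) * unit_vec (A(i := A i - {b})) B)\<rparr>"

text \<open>In degree \<open>0\<close> each \<open>A\<^sub>i\<close> is a singleton \<open>{a\<^sub>i}\<close>, and \<open>a\<^sub>i = Max A\<^sub>i\<close>.\<close>

definition K_tilde ::
    "nat \<Rightarrow> (nat \<Rightarrow> nat) \<Rightarrow> (nat \<Rightarrow> nat) set
      \<Rightarrow> ((nat \<Rightarrow> nat set) option, (nat \<times> nat, 'k::comm_ring_1) mpoly) based_complex"
  where "K_tilde n d P = augment (K_complex n d P) (\<lambda>A. \<Prod>i\<in>{1..n}. Var (i, Max (A i)))"

text \<open>The structure map \<open>T \<rightarrow> S\<close>.\<close>

definition T_to_S ::
    "('k::field \<Rightarrow> 'v::ab_group_add \<Rightarrow> 'v) \<Rightarrow> ('x::finite \<Rightarrow> 'v) \<Rightarrow> (nat \<Rightarrow> nat \<Rightarrow> 'v)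
      \<Rightarrow> (nat \<times> nat, 'k) mpoly \<Rightarrow> ('x, 'k) mpoly"
  where "T_to_S s bas f = subst (\<lambda>(i, j). linear_form s bas (f i j))"

end

theory Submission
  imports Defs "HOL-Library.Product_Lexorder" "Jordan_Normal_Form.Determinant"
begin

text \<open>
  Write \<open>D\<close> for the box \<open>[d\<^sub>1] \<times> \<dots> \<times> [d\<^sub>n]\<close>, \<open>f\<^sub>a\<close> for the product \<open>f\<^bsub>1 a\<^sub>1\<^esub> \<dots> f\<^bsub>n a\<^sub>n\<^esub>\<close> and \<open>L\<^sub>a\<close> for
  the ideal generated by the \<open>f\<^sub>i\<^sub>j\<close> with \<open>j < a\<^sub>i\<close>.  The proof has three ingredients.

  \<^emph>\<open>Acyclicity\<close> (\<open>poset_ideal_acyclic\<close>).  Build a poset ideal \<open>P\<close> by adding its elements one at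
  a time.  If \<open>a\<close> is maximal in \<open>P\<close>, the quotient of \<open>\<K>\<^sub>P\<close> by \<open>\<K>\<^bsub>P - {a}\<^esub>\<close> is the Koszul complex of
  the generators of \<open>L\<^sub>a\<close>.  After base change to \<open>S\<close> it is exact in positive degrees when these
  linear forms are independent.  In degree \<open>0\<close> one needs that \<open>c f\<^sub>a\<close> can be a combination of the
  \<open>f\<^sub>b\<close>, \<open>b \<in> P - {a}\<close>, only for \<open>c \<in> L\<^sub>a\<close>.  All these \<open>f\<^sub>b\<close> lie in \<open>L\<^sub>a\<close>, so it is enough that every
  \<open>f\<^bsub>i a\<^sub>i\<^esub>\<close> is a nonzerodivisor modulo \<open>L\<^sub>a\<close>, which holds if \<open>f\<^bsub>i a\<^sub>i\<^esub>\<close> together with the generators of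
  \<open>L\<^sub>a\<close> is independent (\<open>linear_form_regular\<close>).

  \<^emph>\<open>Genericity\<close> (\<open>generic_bases_independent\<close>).  By Rado's theorem one can choose \<open>b\<^sub>i\<close> vectors in
  each \<open>V\<^sub>i\<close>, all independent together, if \<open>\<Sum>\<^sub>T b\<^sub>i \<le> rk T\<close> for all sets \<open>T\<close> of rows; maximality of
  the \<open>dim W\<^sub>b\<close> then makes the \<open>f\<^sub>i\<^sub>j\<close> with \<open>j \<le> b\<^sub>i\<close> independent.  For \<open>a \<in> D\<^sub>\<V>\<close> the inequalities hold
  for \<open>b = a - 1\<close> even after one \<open>b\<^sub>i\<close> is increased by one, which is what acyclicity asks for.

  \<^emph>\<open>Generators\<close> (\<open>box_prod_lower\<close>).  The ideal \<open>J\<close> is generated by all \<open>f\<^sub>a\<close>, \<open>a \<in> D\<close>, whereas the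
  complex resolves the quotient by the ideal of those with \<open>a \<in> D\<^sub>\<V>\<close>.  If \<open>a \<notin> D\<^sub>\<V>\<close>, then for some
  set \<open>T\<close> of rows the \<open>f\<^sub>k\<^sub>j\<close> with \<open>k \<in> T\<close>, \<open>j < a\<^sub>k\<close> span \<open>\<Sum>\<^sub>T V\<^sub>k\<close>, so that
  \<open>f\<^bsub>i a\<^sub>i\<^esub> = \<Sum>\<^sub>k p\<^sub>i\<^sub>k\<close> for \<open>i \<in> T\<close>, with \<open>p\<^sub>i\<^sub>k\<close> a combination of the \<open>f\<^sub>k\<^sub>j\<close>, \<open>j < a\<^sub>k\<close>.  The matrix
  \<open>diag(f\<^bsub>i a\<^sub>i\<^esub>) - (p\<^sub>i\<^sub>k)\<close> has zero row sums, and expanding its vanishing determinant expresses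
  \<open>f\<^sub>a\<close> by products \<open>f\<^sub>b\<close> with \<open>b < a\<close>.  By induction \<open>J\<close> is generated by the \<open>f\<^sub>a\<close> with \<open>a \<in> D\<^sub>\<V>\<close>.

  To handle signs and the identity \<open>\<partial> \<circ> \<partial> = 0\<close> uniformly, \<open>e\<^sub>A\<close> is encoded by the set of all
  \<open>(i, j)\<close> with \<open>j \<in> A\<^sub>i\<close>, ordered lexicographically.  Up to rescaling the variables by signs, \<open>\<K>\<^sub>D\<close>
  is then the Koszul complex of all variables, truncated to the sets that meet every row.
\<close>

section \<open>Ideals\<close>

interpretation ideal: Modules.module "(*) :: 'r::comm_ring_1 \<Rightarrow> 'r \<Rightarrow> 'r"
  by unfold_locales (simp_all add: algebra_simps)

lemma ideal_gen_base: "x \<in> X \<Longrightarrow> x \<in> ideal_gen X"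
  unfolding ideal_gen_def by (rule ideal.span_base)

lemma ideal_gen_zero: "0 \<in> ideal_gen X"
  unfolding ideal_gen_def by (rule ideal.span_zero)

lemma ideal_gen_add: "x \<in> ideal_gen X \<Longrightarrow> y \<in> ideal_gen X \<Longrightarrow> x + y \<in> ideal_gen X"
  unfolding ideal_gen_def by (rule ideal.span_add)

lemma ideal_gen_diff: "x \<in> ideal_gen X \<Longrightarrow> y \<in> ideal_gen X \<Longrightarrow> x - y \<in> ideal_gen X"
  unfolding ideal_gen_def by (rule ideal.span_diff)

lemma ideal_gen_mult: "x \<in> ideal_gen X \<Longrightarrow> r * x \<in> ideal_gen X"
  unfolding ideal_gen_def by (rule ideal.span_scale)

lemma ideal_gen_mult_right: "x \<in> ideal_gen X \<Longrightarrow> x * r \<in> ideal_gen X"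
  using ideal_gen_mult[of x X r] by (simp add: mult.commute)

lemma ideal_gen_sum: "(\<And>i. i \<in> I \<Longrightarrow> g i \<in> ideal_gen X) \<Longrightarrow> sum g I \<in> ideal_gen X"
  unfolding ideal_gen_def by (rule ideal.span_sum)

lemma ideal_gen_mono: "X \<subseteq> Y \<Longrightarrow> ideal_gen X \<subseteq> ideal_gen Y"
  unfolding ideal_gen_def by (rule ideal.span_mono)

lemma ideal_gen_subset: "X \<subseteq> ideal_gen Y \<Longrightarrow> ideal_gen X \<subseteq> ideal_gen Y"
  unfolding ideal_gen_def by (rule ideal.span_minimal) auto

lemma ideal_gen_prod:
  assumes "finite I" and "i \<in> I" and "g i \<in> ideal_gen X"
  shows "prod g I \<in> ideal_gen X"
  using assms by (simp add: prod.remove ideal_gen_mult_right)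

lemma ideal_gen_image_iff:
  assumes "finite E"
  shows "c \<in> ideal_gen (g ` E) \<longleftrightarrow> (\<exists>w. c = (\<Sum>e\<in>E. w e * g e))"
proof
  assume "c \<in> ideal_gen (g ` E)"
  then obtain u where c: "c = (\<Sum>v\<in>g ` E. u v * v)"
    using assms unfolding ideal_gen_def by (auto simp: ideal.span_finite)
  \<comment> \<open>choose one index for every value of \<open>g\<close>\<close>
  define w where "w e = (if e = inv_into E g (g e) then u (g e) else 0)" for e
  have "(\<Sum>e\<in>E. w e * g e) = (\<Sum>e\<in>inv_into E g ` g ` E. w e * g e)"
    using assms by (intro sum.mono_neutral_right) (auto simp: w_def inv_into_into)
  also have "\<dots> = (\<Sum>v\<in>g ` E. w (inv_into E g v) * g (inv_into E g v))"
    by (intro sum.reindex_cong[OF _ refl refl] inj_on_inv_into) simp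
  also have "\<dots> = c"
    unfolding c by (intro sum.cong refl) (simp add: w_def f_inv_into_f)
  finally show "\<exists>w. c = (\<Sum>e\<in>E. w e * g e)" by metis
next
  assume "\<exists>w. c = (\<Sum>e\<in>E. w e * g e)"
  then show "c \<in> ideal_gen (g ` E)"
    by (auto intro!: ideal_gen_sum intro: ideal_gen_mult ideal_gen_base)
qed

text \<open>By bilinearity, one factor at a time.\<close>

lemma prod_mem_ideal_gen:
  assumes "finite I" and "\<And>i. i \<in> I \<Longrightarrow> q i \<in> ideal_gen (X i)"
  shows "prod q I \<in> ideal_gen {\<Prod>i\<in>I. g i | g. \<forall>i\<in>I. g i \<in> X i}"
  using assms
proof (induction I rule: finite_induct)
  case empty
  then show ?case by (auto intro: ideal_gen_base)
next
  case (insert j I)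
  let ?G = "\<lambda>I. {\<Prod>i\<in>I. g i | g. \<forall>i\<in>I. g i \<in> X i}"
  have gen: "x * y \<in> ideal_gen (?G (insert j I))" if x: "x \<in> X j" and y: "y \<in> ?G I" for x y
  proof -
    obtain g where g: "y = prod g I" "\<forall>i\<in>I. g i \<in> X i" using y by blast
    have "prod (g(j := x)) I = prod g I"
      using insert.hyps by (intro prod.cong) auto
    then have "x * y = prod (g(j := x)) (insert j I)"
      using insert.hyps g by simp
    moreover have "\<forall>i\<in>insert j I. (g(j := x)) i \<in> X i" using g x by simp
    ultimately show ?thesis by (intro ideal_gen_base) blast
  qed
  have mult_gen: "x * y \<in> ideal_gen (?G (insert j I))"
    if x: "x \<in> X j" and y: "y \<in> ideal_gen (?G I)" for x y
    using y unfolding ideal_gen_def[of "?G I"]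
  proof (induction rule: ideal.span_induct_alt)
    case base show ?case by (simp only: mult_zero_right mult_zero_left ideal_gen_zero)
  next
    case (step c a b)
    have "c * (x * a) + x * b \<in> ideal_gen (?G (insert j I))"
      by (rule ideal_gen_add[OF ideal_gen_mult[OF gen[OF x step(1)]] step(2)])
    moreover have "c * (x * a) + x * b = x * (c * a + b)" by (simp only: algebra_simps)
    ultimately show ?case by (simp only:)
  qed
  have "x * y \<in> ideal_gen (?G (insert j I))"
    if x: "x \<in> ideal_gen (X j)" and y: "y \<in> ideal_gen (?G I)" for x y
    using x unfolding ideal_gen_def[of "X j"]
  proof (induction rule: ideal.span_induct_alt)
    case base show ?case by (simp only: mult_zero_right mult_zero_left ideal_gen_zero)
  next
    case (step c a b)
    have "c * (a * y) + b * y \<in> ideal_gen (?G (insert j I))"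
      by (rule ideal_gen_add[OF ideal_gen_mult[OF mult_gen[OF step(1) y]] step(2)])
    moreover have "c * (a * y) + b * y = (c * a + b) * y" by (simp only: algebra_simps)
    ultimately show ?case by (simp only:)
  qed
  then show ?case using insert by simp
qed

section \<open>Polynomial rings and linear forms\<close>

lemma Const_mult: "Const (a * b :: 'k::comm_ring_1) = Const a * Const b"
  by (simp add: Const_def mult_single)

lemma Const_add: "Const (a + b) = Const a + Const b"
  by (simp add: Const_def single_add)

lemma Const_0: "Const 0 = 0" and Const_1: "Const (1 :: 'k::comm_ring_1) = 1"
  by (simp_all add: Const_def)

lemma lookup_Const_mult:
  "Poly_Mapping.lookup (Const (a :: 'k::comm_ring_1) * p) m = a * Poly_Mapping.lookup p m"
  using mult_map_scale_conv_mult[of a p]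
  by (simp add: Const_def Poly_Mapping.map.rep_eq when_def flip: mult_map_scale_conv_mult)

lemma poly_mapping_eq_sum_single:
  "(p :: 'a \<Rightarrow>\<^sub>0 'b::comm_monoid_add)
     = (\<Sum>m\<in>Poly_Mapping.keys p. Poly_Mapping.single m (Poly_Mapping.lookup p m))"
  by (rule poly_mapping_eqI)
    (simp add: lookup_sum lookup_single when_def sum.delta in_keys_iff)

text \<open>The value at \<open>g\<close> of a monomial, the factor that \<^const>\<open>subst\<close> attaches to its coefficient.\<close>

definition mono_val :: "('y \<Rightarrow> 'r::comm_ring_1) \<Rightarrow> ('y \<Rightarrow>\<^sub>0 nat) \<Rightarrow> 'r"
  where "mono_val g m = (\<Prod>y\<in>Poly_Mapping.keys m. g y ^ Poly_Mapping.lookup m y)"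

lemma mono_val_superset:
  "finite Y \<Longrightarrow> Poly_Mapping.keys m \<subseteq> Y \<Longrightarrow> mono_val g m = (\<Prod>y\<in>Y. g y ^ Poly_Mapping.lookup m y)"
  unfolding mono_val_def by (rule prod.mono_neutral_left) (auto simp: in_keys_iff)

lemma mono_val_add: "mono_val g (m + m') = mono_val g m * mono_val g m'"
proof -
  let ?Y = "Poly_Mapping.keys m \<union> Poly_Mapping.keys m'"
  have "mono_val g (m + m') = (\<Prod>y\<in>?Y. g y ^ Poly_Mapping.lookup (m + m') y)"
    by (rule mono_val_superset) (auto dest: set_mp[OF keys_add])
  moreover have "mono_val g m = (\<Prod>y\<in>?Y. g y ^ Poly_Mapping.lookup m y)"
    "mono_val g m' = (\<Prod>y\<in>?Y. g y ^ Poly_Mapping.lookup m' y)"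
    by (rule mono_val_superset; auto)+
  ultimately show ?thesis by (simp add: lookup_add power_add prod.distrib)
qed

lemma subst_superset:
  assumes "finite M" and "Poly_Mapping.keys p \<subseteq> M"
  shows "subst g p = (\<Sum>m\<in>M. Const (Poly_Mapping.lookup p m) * mono_val g m)"
  unfolding subst_def mono_val_def[symmetric]
  using assms by (intro sum.mono_neutral_left) (auto simp: in_keys_iff Const_0)

lemma subst_single: "subst g (Poly_Mapping.single m c) = Const c * mono_val g m"
  using subst_superset[of "{m}" "Poly_Mapping.single m c" g] by simp

lemma subst_add: "subst g (p + q) = subst g p + subst g q"
proof -
  let ?M = "Poly_Mapping.keys p \<union> Poly_Mapping.keys q"
  have "subst g (p + q) = (\<Sum>m\<in>?M. Const (Poly_Mapping.lookup (p + q) m) * mono_val g m)"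
    by (rule subst_superset) (auto dest: set_mp[OF keys_add])
  moreover have "subst g p = (\<Sum>m\<in>?M. Const (Poly_Mapping.lookup p m) * mono_val g m)"
    "subst g q = (\<Sum>m\<in>?M. Const (Poly_Mapping.lookup q m) * mono_val g m)"
    by (rule subst_superset; auto)+
  ultimately show ?thesis by (simp add: lookup_add Const_add distrib_right sum.distrib)
qed

lemma subst_0: "subst g 0 = 0"
  by (simp add: subst_def)

lemma subst_uminus: "subst g (- p) = - subst g p"
  using subst_add[of g p "- p"] by (simp add: subst_0 eq_neg_iff_add_eq_0 add.commute)

lemma subst_sum: "subst g (sum h I) = (\<Sum>i\<in>I. subst g (h i))"
  by (induction I rule: infinite_finite_induct) (simp_all add: subst_add subst_0)

lemma subst_mult: "subst g (p * q) = subst g p * subst g q"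
proof -
  let ?t = "\<lambda>p m. Poly_Mapping.single m (Poly_Mapping.lookup p m)"
  have "subst g (p * q) = subst g ((\<Sum>m\<in>Poly_Mapping.keys p. ?t p m) * (\<Sum>m\<in>Poly_Mapping.keys q. ?t q m))"
    by (simp flip: poly_mapping_eq_sum_single)
  also have "\<dots> = (\<Sum>m\<in>Poly_Mapping.keys p. \<Sum>m'\<in>Poly_Mapping.keys q. subst g (?t p m * ?t q m'))"
    by (simp add: sum_product subst_sum)
  also have "\<dots> = (\<Sum>m\<in>Poly_Mapping.keys p. \<Sum>m'\<in>Poly_Mapping.keys q.
      subst g (?t p m) * subst g (?t q m'))"
    by (simp only: mult_single subst_single mono_val_add Const_mult mult_ac)
  also have "\<dots> = subst g (\<Sum>m\<in>Poly_Mapping.keys p. ?t p m) * subst g (\<Sum>m\<in>Poly_Mapping.keys q. ?t q m)"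
    by (simp add: sum_product subst_sum)
  finally show ?thesis by (simp flip: poly_mapping_eq_sum_single)
qed

lemma subst_Const: "subst g (Const c) = Const c"
  by (simp add: subst_single mono_val_def Const_def[of c])

lemma subst_1: "subst g 1 = 1"
  using subst_Const[of g 1] by (simp add: Const_1)

lemma subst_Var: "subst g (Var y) = g y"
  by (simp add: Var_def subst_single mono_val_def Const_1)

lemma subst_prod: "subst g (prod h I) = (\<Prod>i\<in>I. subst g (h i))"
  by (induction I rule: infinite_finite_induct) (simp_all add: subst_mult subst_1)

text \<open>
  Substituting the variables for themselves returns \<open>p\<close>, and it displays the result as a sum of
  products of constants and variables.
\<close>

lemma mpoly_induct [case_names Const Var add mult]:
  fixes p :: "('x, 'k::comm_ring_1) mpoly"
  assumes C: "\<And>c. Q (Const c)" and V: "\<And>x. Q (Var x)"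
    and A: "\<And>p q. Q p \<Longrightarrow> Q q \<Longrightarrow> Q (p + q)" and M: "\<And>p q. Q p \<Longrightarrow> Q q \<Longrightarrow> Q (p * q)"
  shows "Q p"
proof -
  have S: "Q (sum h I)" if "\<And>i. i \<in> I \<Longrightarrow> Q (h i)" for h and I :: "('x \<Rightarrow>\<^sub>0 nat) set"
    using that C[of 0] by (induction I rule: infinite_finite_induct) (auto simp: Const_0 A)
  have P: "Q (prod h I)" if "\<And>i. i \<in> I \<Longrightarrow> Q (h i)" for h and I :: "'x set"
    using that C[of 1] by (induction I rule: infinite_finite_induct) (auto simp: Const_1 M)
  have W: "Q (q ^ n)" if "Q q" for q n
    using that C[of 1] by (induction n) (auto simp: Const_1 M)
  have "subst Var p = p"
  proof -
    have pw: "Var x ^ k = (Poly_Mapping.single (Poly_Mapping.single x k) 1 :: ('x,'k) mpoly)" for x k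
      by (induction k) (simp_all add: Var_def mult_single flip: single_add)
    have mv: "mono_val Var m = Poly_Mapping.single m (1 :: 'k)" for m :: "'x \<Rightarrow>\<^sub>0 nat"
    proof -
      have "(\<Prod>y\<in>Y. Poly_Mapping.single (Poly_Mapping.single y (Poly_Mapping.lookup m y)) (1 :: 'k))
          = Poly_Mapping.single (\<Sum>y\<in>Y. Poly_Mapping.single y (Poly_Mapping.lookup m y)) 1" for Y
        by (induction Y rule: infinite_finite_induct) (simp_all add: mult_single)
      then show ?thesis
        unfolding mono_val_def pw by (simp flip: poly_mapping_eq_sum_single)
    qed
    have "subst Var p = (\<Sum>m\<in>Poly_Mapping.keys p. Poly_Mapping.single m (Poly_Mapping.lookup p m))"
      unfolding subst_def mono_val_def[symmetric] mv by (simp add: Const_def mult_single)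
    then show ?thesis by (simp flip: poly_mapping_eq_sum_single)
  qed
  moreover have "Q (subst Var p)"
    unfolding subst_def by (intro S M C P W V)
  ultimately show ?thesis by simp
qed

text \<open>
  Among the monomials of \<open>p\<close> let \<open>m\<close> be one with the largest exponent of \<open>x\<^sub>0\<close>.  Multiplying a
  monomial of \<open>p\<close> by a variable gives \<open>m + x\<^sub>0\<close> only for \<open>m\<close> and \<open>x\<^sub>0\<close>: for any other variable the
  monomial would have to contain \<open>x\<^sub>0\<close> once more than \<open>m\<close>.
\<close>

lemma linear_form_not_zero_divisor:
  fixes p :: "('x::finite, 'k::field) mpoly"
  assumes "(\<Sum>x\<in>UNIV. Const (a x) * Var x) * p = 0" and "a x\<^sub>0 \<noteq> 0"
  shows "p = 0"
proof (rule ccontr)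
  let ?l = "Poly_Mapping.lookup :: _ \<Rightarrow> 'x \<Rightarrow> nat" and ?e = "\<lambda>x::'x. Poly_Mapping.single x (1::nat)"
  assume "p \<noteq> 0"
  then have ne: "(\<lambda>m. ?l m x\<^sub>0) ` Poly_Mapping.keys p \<noteq> {}" by simp
  obtain m where m: "m \<in> Poly_Mapping.keys p" and
    max: "\<And>m'. m' \<in> Poly_Mapping.keys p \<Longrightarrow> ?l m' x\<^sub>0 \<le> ?l m x\<^sub>0"
    using Max_in[OF _ ne] Max_ge[of "(\<lambda>m. ?l m x\<^sub>0) ` Poly_Mapping.keys p"] by fastforce
  have shift: "Poly_Mapping.lookup (Var x * p) (m + ?e x\<^sub>0) = (Poly_Mapping.lookup p m when x = x\<^sub>0)" for x
  proof -
    have "Poly_Mapping.lookup (Var x * p) (m + ?e x\<^sub>0)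
        = (\<Sum>m'\<in>Poly_Mapping.keys p. Poly_Mapping.lookup (Var x * Poly_Mapping.single m' (Poly_Mapping.lookup p m')) (m + ?e x\<^sub>0))"
      by (subst (1) poly_mapping_eq_sum_single[of p]) (simp add: sum_distrib_left lookup_sum)
    also have "\<dots> = (\<Sum>m'\<in>Poly_Mapping.keys p. Poly_Mapping.lookup p m' when (x = x\<^sub>0 \<and> m' = m))"
    proof (rule sum.cong[OF refl])
      fix m' assume m': "m' \<in> Poly_Mapping.keys p"
      have "?e x + m' = m + ?e x\<^sub>0 \<longleftrightarrow> x = x\<^sub>0 \<and> m' = m"
      proof
        assume eq: "?e x + m' = m + ?e x\<^sub>0"
        have "x = x\<^sub>0"
        proof (rule ccontr)
          assume "x \<noteq> x\<^sub>0"
          then have "?l m' x\<^sub>0 = ?l m x\<^sub>0 + 1"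
            using arg_cong[OF eq, of "\<lambda>q. ?l q x\<^sub>0"] by (simp add: lookup_add lookup_single)
          then show False using max[OF m'] by simp
        qed
        then show "x = x\<^sub>0 \<and> m' = m" using eq by (simp add: add.commute)
      qed (simp add: add.commute)
      then show "Poly_Mapping.lookup (Var x * Poly_Mapping.single m' (Poly_Mapping.lookup p m')) (m + ?e x\<^sub>0)
        = (Poly_Mapping.lookup p m' when (x = x\<^sub>0 \<and> m' = m))"
        by (simp add: Var_def mult_single lookup_single)
    qed
    also have "\<dots> = (Poly_Mapping.lookup p m when x = x\<^sub>0)"
      using m by (cases "x = x\<^sub>0") (simp_all add: when_def sum.delta)
    finally show ?thesis .
  qed
  have "0 = Poly_Mapping.lookup ((\<Sum>x\<in>UNIV. Const (a x) * Var x) * p) (m + ?e x\<^sub>0)"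
    using assms(1) by simp
  also have "\<dots> = (\<Sum>x\<in>UNIV. a x * (Poly_Mapping.lookup p m when x = x\<^sub>0))"
    by (simp only: sum_distrib_right lookup_sum lookup_Const_mult mult.assoc shift)
  also have "\<dots> = a x\<^sub>0 * Poly_Mapping.lookup p m"
    by (simp add: mult_when) (simp add: when_def)
  finally show False using m assms(2) by (simp add: in_keys_iff)
qed

section \<open>Koszul complexes\<close>

text \<open>
  The Koszul complex of a family \<open>f e\<close>, \<open>e \<in> E\<close>: a chain is given by its coefficients \<open>z F\<close> at
  the basis elements \<open>e\<^sub>F\<close>, \<open>F \<subseteq> E\<close>, and the coefficient of the boundary at \<open>e\<^sub>F\<close> collects the
  contributions of the sets that become \<open>F\<close> when one element \<open>e\<close> is removed.  Writing the
  boundary by its coefficients spares all bookkeeping about supports.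
\<close>

definition kosz :: "('e::linorder \<Rightarrow> 'r::comm_ring_1) \<Rightarrow> 'e set \<Rightarrow> ('e set \<Rightarrow> 'r) \<Rightarrow> 'e set \<Rightarrow> 'r"
  where "kosz f E z F = (\<Sum>e\<in>E - F. (- 1) ^ card {c \<in> F. c < e} * f e * z (insert e F))"

lemma kosz_add: "kosz f E (\<lambda>F. z F + w F) F = kosz f E z F + kosz f E w F"
  by (simp add: kosz_def distrib_left sum.distrib)

lemma kosz_diff: "kosz f E (\<lambda>F. z F - w F) F = kosz f E z F - kosz f E w F"
  by (simp add: kosz_def right_diff_distrib sum_subtractf)

lemma kosz_cong:
  "(\<And>e. e \<in> E - F \<Longrightarrow> z (insert e F) = w (insert e F)) \<Longrightarrow> kosz f E z F = kosz f E w F"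
  unfolding kosz_def by (intro sum.cong) auto

lemma kosz_eq_0: "(\<And>e. e \<in> E - F \<Longrightarrow> z (insert e F) = 0) \<Longrightarrow> kosz f E z F = 0"
  unfolding kosz_def by (intro sum.neutral) auto

text \<open>
  The terms at \<open>(x, y)\<close> and \<open>(y, x)\<close> cancel.  Splitting the sum into \<open>x < y\<close> and \<open>y < x\<close> keeps the
  argument valid in characteristic two, where \<open>s = - s\<close> says nothing.
\<close>

lemma sum_antisymmetric_eq_0:
  fixes g :: "'e::linorder \<Rightarrow> 'e \<Rightarrow> 'r::ab_group_add"
  assumes "finite A" and anti: "\<And>x y. x \<in> A \<Longrightarrow> y \<in> A \<Longrightarrow> x < y \<Longrightarrow> g y x = - g x y"
  shows "(\<Sum>x\<in>A. \<Sum>y\<in>A - {x}. g x y) = 0"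
proof -
  have split: "(\<Sum>y\<in>A - {x}. g x y) = (\<Sum>y\<in>{y \<in> A. x < y}. g x y) + (\<Sum>y\<in>{y \<in> A. y < x}. g x y)" for x
  proof -
    have eq: "A - {x} = {y \<in> A. x < y} \<union> {y \<in> A. y < x}" by auto
    show ?thesis unfolding eq using assms(1) by (intro sum.union_disjoint) auto
  qed
  have "(\<Sum>x\<in>A. \<Sum>y\<in>{y \<in> A. y < x}. g x y) = (\<Sum>y\<in>A. \<Sum>x\<in>{x \<in> A. y < x}. g x y)"
    by (rule sum.swap_restrict[OF assms(1) assms(1)])
  also have "\<dots> = (\<Sum>y\<in>A. \<Sum>x\<in>{x \<in> A. y < x}. - g y x)"
    by (intro sum.cong refl) (use anti in auto)
  finally show ?thesis by (simp add: split sum.distrib sum_negf)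
qed

lemma kosz_kosz:
  assumes "finite E" and "F \<subseteq> E"
  shows "kosz f E (kosz f E z) F = 0"
proof -
  let ?s = "\<lambda>F e. (- 1) ^ card {c \<in> F. c < e} :: 'b"
  let ?g = "\<lambda>e e'. ?s F e * f e * (?s (insert e F) e' * f e' * z (insert e' (insert e F)))"
  have fin: "finite F" using assms finite_subset by blast
  have "kosz f E (kosz f E z) F = (\<Sum>e\<in>E - F. \<Sum>e'\<in>E - F - {e}. ?g e e')"
    by (simp only: kosz_def sum_distrib_left Diff_insert[of E _ F])
  also have "\<dots> = 0"
  proof (rule sum_antisymmetric_eq_0)
    fix e e' assume e: "e \<in> E - F" "e' \<in> E - F" "e < e'"
    have "{c \<in> insert e F. c < e'} = insert e {c \<in> F. c < e'}"
      "{c \<in> insert e' F. c < e} = {c \<in> F. c < e}" using e by auto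
    moreover have "e \<notin> {c \<in> F. c < e'}" using e by simp
    ultimately have s: "?s (insert e F) e' = - ?s F e'" "?s (insert e' F) e = ?s F e"
      using fin by simp_all
    show "?g e' e = - ?g e e'"
      unfolding s insert_commute[of e e' F] by (simp only: mult_ac mult_minus_left mult_minus_right minus_minus)
  qed (use assms in auto)
  finally show ?thesis .
qed

text \<open>
  Regularity is demanded in every order, so that it passes to subfamilies and elements may be
  split off the family freely.
\<close>

definition regular_family :: "('e \<Rightarrow> 'r::comm_ring_1) \<Rightarrow> 'e set \<Rightarrow> bool"
  where "regular_family f E \<longleftrightarrow>
    (\<forall>e\<in>E. \<forall>E'\<subseteq>E - {e}. \<forall>c. c * f e \<in> ideal_gen (f ` E') \<longrightarrow> c \<in> ideal_gen (f ` E'))"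

lemma regular_family_mono: "regular_family f E \<Longrightarrow> E' \<subseteq> E \<Longrightarrow> regular_family f E'"
  unfolding regular_family_def by blast

text \<open>
  The coefficients of \<open>c\<close> in terms of the generators form a chain of degree \<open>1\<close> with boundary \<open>c\<close>
  at the empty set.
\<close>

lemma kosz_degree_0:
  assumes "finite E" and "c \<in> ideal_gen (f ` E)"
  obtains w where "\<And>F. w F \<noteq> 0 \<Longrightarrow> F \<subseteq> E \<and> card F = 1"
    and "\<And>F. F \<subseteq> E \<Longrightarrow> kosz f E w F = (if F = {} then c else 0)"
proof -
  obtain u where u: "c = (\<Sum>e\<in>E. u e * f e)"
    using assms by (auto simp: ideal_gen_image_iff)
  define w where "w F = (if F \<subseteq> E \<and> card F = 1 then u (the_elem F) else 0)" for F
  have supp: "F \<subseteq> E \<and> card F = 1" if "w F \<noteq> 0" for F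
    using that by (auto simp: w_def split: if_splits)
  have "kosz f E w F = (if F = {} then c else 0)" if F: "F \<subseteq> E" for F
  proof (cases "F = {}")
    case True
    have "kosz f E w {} = (\<Sum>e\<in>E. f e * u e)"
      unfolding kosz_def by (intro sum.cong) (auto simp: w_def)
    then show ?thesis using True by (simp add: u mult.commute)
  next
    case False
    have fin: "finite F" using F assms(1) finite_subset by blast
    then have "card F \<noteq> 0" using False by simp
    then have "w (insert e F) = 0" if "e \<in> E - F" for e
      using supp[of "insert e F"] that fin by fastforce
    then have "kosz f E w F = 0" by (rule kosz_eq_0)
    then show ?thesis using False by simp
  qed
  with supp show ?thesis using that by blast
qed

text \<open>
  Induction on \<open>E\<close>.  With \<open>m\<close> the last element of \<open>E\<close>, a cycle is \<open>z\<^sub>0 + z\<^sub>1 \<and> e\<^sub>m\<close> with \<open>z\<^sub>1\<close> a cycle of smaller degree on \<open>E - {m}\<close>.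
  Subtracting the boundary of a multiple of \<open>e\<^sub>m\<close> removes \<open>z\<^sub>1\<close>: by induction in positive degree,
  and in degree \<open>0\<close> because \<open>z\<^sub>1\<close> times \<open>f m\<close> is then a combination of the other \<open>f e\<close>.
\<close>

lemma kosz_exact:
  fixes f :: "'e::linorder \<Rightarrow> 'r::comm_ring_1"
  assumes "finite E" and "regular_family f E" and "k > 0"
    and "\<And>F. z F \<noteq> 0 \<Longrightarrow> F \<subseteq> E \<and> card F = k"
    and "\<And>F. F \<subseteq> E \<Longrightarrow> kosz f E z F = 0"
  obtains w where "\<And>F. w F \<noteq> 0 \<Longrightarrow> F \<subseteq> E \<and> card F = Suc k"
    and "\<And>F. F \<subseteq> E \<Longrightarrow> kosz f E w F = z F"
proof -
  have "\<exists>w. (\<forall>F. w F \<noteq> 0 \<longrightarrow> F \<subseteq> E \<and> card F = Suc k) \<and> (\<forall>F\<subseteq>E. kosz f E w F = z F)"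
    using assms
  proof (induction E arbitrary: k z rule: finite_linorder_max_induct)
    case empty
    then have "z F = 0" for F by fastforce
    then show ?case by (intro exI[of _ "\<lambda>_. 0"]) (simp add: kosz_def)
  next
    case (insert m E k z)
    note supp = insert.prems(3) and cyc = insert.prems(4)
    have m: "m \<notin> E" using insert.hyps by blast
    have regE: "regular_family f E"
      using insert.prems(1) by (rule regular_family_mono) auto
    \<comment> \<open>the boundary on \<open>E \<union> {m}\<close> in terms of the boundary on \<open>E\<close>\<close>
    have step0: "kosz f (insert m E) y F = kosz f E y F + (- 1) ^ card F * f m * y (insert m F)"
      if F: "F \<subseteq> E" for y F
    proof -
      have "insert m E - F = insert m (E - F)" using F m by auto
      moreover have "{c \<in> F. c < m} = F" using F insert.hyps by auto
      ultimately show ?thesis using insert.hyps m by (simp add: kosz_def add.commute)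
    qed
    have step1: "kosz f (insert m E) y (insert m F) = kosz f E (\<lambda>F. y (insert m F)) F"
      if F: "F \<subseteq> E" for y F
    proof -
      have "{c \<in> insert m F. c < e} = {c \<in> F. c < e}" if "e \<in> E" for e
        using insert.hyps that by auto
      moreover have "insert m E - insert m F = E - F" using F m by auto
      ultimately show ?thesis unfolding kosz_def by (auto intro!: sum.cong simp: insert_commute)
    qed
    let ?z1 = "\<lambda>F. if F \<subseteq> E then z (insert m F) else 0"
    have z1_supp: "F \<subseteq> E \<and> card F = k - 1" if "?z1 F \<noteq> 0" for F
    proof -
      have F: "F \<subseteq> E" "z (insert m F) \<noteq> 0" using that by (auto split: if_splits)
      moreover have "finite F" "m \<notin> F" using F m insert.hyps finite_subset by blast+
      ultimately show ?thesis using supp[of "insert m F"] by auto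
    qed
    have z1_cyc: "kosz f E ?z1 F = 0" if F: "F \<subseteq> E" for F
    proof -
      have "kosz f E ?z1 F = kosz f E (\<lambda>F. z (insert m F)) F"
        using F by (intro kosz_cong) auto
      then show ?thesis using step1[OF F, of z] cyc[of "insert m F"] F by auto
    qed
    have "\<exists>w1. (\<forall>F. w1 F \<noteq> 0 \<longrightarrow> F \<subseteq> E \<and> card F = k) \<and> (\<forall>F\<subseteq>E. kosz f E w1 F = ?z1 F)"
    proof (cases "k = 1")
      case False
      then have "k - 1 > 0" "Suc (k - 1) = k" using insert.prems(2) by auto
      then show ?thesis using insert.IH[OF regE, of "k - 1" ?z1] z1_supp z1_cyc by auto
    next
      case True
      have "(z {m} * f m) = - kosz f E z {}"
        using step0[of "{}" z] cyc[of "{}"] by (simp add: eq_neg_iff_add_eq_0 mult.commute add.commute)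
      also have "\<dots> = (\<Sum>e\<in>E. - z {e} * f e)"
        by (simp add: kosz_def sum_negf mult.commute)
      also have "\<dots> \<in> ideal_gen (f ` E)"
        by (intro ideal_gen_sum ideal_gen_mult ideal_gen_base) auto
      finally have "z {m} * f m \<in> ideal_gen (f ` E)" .
      then have "z {m} \<in> ideal_gen (f ` E)"
        using insert.prems(1) m unfolding regular_family_def by blast
      then obtain w1 where w1: "\<And>F. w1 F \<noteq> 0 \<Longrightarrow> F \<subseteq> E \<and> card F = 1"
        "\<And>F. F \<subseteq> E \<Longrightarrow> kosz f E w1 F = (if F = {} then z {m} else 0)"
        using kosz_degree_0[OF insert.hyps(1)] by metis
      have "kosz f E w1 F = ?z1 F" if F: "F \<subseteq> E" for F
      proof (cases "F = {}")
        case False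
        then have "card F \<noteq> 0" using F insert.hyps finite_subset by fastforce
        then have "?z1 F = 0" using z1_supp[of F] True by (metis diff_self_eq_0)
        then show ?thesis using w1(2)[OF F] False by simp
      qed (use w1(2)[OF F] in simp)
      then show ?thesis using w1(1) True by blast
    qed
    then obtain w1 where w1: "\<And>F. w1 F \<noteq> 0 \<Longrightarrow> F \<subseteq> E \<and> card F = k"
      "\<And>F. F \<subseteq> E \<Longrightarrow> kosz f E w1 F = ?z1 F" by blast
    define v where "v F = (if m \<in> F then w1 (F - {m}) else 0)" for F
    have v_ins: "v (insert m F) = w1 F" if "F \<subseteq> E" for F
      proof -
      have "insert m F - {m} = F" using that m by auto
      then show ?thesis by (simp add: v_def)
    qed
    have v_supp: "F \<subseteq> insert m E \<and> card F = Suc k" if "v F \<noteq> 0" for F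
    proof -
      have F: "m \<in> F" "F - {m} \<subseteq> E" "card (F - {m}) = k"
        using that w1(1)[of "F - {m}"] by (auto simp: v_def split: if_splits)
      have "finite (F - {m})" using F insert.hyps finite_subset by blast
      then have "card F = Suc (card (F - {m}))" using F by (intro card.remove) auto
      then show ?thesis using F by auto
    qed
    define y where "y F = z F - kosz f (insert m E) v F" for F
    have y_m: "y (insert m F) = 0" if F: "F \<subseteq> E" for F
    proof -
      have "kosz f (insert m E) v (insert m F) = kosz f E w1 F"
        unfolding step1[OF F] using F v_ins by (intro kosz_cong) auto
      then show ?thesis using w1(2)[OF F] F by (simp add: y_def)
    qed
    let ?y = "\<lambda>F. if F \<subseteq> E then y F else 0"
    have y_supp: "F \<subseteq> E \<and> card F = k" if "?y F \<noteq> 0" for F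
    proof (rule ccontr)
      assume neg: "\<not> ?thesis"
      have F: "F \<subseteq> E" "y F \<noteq> 0" using that by (auto split: if_splits)
      then have "card F \<noteq> k" using neg by simp
      then have "z F = 0" using supp by blast
      moreover have "v (insert e F) = 0" if "e \<in> insert m E - F" for e
      proof -
        have "finite F" using F insert.hyps finite_subset by blast
        then show ?thesis using v_supp[of "insert e F"] that \<open>card F \<noteq> k\<close> by fastforce
      qed
      then have "kosz f (insert m E) v F = 0" by (rule kosz_eq_0)
      ultimately show False using F by (simp add: y_def)
    qed
    have y_cyc: "kosz f E ?y F = 0" if F: "F \<subseteq> E" for F
    proof -
      have "kosz f (insert m E) y F = 0"
        using F cyc[of F] kosz_kosz[of "insert m E" F f v] insert.hyps
        unfolding y_def kosz_diff by (simp add: subset_insertI2)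
      then have "kosz f E y F = 0" using step0[OF F] y_m[OF F] by simp
      moreover have "kosz f E ?y F = kosz f E y F" using F by (intro kosz_cong) auto
      ultimately show ?thesis by simp
    qed
    obtain w0 where w0: "\<And>F. w0 F \<noteq> 0 \<Longrightarrow> F \<subseteq> E \<and> card F = Suc k"
      "\<And>F. F \<subseteq> E \<Longrightarrow> kosz f E w0 F = ?y F"
      using insert.IH[OF regE insert.prems(2), of ?y] y_supp y_cyc by blast
    have w0_m: "w0 (insert m F) = 0" for F using w0(1)[of "insert m F"] m by auto
    let ?w = "\<lambda>F. w0 F + v F"
    have w_bd: "kosz f (insert m E) ?w F = z F" if F: "F \<subseteq> insert m E" for F
    proof (cases "m \<in> F")
      case False
      then have "F \<subseteq> E" using F by blast
      then show ?thesis using w0(2)[of F] w0_m by (simp add: kosz_add step0 y_def)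
    next
      case True
      then obtain G where G: "F = insert m G" "G \<subseteq> E" using F by (metis Diff_subset_conv insert_Diff insert_is_Un)
      have "kosz f (insert m E) w0 F = 0"
        unfolding G(1) step1[OF G(2)] by (rule kosz_eq_0) (simp add: w0_m)
      then show ?thesis using y_m[OF G(2)] G by (simp add: kosz_add y_def)
    qed
    have w_supp: "F \<subseteq> insert m E \<and> card F = Suc k" if "?w F \<noteq> 0" for F
    proof -
      from that have "w0 F \<noteq> 0 \<or> v F \<noteq> 0" by auto
      then show ?thesis using w0(1)[of F] v_supp[of F] by blast
    qed
    show ?case using w_bd w_supp by (intro exI[of _ ?w]) simp
  qed
  then show ?thesis using that by blast
qed

section \<open>Acyclicity of the complex of a poset ideal\<close>

definition grid :: "nat \<Rightarrow> (nat \<Rightarrow> nat) \<Rightarrow> (nat \<times> nat) set"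
  where "grid n d = Sigma {1..n} (\<lambda>i. {1..d i})"

definition below :: "nat \<Rightarrow> (nat \<Rightarrow> nat) \<Rightarrow> (nat \<times> nat) set"
  where "below n a = Sigma {1..n} (\<lambda>i. {1..<a i})"

definition graph_of :: "nat \<Rightarrow> (nat \<Rightarrow> nat) \<Rightarrow> (nat \<times> nat) set"
  where "graph_of n a = (\<lambda>i. (i, a i)) ` {1..n}"

text \<open>The multidegree \<open>(max A\<^sub>1, \<dots>, max A\<^sub>n)\<close> that decides membership in the complex.\<close>

definition row_tops :: "nat \<Rightarrow> (nat \<times> nat) set \<Rightarrow> nat \<Rightarrow> nat"
  where "row_tops n F = (\<lambda>i\<in>{1..n}. Max (F `` {i}))"

definition full :: "nat \<Rightarrow> (nat \<Rightarrow> nat) \<Rightarrow> (nat \<times> nat) set set"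
  where "full n d = {F. F \<subseteq> grid n d \<and> (\<forall>i\<in>{1..n}. F `` {i} \<noteq> {})}"

text \<open>
  The basis element \<open>e\<^sub>A\<close> is encoded by the set \<open>F\<close> of all \<open>(i, j)\<close> with \<open>j \<in> A\<^sub>i\<close>.
\<close>

definition cells :: "nat \<Rightarrow> (nat \<Rightarrow> nat) \<Rightarrow> (nat \<Rightarrow> nat) set \<Rightarrow> nat \<Rightarrow> (nat \<times> nat) set set"
  where "cells n d P k = {F \<in> full n d. row_tops n F \<in> P \<and> card F = k + n}"

text \<open>
  In the lexicographic order the elements of \<open>F\<close> before \<open>(i, b)\<close> number
  \<open>\<Sum>\<^bsub>j<i\<^esub> |A\<^sub>j| + |{c \<in> A\<^sub>i. c < b}|\<close>, which exceeds \<open>\<sigma>(i, b)\<close> by \<open>i - 1\<close>.  Rescaling row \<open>i\<close> by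
  \<open>(-1)\<^bsup>i-1\<^esup>\<close> therefore exhibits \<open>\<K>\<^sub>D\<close> as the quotient of the Koszul complex of all the
  variables by the subcomplex of the \<open>e\<^sub>F\<close> for which \<open>F\<close> misses a row.
\<close>

definition row_signed :: "(nat \<times> nat \<Rightarrow> 'r::comm_ring_1) \<Rightarrow> nat \<times> nat \<Rightarrow> 'r"
  where "row_signed f = (\<lambda>(i, j). (- 1) ^ (i - 1) * f (i, j))"

text \<open>The augmentation: in degree \<open>0\<close> the basis elements are the graphs of the \<open>a\<close>.\<close>

definition aug :: "nat \<Rightarrow> (nat \<Rightarrow> nat) \<Rightarrow> (nat \<times> nat \<Rightarrow> 'r::comm_ring_1) \<Rightarrow> ((nat \<times> nat) set \<Rightarrow> 'r) \<Rightarrow> 'r"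
  where "aug n d f z = (\<Sum>a\<in>D_box n d. z (graph_of n a) * (\<Prod>i\<in>{1..n}. f (i, a i)))"

lemma finite_grid [simp]: "finite (grid n d)" and finite_below [simp]: "finite (below n a)"
  and finite_graph_of [simp]: "finite (graph_of n a)"
  by (auto simp: grid_def below_def graph_of_def)

lemma finite_D_box [simp]: "finite (D_box n d)"
  unfolding D_box_def by (intro finite_PiE) auto

lemma D_box_mem: "a \<in> D_box n d \<Longrightarrow> i \<in> {1..n} \<Longrightarrow> a i \<in> {1..d i}"
  unfolding D_box_def by (rule PiE_mem)

lemma D_box_update:
  assumes "a \<in> D_box n d" and "i \<in> {1..n}" and "b \<in> {1..d i}"
  shows "a(i := b) \<in> D_box n d"
  unfolding D_box_def
proof (rule PiE_I)
  fix j assume j: "j \<in> {1..n}"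
  show "(a(i := b)) j \<in> {1..d j}"
  proof (cases "j = i")
    case True
    then show ?thesis using assms(3) by simp
  next
    case False
    then show ?thesis using D_box_mem[OF assms(1) j] by simp
  qed
next
  fix j assume j: "j \<notin> {1..n}"
  then have "j \<noteq> i" using assms(2) by blast
  then show "(a(i := b)) j = undefined"
    using PiE_arb[OF assms(1)[unfolded D_box_def] j] by simp
qed

lemma card_graph_of: "card (graph_of n a) = n"
  unfolding graph_of_def by (subst card_image) (auto simp: inj_on_def)

lemma below_Int_graph_of: "below n a \<inter> graph_of n a = {}"
  by (auto simp: below_def graph_of_def)

lemma fullD: "F \<in> full n d \<Longrightarrow> F \<subseteq> grid n d" "F \<in> full n d \<Longrightarrow> finite F"
  by (auto simp: full_def intro: finite_subset[OF _ finite_grid])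

lemma full_row: "F \<in> full n d \<Longrightarrow> i \<in> {1..n} \<Longrightarrow> F `` {i} \<noteq> {}"
  unfolding full_def by blast

lemma full_insert: "F \<in> full n d \<Longrightarrow> e \<in> grid n d \<Longrightarrow> insert e F \<in> full n d"
  by (auto simp: full_def)

lemma finite_row: "finite F \<Longrightarrow> finite (F `` {i})"
  by (rule finite_Image)

lemma row_tops_in_D_box:
  assumes "F \<in> full n d"
  shows "row_tops n F \<in> D_box n d"
proof -
  have "Max (F `` {i}) \<in> {1..d i}" if "i \<in> {1..n}" for i
  proof -
    have "Max (F `` {i}) \<in> F `` {i}"
      using full_row[OF assms that] fullD(2)[OF assms] by (intro Max_in finite_row)
    then show ?thesis using assms by (auto simp: full_def grid_def)
  qed
  then show ?thesis by (auto simp: row_tops_def D_box_def)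
qed

lemma row_tops_insert_le:
  assumes "F \<in> full n d" and "e \<in> grid n d"
  shows "row_tops n F \<le> row_tops n (insert e F)"
proof (rule le_funI)
  fix i
  show "row_tops n F i \<le> row_tops n (insert e F) i"
  proof (cases "i \<in> {1..n}")
    case True
    have "Max (F `` {i}) \<le> Max (insert e F `` {i})"
      using full_row[OF assms(1) True] fullD(2)[OF assms(1)] by (intro Max_mono finite_row) auto
    then show ?thesis using True by (simp add: row_tops_def)
  qed (simp only: row_tops_def restrict_apply simp_thms if_False order_refl)
qed

text \<open>
  With \<open>cell_decomp\<close> below, this identifies the cells with row tops \<open>a\<close> with the subsets of
  \<open>below n a\<close>, the basis of a Koszul complex.
\<close>

lemma
  assumes a: "a \<in> D_box n d" and B: "B \<subseteq> below n a"
  shows cell_full: "B \<union> graph_of n a \<in> full n d"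
    and cell_tops: "row_tops n (B \<union> graph_of n a) = a"
    and cell_card: "card (B \<union> graph_of n a) = card B + n"
proof -
  have ai: "a i \<in> {1..d i}" if "i \<in> {1..n}" for i using a that by (auto simp: D_box_def)
  show "B \<union> graph_of n a \<in> full n d"
    using B ai by (fastforce simp: full_def grid_def below_def graph_of_def)
  have "Max ((B \<union> graph_of n a) `` {i}) = a i" if "i \<in> {1..n}" for i
    using B that finite_subset[OF B finite_below]
    by (intro Max_eqI finite_row) (auto simp: below_def graph_of_def)
  then show "row_tops n (B \<union> graph_of n a) = a"
    using a by (auto simp: row_tops_def D_box_def fun_eq_iff PiE_def extensional_def)
  have "card (B \<union> graph_of n a) = card B + card (graph_of n a)"
    using B below_Int_graph_of[of n a] finite_subset[OF B finite_below]
    by (intro card_Un_disjoint) auto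
  then show "card (B \<union> graph_of n a) = card B + n" by (simp add: card_graph_of)
qed

lemma cell_decomp:
  assumes F: "F \<in> full n d" and a: "a = row_tops n F"
  shows "graph_of n a \<subseteq> F" and "F - graph_of n a \<subseteq> below n a"
proof -
  have max: "a i \<in> F `` {i} \<and> (\<forall>b\<in>F `` {i}. b \<le> a i)" if "i \<in> {1..n}" for i
    using that finite_row[OF fullD(2)[OF F], of i] Max_in[OF _ full_row[OF F that]]
    by (simp add: a row_tops_def)
  show "graph_of n a \<subseteq> F" using max by (auto simp: graph_of_def)
  show "F - graph_of n a \<subseteq> below n a"
  proof
    fix e assume e: "e \<in> F - graph_of n a"
    then obtain i b where ib: "e = (i, b)" "i \<in> {1..n}" "b \<in> {1..d i}"
      using fullD(1)[OF F] by (auto simp: grid_def)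
    then have "b \<le> a i" "b \<noteq> a i" using e max[of i] by (auto simp: graph_of_def)
    then show "e \<in> below n a" using ib by (auto simp: below_def)
  qed
qed

lemma card_graph_of_before:
  assumes "i \<in> {1..n}" and "b \<noteq> a i"
  shows "card {c \<in> graph_of n a. c < (i, b)} = (i - 1) + (if a i < b then 1 else 0)"
proof -
  have "{c \<in> graph_of n a. c < (i, b)} = (\<lambda>j. (j, a j)) ` ({1..<i} \<union> (if a i < b then {i} else {}))"
    using assms by (auto simp: graph_of_def less_prod_def' image_iff)
  moreover have "card \<dots> = card ({1..<i} \<union> (if a i < b then {i} else {}))"
    by (rule card_image) (auto simp: inj_on_def)
  ultimately show ?thesis by simp
qed

text \<open>
  The quotient of \<open>\<K>\<^sub>P\<close> by \<open>\<K>\<^bsub>P - {a}\<^esub>\<close>, for \<open>a\<close> maximal in \<open>P\<close>, is the Koszul complex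
  of the \<open>f (i, j)\<close> with \<open>j < a i\<close>.  Adding an element of row \<open>i\<close> beyond \<open>a i\<close> would raise the row
  tops, and the \<open>i - 1\<close> elements of the graph in earlier rows undo the sign of \<^const>\<open>row_signed\<close>.
\<close>

lemma kosz_top_layer:
  fixes f :: "nat \<times> nat \<Rightarrow> 'r::comm_ring_1"
  assumes a: "a \<in> D_box n d" and B: "B \<subseteq> below n a"
    and supp: "\<And>F. y F \<noteq> 0 \<Longrightarrow> F \<in> full n d \<and> \<not> a < row_tops n F"
  shows "kosz (row_signed f) (grid n d) y (B \<union> graph_of n a)
    = kosz f (below n a) (\<lambda>B. y (B \<union> graph_of n a)) B"
proof -
  let ?F = "B \<union> graph_of n a"
  note F = cell_full[OF a B] and tops = cell_tops[OF a B]
  have finB: "finite B" using finite_subset[OF B finite_below] .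
  have sub: "below n a - B \<subseteq> grid n d - ?F"
    using a below_Int_graph_of[of n a] by (fastforce simp: below_def grid_def D_box_def)
  have vanish: "y (insert e ?F) = 0" if e: "e \<in> grid n d - ?F - (below n a - B)" for e
  proof (rule ccontr)
    assume "y (insert e ?F) \<noteq> 0"
    then have "\<not> a < row_tops n (insert e ?F)" using supp by blast
    moreover have "a \<le> row_tops n (insert e ?F)"
      using row_tops_insert_le[OF F, of e] e tops by auto
    ultimately have eq: "a = row_tops n (insert e ?F)" by (simp add: less_le)
    have "e \<in> grid n d" using e by simp
    then have "insert e ?F - graph_of n a \<subseteq> below n a"
      using cell_decomp(2)[OF full_insert[OF F] eq] by blast
    then show False using e by blast
  qed
  have sign: "(- 1) ^ card {c \<in> ?F. c < e} * row_signed f e = (- 1) ^ card {c \<in> B. c < e} * f e"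
    if e: "e \<in> below n a - B" for e
  proof -
    obtain i b where ib: "e = (i, b)" "i \<in> {1..n}" "b < a i" using e by (auto simp: below_def)
    have "{c \<in> ?F. c < e} = {c \<in> B. c < e} \<union> {c \<in> graph_of n a. c < e}" by auto
    moreover have "card \<dots> = card {c \<in> B. c < e} + card {c \<in> graph_of n a. c < e}"
      using B finB below_Int_graph_of[of n a] by (intro card_Un_disjoint) auto
    ultimately have "card {c \<in> ?F. c < e} = card {c \<in> B. c < e} + (i - 1)"
      using card_graph_of_before[of i n b a] ib by simp
    moreover have "(- 1 :: 'r) ^ (i - 1) * (- 1) ^ (i - 1) = 1" by (simp flip: power_mult_distrib)
    ultimately show ?thesis
      by (simp add: row_signed_def ib power_add mult.assoc[symmetric]) (simp add: mult.assoc)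
  qed
  have "kosz (row_signed f) (grid n d) y ?F
      = (\<Sum>e\<in>below n a - B. (- 1) ^ card {c \<in> ?F. c < e} * row_signed f e * y (insert e ?F))"
    unfolding kosz_def using sub vanish by (intro sum.mono_neutral_right) auto
  also have "\<dots> = kosz f (below n a) (\<lambda>B. y (B \<union> graph_of n a)) B"
    unfolding kosz_def by (intro sum.cong refl) (simp only: sign Un_insert_left)
  finally show ?thesis .
qed

text \<open>
  A basis element of degree \<open>1\<close> has one row with two elements \<open>b < c\<close>; its boundary involves \<open>x\<^sub>b e\<^sub>c\<close>
  and \<open>x\<^sub>c e\<^sub>b\<close> with opposite signs, and the augmentation sends both to the same product.
\<close>

lemma aug_kosz:
  fixes f :: "nat \<times> nat \<Rightarrow> 'r::comm_ring_1"
  shows "aug n d f (kosz (row_signed f) (grid n d) w) = 0"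
proof -
  let ?h = "\<lambda>i (a, b). f (i, b) * w (insert (i, b) (graph_of n a)) * (\<Prod>j\<in>{1..n}. f (j, a j))"
  let ?lt = "\<lambda>i. {(a, b). a \<in> D_box n d \<and> b \<in> {1..d i} \<and> a i < b}"
  let ?gt = "\<lambda>i. {(a, b). a \<in> D_box n d \<and> b \<in> {1..d i} \<and> b < a i}"
  have finlt: "finite (?lt i)" "finite (?gt i)" for i
    by (rule finite_subset[of _ "D_box n d \<times> {1..d i}"]; auto)+
  have expand: "kosz (row_signed f) (grid n d) w (graph_of n a) * (\<Prod>j\<in>{1..n}. f (j, a j))
      = (\<Sum>i\<in>{1..n}. \<Sum>b\<in>{1..d i} - {a i}. if a i < b then - ?h i (a, b) else ?h i (a, b))"
    if a: "a \<in> D_box n d" for a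
  proof -
    have "grid n d - graph_of n a = Sigma {1..n} (\<lambda>i. {1..d i} - {a i})"
      by (auto simp: grid_def graph_of_def)
    then have "kosz (row_signed f) (grid n d) w (graph_of n a)
      = (\<Sum>i\<in>{1..n}. \<Sum>b\<in>{1..d i} - {a i}. (- 1) ^ card {c \<in> graph_of n a. c < (i, b)} *
           row_signed f (i, b) * w (insert (i, b) (graph_of n a)))"
      by (simp add: kosz_def sum.Sigma split_def)
    also have "\<dots> = (\<Sum>i\<in>{1..n}. \<Sum>b\<in>{1..d i} - {a i}. (if a i < b then - 1 else 1) *
           f (i, b) * w (insert (i, b) (graph_of n a)))"
    proof (intro sum.cong refl)
      fix i b assume "i \<in> {1..n}" "b \<in> {1..d i} - {a i}"
      then have card: "card {c \<in> graph_of n a. c < (i, b)} = (i - 1) + (if a i < b then 1 else 0)"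
        by (intro card_graph_of_before) auto
      have "(- 1 :: 'r) ^ (i - 1) * (- 1) ^ (i - 1) = 1" by (simp flip: power_mult_distrib)
      then show "(- 1) ^ card {c \<in> graph_of n a. c < (i, b)} *
           row_signed f (i, b) * w (insert (i, b) (graph_of n a))
        = (if a i < b then - 1 else 1) * f (i, b) * w (insert (i, b) (graph_of n a))"
        unfolding card by (simp add: row_signed_def power_add mult.assoc[symmetric])
    qed
    finally have eq: "kosz (row_signed f) (grid n d) w (graph_of n a) = \<dots>" .
    show ?thesis
      unfolding eq sum_distrib_right prod.case
      by (intro sum.cong refl) (simp only: if_distribR mult_minus_left mult_1_left split: if_split, blast?)
  qed
  have "aug n d f (kosz (row_signed f) (grid n d) w)
    = (\<Sum>i\<in>{1..n}. \<Sum>a\<in>D_box n d. \<Sum>b\<in>{1..d i} - {a i}. if a i < b then - ?h i (a, b) else ?h i (a, b))"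
    unfolding aug_def by (subst sum.swap) (intro sum.cong refl expand)
  also have "\<dots> = (\<Sum>i\<in>{1..n}. 0)"
  proof (rule sum.cong[OF refl])
    fix i assume i: "i \<in> {1..n}"
    let ?g = "\<lambda>(a, b). if a i < b then - ?h i (a, b) else ?h i (a, b)"
    have un: "Sigma (D_box n d) (\<lambda>a. {1..d i} - {a i}) = ?lt i \<union> ?gt i" by auto
    have "(\<Sum>a\<in>D_box n d. \<Sum>b\<in>{1..d i} - {a i}. if a i < b then - ?h i (a, b) else ?h i (a, b))
      = sum ?g (Sigma (D_box n d) (\<lambda>a. {1..d i} - {a i}))"
      by (subst sum.Sigma) (auto simp: split_def)
    also have "\<dots> = sum ?g (?lt i) + sum ?g (?gt i)"
      unfolding un using finlt by (intro sum.union_disjoint) auto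
    also have "sum ?g (?lt i) = (\<Sum>p\<in>?lt i. - ?h i p)" by (intro sum.cong) auto
    also have "sum ?g (?gt i) = sum (?h i) (?gt i)" by (intro sum.cong) auto
    \<comment> \<open>exchanging the two elements of row \<open>i\<close> matches the two halves\<close>
    also have "sum (?h i) (?gt i) = sum (?h i) (?lt i)"
    proof (rule sum.reindex_bij_witness[of _ "\<lambda>(a, b). (a(i := b), a i)" "\<lambda>(a, b). (a(i := b), a i)"])
      fix p assume "p \<in> ?gt i"
      then obtain a b where p: "p = (a, b)" "a \<in> D_box n d" "b \<in> {1..d i}" "b < a i" by auto
      have pull: "(\<Prod>j\<in>{1..n}. h j) = h i * (\<Prod>j\<in>{1..n} - {i}. h j)" for h :: "nat \<Rightarrow> 'r"
        using i by (intro prod.remove) auto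
      have "(\<Prod>j\<in>{1..n} - {i}. f (j, (a(i := b)) j)) = (\<Prod>j\<in>{1..n} - {i}. f (j, a j))"
        by (intro prod.cong) auto
      then have P: "f (i, a i) * (\<Prod>j\<in>{1..n}. f (j, (a(i := b)) j)) = f (i, b) * (\<Prod>j\<in>{1..n}. f (j, a j))"
        unfolding pull by (simp only: fun_upd_same mult.left_commute)
      have G: "insert (i, a i) (graph_of n (a(i := b))) = insert (i, b) (graph_of n a)"
        using i by (auto simp: graph_of_def image_iff)
      have swap: "x * v * P = y * v * Q" if "x * P = y * Q" for x y v P Q :: 'r
        using that by (metis mult.assoc mult.commute)
      show "?h i (case p of (a, b) \<Rightarrow> (a(i := b), a i)) = ?h i p"
        unfolding p prod.case G by (rule swap[OF P])
    qed (use i in \<open>auto simp del: atLeastAtMost_iff One_nat_def intro: D_box_update D_box_mem\<close>)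
    finally show "(\<Sum>a\<in>D_box n d. \<Sum>b\<in>{1..d i} - {a i}. if a i < b then - ?h i (a, b) else ?h i (a, b)) = 0"
      by (simp add: sum_negf)
  qed
  finally show ?thesis by simp
qed

text \<open>In degree \<open>0\<close> these are the cycles of the augmented complex.\<close>

definition cycles :: "nat \<Rightarrow> (nat \<Rightarrow> nat) \<Rightarrow> (nat \<times> nat \<Rightarrow> 'r::comm_ring_1) \<Rightarrow> nat \<Rightarrow> ((nat \<times> nat) set \<Rightarrow> 'r) \<Rightarrow> bool"
  where "cycles n d f k z \<longleftrightarrow>
    (if k = 0 then aug n d f z = 0
     else \<forall>F\<in>full n d. kosz (row_signed f) (grid n d) z F = 0)"

definition poset_ideal :: "nat \<Rightarrow> (nat \<Rightarrow> nat) \<Rightarrow> (nat \<Rightarrow> nat) set \<Rightarrow> bool"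
  where "poset_ideal n d P \<longleftrightarrow> P \<subseteq> D_box n d \<and> (\<forall>b\<in>P. \<forall>a\<in>D_box n d. a \<le> b \<longrightarrow> a \<in> P)"

lemma prod_cancel_mod_ideal:
  assumes "finite I" and "\<And>i c. i \<in> I \<Longrightarrow> c * g i \<in> L \<Longrightarrow> c \<in> L" and "c * prod g I \<in> L"
  shows "c \<in> (L :: 'r::comm_ring_1 set)"
  using assms
proof (induction I arbitrary: c rule: finite_induct)
  case (insert i I)
  have "c * prod g (insert i I) = (c * prod g I) * g i"
    unfolding prod.insert[OF insert.hyps] by (simp only: mult_ac)
  then have "(c * prod g I) * g i \<in> L" using insert.prems(2) by (rule subst)
  then have "c * prod g I \<in> L" by (rule insert.prems(1)[OF insertI1])
  then show ?case
    by (rule insert.IH[rotated]) (rule insert.prems(1)[OF insertI2])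
qed simp

text \<open>
  Add the elements of \<open>P\<close> one at a time, a maximal element \<open>a\<close> being the last.  The part of a
  cycle with row tops \<open>a\<close> is a cycle of the Koszul complex of a regular family, hence a
  boundary; what remains is a cycle over \<open>P - {a}\<close>.  In degree \<open>0\<close> that part is a scalar \<open>c\<close>
  such that \<open>c \<Prod>\<^sub>i f (i, a i)\<close> is a combination of the products for the other \<open>b \<in> P\<close>.  Each
  such \<open>b\<close> has \<open>b i < a i\<close> for some \<open>i\<close>, so \<open>c \<Prod>\<^sub>i f (i, a i)\<close> lies in the ideal \<open>L\<close> of the
  \<open>f (i, j)\<close> with \<open>j < a i\<close>, modulo which the \<open>f (i, a i)\<close> are nonzerodivisors.
\<close>

lemma poset_ideal_acyclic:
  fixes f :: "nat \<times> nat \<Rightarrow> 'r::comm_ring_1"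
  assumes "finite P" and "poset_ideal n d P"
    and "\<And>a. a \<in> P \<Longrightarrow> regular_family f (below n a)"
    and "\<And>a i c. a \<in> P \<Longrightarrow> i \<in> {1..n} \<Longrightarrow>
      c * f (i, a i) \<in> ideal_gen (f ` below n a) \<Longrightarrow> c \<in> ideal_gen (f ` below n a)"
    and "\<And>F. z F \<noteq> 0 \<Longrightarrow> F \<in> cells n d P k"
    and "cycles n d f k z"
  obtains w where "\<And>F. w F \<noteq> 0 \<Longrightarrow> F \<in> cells n d P (Suc k)"
    and "\<And>F. F \<in> full n d \<Longrightarrow> kosz (row_signed f) (grid n d) w F = z F"
proof -
  let ?K = "kosz (row_signed f) (grid n d)"
  have "\<exists>w. (\<forall>F. w F \<noteq> 0 \<longrightarrow> F \<in> cells n d P (Suc k)) \<and> (\<forall>F\<in>full n d. ?K w F = z F)"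
    using assms
  proof (induction "card P" arbitrary: P z)
    case 0
    then have "z F = 0" for F by (fastforce simp: cells_def)
    then show ?case by (intro exI[of _ "\<lambda>_. 0"]) (simp add: kosz_def)
  next
    case (Suc m P z)
    note finP = Suc.prems(1) and ideal = Suc.prems(2) and supp = Suc.prems(5) and cyc = Suc.prems(6)
    have "P \<noteq> {}" using Suc.hyps(2) by auto
    then obtain a where a: "a \<in> P" and max: "\<And>b. b \<in> P \<Longrightarrow> a \<le> b \<Longrightarrow> a = b"
      using finite_has_maximal[OF finP] by blast
    have aD: "a \<in> D_box n d" using ideal a by (auto simp: poset_ideal_def)
    have finL: "finite (below n a)" by simp
    note cf = cell_full[OF aD] and ct = cell_tops[OF aD] and cc = cell_card[OF aD]
    let ?za = "\<lambda>B. if B \<subseteq> below n a then z (B \<union> graph_of n a) else 0"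
    have za_supp: "B \<subseteq> below n a \<and> card B = k" if "?za B \<noteq> 0" for B
      using that supp[of "B \<union> graph_of n a"] cc[of B] by (auto simp: cells_def split: if_splits)
    \<comment> \<open>\<open>a\<close> is maximal in \<open>P\<close>, so chains over \<open>P\<close> vanish on cells with larger row tops\<close>
    have zK: "?K y (B \<union> graph_of n a) = kosz f (below n a) (\<lambda>B. y (B \<union> graph_of n a)) B"
      if "B \<subseteq> below n a" and "\<And>F. y F \<noteq> 0 \<Longrightarrow> F \<in> cells n d P j" for y B j
    proof (rule kosz_top_layer[OF aD that(1)])
      fix F assume "y F \<noteq> 0"
      then have "F \<in> full n d" "row_tops n F \<in> P" using that(2) by (auto simp: cells_def)
      then show "F \<in> full n d \<and> \<not> a < row_tops n F" using max[of "row_tops n F"] by (auto simp: less_le)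
    qed
    have "\<exists>wa. (\<forall>B. wa B \<noteq> 0 \<longrightarrow> B \<subseteq> below n a \<and> card B = Suc k) \<and>
        (\<forall>B. B \<subseteq> below n a \<longrightarrow> kosz f (below n a) wa B = ?za B)"
    proof (cases "k = 0")
      case False
      have za_cyc: "kosz f (below n a) ?za B = 0" if B: "B \<subseteq> below n a" for B
      proof -
        have "kosz f (below n a) ?za B = kosz f (below n a) (\<lambda>B. z (B \<union> graph_of n a)) B"
          using B by (intro kosz_cong) auto
        also have "\<dots> = ?K z (B \<union> graph_of n a)" using zK[OF B supp] by simp
        also have "\<dots> = 0" using cyc False cf[OF B] by (simp add: cycles_def)
        finally show ?thesis .
      qed
      have "k > 0" using False by simp
      then obtain wa where wa: "\<And>B. wa B \<noteq> 0 \<Longrightarrow> B \<subseteq> below n a \<and> card B = Suc k"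
        "\<And>B. B \<subseteq> below n a \<Longrightarrow> kosz f (below n a) wa B = ?za B"
        by (rule kosz_exact[OF finL Suc.prems(3)[OF a] _ za_supp za_cyc]) (assumption | blast)+
      then show ?thesis by (intro exI[of _ wa]) simp
    next
      case True
      let ?L = "ideal_gen (f ` below n a)" and ?p = "\<lambda>b. \<Prod>i\<in>{1..n}. f (i, b i)"
      \<comment> \<open>every other \<open>b\<close> in the support lies below \<open>a\<close> in some row, which puts its product into \<open>L\<close>\<close>
      have low: "z (graph_of n b) * ?p b \<in> ?L" if b: "b \<in> D_box n d - {a}" for b
      proof (cases "z (graph_of n b) = 0")
        case True
        then show ?thesis by (simp add: ideal_gen_zero)
      next
        case False
        then have "row_tops n (graph_of n b) \<in> P" using supp by (auto simp: cells_def)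
        then have "b \<in> P" using cell_tops[of b n d "{}"] b by simp
        then have "\<not> a \<le> b" using max b by blast
        then obtain i where i: "b i < a i" by (auto simp: le_fun_def not_le)
        have "i \<in> {1..n}"
          using i aD b by (cases "i \<in> {1..n}") (auto simp: D_box_def PiE_def extensional_def)
        moreover from this have "b i \<ge> 1" using b by (auto simp: D_box_def)
        ultimately have "(i, b i) \<in> below n a" using i by (auto simp: below_def)
        then have "f (i, b i) \<in> ?L" by (intro ideal_gen_base) blast
        then have "?p b \<in> ?L" using \<open>i \<in> {1..n}\<close> by (intro ideal_gen_prod[of _ i]) auto
        then show ?thesis by (rule ideal_gen_mult)
      qed
      have "0 = aug n d f z" using cyc True by (simp add: cycles_def)
      also have "\<dots> = z (graph_of n a) * ?p a + (\<Sum>b\<in>D_box n d - {a}. z (graph_of n b) * ?p b)"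
        unfolding aug_def using aD by (intro sum.remove) auto
      finally have "z (graph_of n a) * ?p a = 0 - (\<Sum>b\<in>D_box n d - {a}. z (graph_of n b) * ?p b)"
        by (simp add: eq_neg_iff_add_eq_0)
      also have "\<dots> \<in> ?L" using low by (intro ideal_gen_diff ideal_gen_zero ideal_gen_sum)
      finally have mem: "z (graph_of n a) * ?p a \<in> ?L" .
      have "z (graph_of n a) \<in> ?L"
        by (rule prod_cancel_mod_ideal[OF _ _ mem]) (use Suc.prems(4)[OF a] in \<open>simp, blast\<close>)
      then obtain wa where wa: "\<And>F. wa F \<noteq> 0 \<Longrightarrow> F \<subseteq> below n a \<and> card F = 1"
        "\<And>F. F \<subseteq> below n a \<Longrightarrow> kosz f (below n a) wa F = (if F = {} then z (graph_of n a) else 0)"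
        using kosz_degree_0[OF finL] by metis
      have "kosz f (below n a) wa B = ?za B" if B: "B \<subseteq> below n a" for B
      proof (cases "B = {}")
        case False
        then have "card B \<noteq> 0" using finite_subset[OF B] by simp
        then have "?za B = 0" using za_supp[of B] True by metis
        then show ?thesis using wa(2)[OF B] False by simp
      qed (use wa(2)[OF B] in simp)
      then show ?thesis using wa(1) True by (intro exI[of _ wa]) simp
    qed
    then obtain wa where wa_supp: "\<And>B. wa B \<noteq> 0 \<Longrightarrow> B \<subseteq> below n a \<and> card B = Suc k"
      and wa_bd: "\<And>B. B \<subseteq> below n a \<Longrightarrow> kosz f (below n a) wa B = ?za B" by blast
    define w where "w F = (if graph_of n a \<subseteq> F then wa (F - graph_of n a) else 0)" for F
    have w_cell: "w (B \<union> graph_of n a) = wa B" if "B \<subseteq> below n a" for B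
    proof -
      have "B \<union> graph_of n a - graph_of n a = B" using that below_Int_graph_of[of n a] by blast
      then show ?thesis by (simp add: w_def)
    qed
    have w_supp: "F \<in> full n d \<and> row_tops n F = a \<and> card F = Suc k + n" if "w F \<noteq> 0" for F
    proof -
      define B where "B = F - graph_of n a"
      have "graph_of n a \<subseteq> F" "wa B \<noteq> 0" using that by (auto simp: w_def B_def split: if_splits)
      then have B: "B \<subseteq> below n a" "card B = Suc k" "F = B \<union> graph_of n a"
        using wa_supp by (auto simp: B_def)
      then show ?thesis using cf ct cc by metis
    qed
    then have w_cells: "F \<in> cells n d P (Suc k)" if "w F \<noteq> 0" for F
      using that a by (auto simp: cells_def)
    define y where "y F = (if F \<in> full n d then z F - ?K w F else 0)" for F
    have y_supp: "F \<in> cells n d (P - {a}) k" if yF: "y F \<noteq> 0" for F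
    proof -
      have F: "F \<in> full n d" using yF by (auto simp: y_def split: if_splits)
      have mem: "row_tops n F \<in> P \<and> card F = k + n"
      proof (cases "z F = 0")
        case False
        then show ?thesis using supp by (auto simp: cells_def)
      next
        case True
        then have "?K w F \<noteq> 0" using yF F by (simp add: y_def)
        then obtain e where e: "e \<in> grid n d - F" "w (insert e F) \<noteq> 0"
          using kosz_eq_0[of "grid n d" F w] by blast
        then have "row_tops n F \<le> a" "card (insert e F) = Suc k + n"
          using w_supp row_tops_insert_le[OF F, of e] by auto
        then show ?thesis
          using ideal a row_tops_in_D_box[OF F] e fullD(2)[OF F] by (auto simp: poset_ideal_def)
      qed
      moreover have "row_tops n F \<noteq> a"
      proof
        assume tops: "row_tops n F = a"
        define B where "B = F - graph_of n a"
        have B: "B \<subseteq> below n a" "F = B \<union> graph_of n a"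
          using cell_decomp[OF F, of a] tops by (auto simp: B_def)
        have "?K w F = kosz f (below n a) (\<lambda>B. w (B \<union> graph_of n a)) B"
          unfolding B(2) by (rule zK[OF B(1) w_cells])
        also have "\<dots> = kosz f (below n a) wa B"
          using B(1) by (intro kosz_cong w_cell) auto
        also have "\<dots> = z F" using wa_bd[OF B(1)] B by simp
        finally show False using yF by (simp add: y_def split: if_splits)
      qed
      ultimately show ?thesis using F by (auto simp: cells_def)
    qed
    have y_cyc: "cycles n d f k y"
    proof (cases "k = 0")
      case True
      have "y (graph_of n b) = z (graph_of n b) - ?K w (graph_of n b)" if "b \<in> D_box n d" for b
        using cell_full[OF that, of "{}"] by (simp add: y_def)
      then have "aug n d f y = aug n d f z - aug n d f (?K w)"
        unfolding aug_def by (simp add: left_diff_distrib sum_subtractf)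
      then show ?thesis using cyc True by (simp add: cycles_def aug_kosz)
    next
      case False
      have "?K y F = 0" if F: "F \<in> full n d" for F
      proof -
        have "?K y F = ?K (\<lambda>F. z F - ?K w F) F"
          using F full_insert by (intro kosz_cong) (auto simp: y_def)
        also have "\<dots> = ?K z F - ?K (?K w) F" by (rule kosz_diff)
        also have "\<dots> = 0"
          using cyc False F kosz_kosz[OF finite_grid fullD(1)[OF F]] by (simp add: cycles_def)
        finally show ?thesis .
      qed
      then show ?thesis using False by (simp add: cycles_def)
    qed
    have ideal': "poset_ideal n d (P - {a})"
      unfolding poset_ideal_def
    proof (intro conjI ballI impI)
      show "P - {a} \<subseteq> D_box n d" using ideal by (auto simp: poset_ideal_def)
      fix b c assume "b \<in> P - {a}" "c \<in> D_box n d" "c \<le> b"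
      moreover from this have "c \<noteq> a" using max[of b] by auto
      ultimately show "c \<in> P - {a}" using ideal by (auto simp: poset_ideal_def)
    qed
    have "\<exists>w'. (\<forall>F. w' F \<noteq> 0 \<longrightarrow> F \<in> cells n d (P - {a}) (Suc k)) \<and> (\<forall>F\<in>full n d. ?K w' F = y F)"
    proof (rule Suc.hyps(1)[OF _ _ ideal' _ _ y_supp y_cyc])
      show "m = card (P - {a})" "finite (P - {a})" using Suc.hyps(2) a finP by simp_all
      show "regular_family f (below n b)" if "b \<in> P - {a}" for b
        using that by (intro Suc.prems(3)) simp
      show "c \<in> ideal_gen (f ` below n b)"
        if "b \<in> P - {a}" "i \<in> {1..n}" "c * f (i, b i) \<in> ideal_gen (f ` below n b)" for b i c
        using that(1) by (intro Suc.prems(4)[OF _ that(2,3)]) simp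
    qed
    then obtain w' where w': "\<And>F. w' F \<noteq> 0 \<Longrightarrow> F \<in> cells n d (P - {a}) (Suc k)"
      "\<And>F. F \<in> full n d \<Longrightarrow> ?K w' F = y F" by blast
    let ?w = "\<lambda>F. w' F + w F"
    have bd: "?K ?w F = z F" if "F \<in> full n d" for F
      using w'(2)[OF that] that by (simp add: kosz_add y_def)
    have sp: "F \<in> cells n d P (Suc k)" if "?w F \<noteq> 0" for F
    proof -
      from that have "w' F \<noteq> 0 \<or> w F \<noteq> 0" by auto
      then show ?thesis using w'(1)[of F] w_cells[of F] by (auto simp: cells_def)
    qed
    show ?case using bd sp by (intro exI[of _ ?w]) simp
  qed
  then show ?thesis using that by blast
qed

section \<open>Independent choices of vectors\<close>

context finite_dimensional_vector_space
begin

lemma dim_Un_Int_span: "dim (X \<union> Y) + dim (span X \<inter> span Y) = dim X + dim Y"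
  using dim_sums_Int[of "span X" "span Y"] by (simp flip: span_Un)

text \<open>
  Rado's theorem.  As long as some \<open>A i\<close> has two elements, one of them can be dropped: if
  neither could, the sets violating the rank condition afterwards would contradict
  submodularity of the dimension.
\<close>

lemma rado:
  assumes "finite I" and "\<And>i. i \<in> I \<Longrightarrow> finite (A i)"
    and "\<And>T. T \<subseteq> I \<Longrightarrow> card T \<le> dim (\<Union>i\<in>T. A i)"
  shows "\<exists>x. (\<forall>i\<in>I. x i \<in> A i) \<and> inj_on x I \<and> independent (x ` I)"
  using assms(2,3)
proof (induction "\<Sum>i\<in>I. card (A i)" arbitrary: A rule: less_induct)
  case less
  have fin: "finite T" if "T \<subseteq> I" for T using that assms(1) finite_subset by blast
  show ?case
  proof (cases "\<exists>i\<in>I. \<exists>x\<in>A i. \<exists>y\<in>A i. x \<noteq> y")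
    case False
    have "A i \<noteq> {}" if "i \<in> I" for i
      using less.prems(2)[of "{i}"] that by auto
    then have ex: "\<forall>i\<in>I. \<exists>x. x \<in> A i" by blast
    then obtain x where x: "\<forall>i\<in>I. x i \<in> A i" by metis
    with False have A: "A i = {x i}" if "i \<in> I" for i using that by blast
    have "(\<Union>i\<in>I. A i) = x ` I" using A by auto
    then have "card I \<le> dim (x ` I)" using less.prems(2)[of I] by simp
    moreover have "dim (x ` I) \<le> card (x ` I)"
      using assms(1) by (intro dim_le_card span_superset) auto
    moreover have "card (x ` I) \<le> card I" using assms(1) by (rule card_image_le)
    ultimately have "card (x ` I) = card I" "card (x ` I) \<le> dim (x ` I)" by auto
    then have "inj_on x I" "independent (x ` I)"
      using assms(1) card_le_dim_spanning[of "x ` I" "x ` I"]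
      by (auto simp: inj_on_iff_eq_card span_superset)
    then show ?thesis using x by blast
  next
    case True
    then obtain i x y where i: "i \<in> I" and x: "x \<in> A i" and y: "y \<in> A i" and xy: "x \<noteq> y" by blast
    have drop: ?thesis if v: "v \<in> A i"
      and good: "\<And>T. T \<subseteq> I - {i} \<Longrightarrow> card T < dim (A i - {v} \<union> (\<Union>j\<in>T. A j))" for v
    proof -
      let ?A = "A(i := A i - {v})"
      have "(\<Sum>j\<in>I - {i}. card (?A j)) = (\<Sum>j\<in>I - {i}. card (A j))"
        by (intro sum.cong) auto
      moreover have "card (?A i) < card (A i)"
        using card_Diff1_less[OF less.prems(1)[OF i] v] by simp
      ultimately have "(\<Sum>j\<in>I. card (?A j)) < (\<Sum>j\<in>I. card (A j))"
        using assms(1) i by (simp only: sum.remove[of I i])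
      moreover have "card T \<le> dim (\<Union>j\<in>T. ?A j)" if T: "T \<subseteq> I" for T
      proof (cases "i \<in> T")
        case True
        have "(\<Union>j\<in>T. ?A j) = A i - {v} \<union> (\<Union>j\<in>T - {i}. A j)"
          using True by (auto split: if_splits)
        moreover have "card (T - {i}) < dim (A i - {v} \<union> (\<Union>j\<in>T - {i}. A j))"
          using T by (intro good) auto
        moreover have "card T = Suc (card (T - {i}))" using fin[OF T] True by (rule card.remove)
        ultimately show ?thesis by (simp only: Suc_le_eq)
      next
        case False
        then have "(\<Union>j\<in>T. ?A j) = (\<Union>j\<in>T. A j)" by (intro SUP_cong) auto
        then show ?thesis using less.prems(2)[OF T] by simp
      qed
      moreover have "finite (?A j)" if "j \<in> I" for j using less.prems(1) that by auto
      ultimately obtain z where "\<forall>j\<in>I. z j \<in> ?A j" "inj_on z I" "independent (z ` I)"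
        using less.hyps[of ?A] by blast
      moreover from this(1) have "\<forall>j\<in>I. z j \<in> A j" by (auto split: if_splits)
      ultimately show ?thesis by blast
    qed
    have "(\<forall>T. T \<subseteq> I - {i} \<longrightarrow> card T < dim (A i - {x} \<union> (\<Union>j\<in>T. A j))) \<or>
      (\<forall>T. T \<subseteq> I - {i} \<longrightarrow> card T < dim (A i - {y} \<union> (\<Union>j\<in>T. A j)))"
    proof (rule ccontr)
      assume "\<not> ?thesis"
      then obtain T U where T: "T \<subseteq> I - {i}" "dim (A i - {x} \<union> (\<Union>j\<in>T. A j)) \<le> card T"
        and U: "U \<subseteq> I - {i}" "dim (A i - {y} \<union> (\<Union>j\<in>U. A j)) \<le> card U"
        by (auto simp: not_less)
      let ?X = "A i - {x} \<union> (\<Union>j\<in>T. A j)" and ?Y = "A i - {y} \<union> (\<Union>j\<in>U. A j)"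
      have finTU: "finite T" "finite U" "i \<notin> T \<union> U" using T U fin[of T] fin[of U] by auto
      have "card (insert i (T \<union> U)) \<le> dim (\<Union>j\<in>insert i (T \<union> U). A j)"
        using T U i by (intro less.prems(2)) auto
      also have "(\<Union>j\<in>insert i (T \<union> U). A j) = ?X \<union> ?Y" using xy by auto
      finally have un: "card (T \<union> U) + 1 \<le> dim (?X \<union> ?Y)" using finTU by simp
      have "card (T \<inter> U) \<le> dim (\<Union>j\<in>T \<inter> U. A j)"
        using T by (intro less.prems(2)) auto
      also have "\<dots> \<le> dim (span ?X \<inter> span ?Y)"
        by (intro dim_subset) (auto intro: span_base)
      finally have "card (T \<union> U) + card (T \<inter> U) + 1 \<le> dim ?X + dim ?Y"
        using un dim_Un_Int_span[of ?X ?Y] by linarith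
      then show False using T(2) U(2) card_Un_Int[OF finTU(1,2)] by linarith
    qed
    then show ?thesis using drop[OF x] drop[OF y] by blast
  qed
qed

lemma extend_to_enumerated_basis:
  assumes "subspace U" and "inj_on h {1..m}" and "independent (h ` {1..m})" and "h ` {1..m} \<subseteq> U"
  obtains g where "\<And>j. j \<in> {1..m} \<Longrightarrow> g j = h j" and "inj_on g {1..dim U}"
    and "independent (g ` {1..dim U})" and "span (g ` {1..dim U}) = U" and "m \<le> dim U"
proof -
  obtain B where B: "h ` {1..m} \<subseteq> B" "B \<subseteq> U" "independent B" "U \<subseteq> span B"
    using maximal_independent_subset_extend[OF assms(4,3)] by metis
  have finB: "finite B" by (rule finiteI_independent[OF B(3)])
  have card: "card B = dim U" by (rule basis_card_eq_dim[OF B(2,4,3)])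
  have m: "card (h ` {1..m}) = m" using assms(2) by (simp add: card_image)
  then have le: "m \<le> dim U" using card_mono[OF finB B(1)] card by simp
  have "card {m+1..dim U} = card (B - h ` {1..m})"
    using card_Diff_subset[OF _ B(1)] m card le by simp
  then obtain \<beta> where \<beta>: "bij_betw \<beta> {m+1..dim U} (B - h ` {1..m})"
    using finite_same_card_bij[of "{m+1..dim U}" "B - h ` {1..m}"] finB by auto
  define g where "g j = (if j \<le> m then h j else \<beta> j)" for j
  have split: "{1..dim U} = {1..m} \<union> {m+1..dim U}" using le by auto
  have "bij_betw g {1..m} (h ` {1..m})"
    using inj_on_imp_bij_betw[OF assms(2)]
    by (rule bij_betw_cong[THEN iffD1, rotated]) (auto simp: g_def)
  moreover have "bij_betw g {m+1..dim U} (B - h ` {1..m})"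
    using \<beta> by (rule bij_betw_cong[THEN iffD1, rotated]) (auto simp: g_def)
  ultimately have "bij_betw g {1..dim U} (h ` {1..m} \<union> (B - h ` {1..m}))"
    unfolding split by (rule bij_betw_combine) auto
  then have g: "bij_betw g {1..dim U} B" using B(1) by (simp add: Un_absorb1)
  then have "inj_on g {1..dim U}" "g ` {1..dim U} = B" by (auto simp: bij_betw_def)
  moreover have "span B = U" by (rule span_subspace[OF B(2,4) assms(1)])
  ultimately show ?thesis using B(3) le by (intro that[of g]) (simp_all add: g_def)
qed

text \<open>The sum of the subspaces and their union have the same span.\<close>

lemma rk_eq_dim_Union:
  assumes "finite T" and "\<And>i. i \<in> T \<Longrightarrow> subspace (Vs i)"
  shows "rk scale Vs T = dim (\<Union>i\<in>T. Vs i)"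
proof -
  let ?S = "{\<Sum>i\<in>T. v i | v. \<forall>i\<in>T. v i \<in> Vs i}"
  have "?S \<subseteq> span (\<Union>i\<in>T. Vs i)" by (auto intro!: span_sum intro: span_base)
  moreover have "(\<Union>i\<in>T. Vs i) \<subseteq> ?S"
  proof
    fix x assume "x \<in> (\<Union>i\<in>T. Vs i)"
    then obtain i where i: "i \<in> T" "x \<in> Vs i" by blast
    let ?v = "\<lambda>j. if j = i then x else 0"
    have "x = (\<Sum>j\<in>T. ?v j)" using assms(1) i by simp
    moreover have "\<forall>j\<in>T. ?v j \<in> Vs j" using i subspace_0[OF assms(2)] by auto
    ultimately show "x \<in> ?S" by blast
  qed
  ultimately have "dim ?S = dim (\<Union>i\<in>T. Vs i)"
    by (meson antisym dim_mono span_superset subset_trans)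
  then show ?thesis by (simp add: rk_def)
qed

text \<open>
  For generic bases the initial segments prescribed by \<open>b\<close> are independent as soon as this is
  possible at all, and Rado's theorem says when it is possible.
\<close>

lemma generic_bases_independent:
  assumes arr: "subspace_arrangement scale n Vs" and gen: "generic_bases scale n Vs f"
    and hall: "\<And>T. T \<subseteq> {1..n} \<Longrightarrow> (\<Sum>i\<in>T. b i) \<le> rk scale Vs T"
  shows "inj_on (\<lambda>(i, j). f i j) (Sigma {1..n} (\<lambda>i. {1..b i}))"
    and "independent ((\<lambda>(i, j). f i j) ` Sigma {1..n} (\<lambda>i. {1..b i}))"
proof -
  let ?S = "Sigma {1..n} (\<lambda>i. {1..b i})"
  have sub: "subspace (Vs i)" if "i \<in> {1..n}" for i
    using arr that by (auto simp: subspace_arrangement_def)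
  have card_S: "card ?S = (\<Sum>i\<in>{1..n}. b i)" by simp
  define A where "A = (\<lambda>p :: nat \<times> nat. f (fst p) ` {1..dim (Vs (fst p))})"
  have A: "span (A p) = Vs (fst p)" if "fst p \<in> {1..n}" for p
    using gen that by (auto simp: generic_bases_def collection_of_bases_def dims_def A_def)
  \<comment> \<open>Rado's condition: \<open>T\<close> has at most \<open>b i\<close> members in row \<open>i\<close>, and row \<open>i\<close> chooses from a basis of \<open>V\<^sub>i\<close>\<close>
  have "card T \<le> dim (\<Union>p\<in>T. A p)" if T: "T \<subseteq> ?S" for T
  proof -
    have R: "fst ` T \<subseteq> {1..n}" using T by auto
    have "card T \<le> card (Sigma (fst ` T) (\<lambda>i. {1..b i}))"
      using T by (intro card_mono finite_SigmaI finite_subset[OF R]) force+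
    also have "\<dots> = (\<Sum>i\<in>fst ` T. b i)" using finite_subset[OF R] by simp
    also have "\<dots> \<le> rk scale Vs (fst ` T)" by (rule hall[OF R])
    also have "\<dots> = dim (\<Union>i\<in>fst ` T. Vs i)"
      using finite_subset[OF R] R sub by (intro rk_eq_dim_Union) auto
    also have "\<dots> \<le> dim (\<Union>p\<in>T. A p)"
    proof (rule dim_mono, rule UN_least)
      fix i assume "i \<in> fst ` T"
      then obtain p where p: "p \<in> T" "i = fst p" by blast
      then have "Vs i = span (A p)" using A[of p] R \<open>i \<in> fst ` T\<close> by blast
      also have "\<dots> \<subseteq> span (\<Union>p\<in>T. A p)" using p by (intro span_mono) auto
      finally show "Vs i \<subseteq> span (\<Union>p\<in>T. A p)" .
    qed
    finally show ?thesis .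
  qed
  then obtain x where x: "\<forall>p\<in>?S. x p \<in> A p" "inj_on x ?S" "independent (x ` ?S)"
    using rado[of ?S A] by (auto simp: A_def)
  have "\<exists>g. (\<forall>j\<in>{1..b i}. g j = x (i, j)) \<and> inj_on g {1..dim (Vs i)} \<and>
      independent (g ` {1..dim (Vs i)}) \<and> span (g ` {1..dim (Vs i)}) = Vs i \<and> b i \<le> dim (Vs i)"
    if i: "i \<in> {1..n}" for i
  proof -
    have "inj_on (\<lambda>j. x (i, j)) {1..b i}"
    proof (rule inj_onI)
      fix j j' assume "j \<in> {1..b i}" "j' \<in> {1..b i}" "x (i, j) = x (i, j')"
      then have "(i, j) = (i, j')" using i by (intro inj_onD[OF x(2)]) auto
      then show "j = j'" by simp
    qed
    moreover have "independent ((\<lambda>j. x (i, j)) ` {1..b i})"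
      using i by (intro independent_mono[OF x(3)]) auto
    moreover have "(\<lambda>j. x (i, j)) ` {1..b i} \<subseteq> Vs i"
    proof
      fix v assume "v \<in> (\<lambda>j. x (i, j)) ` {1..b i}"
      then obtain j where "j \<in> {1..b i}" "v = x (i, j)" by blast
      then have "v \<in> A (i, j)" using x(1) i by auto
      then show "v \<in> Vs i" using A[of "(i, j)"] i span_base by auto
    qed
    ultimately show ?thesis using extend_to_enumerated_basis[OF sub[OF i]] by metis
  qed
  then obtain g where g: "\<And>i. i \<in> {1..n} \<Longrightarrow> (\<forall>j\<in>{1..b i}. g i j = x (i, j)) \<and>
      inj_on (g i) {1..dim (Vs i)} \<and> independent (g i ` {1..dim (Vs i)}) \<and>
      span (g i ` {1..dim (Vs i)}) = Vs i \<and> b i \<le> dim (Vs i)" by metis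
  have W: "W scale n h b = span ((\<lambda>(i, j). h i j) ` ?S)" for h
    unfolding W_def by (rule arg_cong[where f = span]) (auto 0 4)
  have "collection_of_bases scale n Vs g"
    using g by (auto simp: collection_of_bases_def dims_def)
  \<comment> \<open>genericity: \<open>f\<close> does at least as well as the collection \<open>g\<close> just constructed\<close>
  then have "dim (W scale n g b) \<le> dim (W scale n f b)"
    using gen g by (auto simp: generic_bases_def dims_def)
  moreover have "(\<lambda>(i, j). g i j) ` ?S = x ` ?S"
    using g by (intro image_cong refl) auto
  then have "dim (W scale n g b) = card ?S"
    using x by (simp add: W dim_eq_card_independent card_image)
  ultimately have ge: "card ?S \<le> dim ((\<lambda>(i, j). f i j) ` ?S)" by (simp add: W)
  have finS: "finite ?S" by simp
  have "dim ((\<lambda>(i, j). f i j) ` ?S) \<le> card ((\<lambda>(i, j). f i j) ` ?S)"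
    using finS by (intro dim_le_card span_superset) auto
  moreover have "card ((\<lambda>(i, j). f i j) ` ?S) \<le> card ?S" using finS by (rule card_image_le)
  ultimately have eq: "card ((\<lambda>(i, j). f i j) ` ?S) = card ?S"
    "card ((\<lambda>(i, j). f i j) ` ?S) \<le> dim ((\<lambda>(i, j). f i j) ` ?S)" using ge by linarith+
  show "inj_on (\<lambda>(i, j). f i j) ?S" using eq(1) finS by (rule eq_card_imp_inj_on[rotated])
  show "independent ((\<lambda>(i, j). f i j) ` ?S)"
    by (rule card_le_dim_spanning[OF subset_refl span_superset _ eq(2)]) (use finS in blast)
qed

end

section \<open>Generators of the product ideal\<close>

text \<open>
  Over a ring with zero divisors a nonzero kernel vector does not suffice; the adjugate shows
  that \<open>det M\<close> kills every entry of a kernel vector, and here all entries are \<open>1\<close>.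
\<close>

lemma det_eq_0_if_row_sums_0:
  fixes M :: "'r::comm_ring_1 mat"
  assumes M: "M \<in> carrier_mat m m" and "m > 0"
    and rows: "\<And>i. i < m \<Longrightarrow> (\<Sum>j<m. M $$ (i, j)) = 0"
  shows "det M = 0"
proof -
  let ?u = "vec m (\<lambda>_. 1) :: 'r vec"
  have u: "?u \<in> carrier_vec m" by simp
  note adj = adj_mat[OF M]
  have "M *\<^sub>v ?u = 0\<^sub>v m"
    using M rows by (intro eq_vecI) (auto simp: scalar_prod_def atLeast0LessThan)
  then have "adj_mat M *\<^sub>v (M *\<^sub>v ?u) = 0\<^sub>v m" using adj(1) by (auto intro!: eq_vecI)
  moreover have "adj_mat M *\<^sub>v (M *\<^sub>v ?u) = (adj_mat M * M) *\<^sub>v ?u"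
    by (rule assoc_mult_mat_vec[symmetric, OF adj(1) M u])
  ultimately have "(det M \<cdot>\<^sub>m 1\<^sub>m m) *\<^sub>v ?u = 0\<^sub>v m" using adj(3) by simp
  then have "((det M \<cdot>\<^sub>m 1\<^sub>m m) *\<^sub>v ?u) $ 0 = 0" using assms(2) by simp
  moreover have "((det M \<cdot>\<^sub>m 1\<^sub>m m) *\<^sub>v ?u) $ 0 = (\<Sum>j<m. det M * (if 0 = j then 1 else 0))"
    using assms(2) by (auto simp: scalar_prod_def atLeast0LessThan intro!: sum.cong)
  moreover have "\<dots> = det M" using assms(2) by (simp add: if_distrib[of "(*) _"] cong: if_cong)
  ultimately show ?thesis by metis
qed

definition lowered :: "'i set \<Rightarrow> ('i \<Rightarrow> 'r::comm_ring_1) \<Rightarrow> ('i \<Rightarrow> 'r set) \<Rightarrow> 'r set"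
  where "lowered T g X = {\<Prod>i\<in>T. q i | q.
    (\<forall>i\<in>T. q i \<in> insert (g i) (X i)) \<and> (\<exists>i\<in>T. q i \<in> X i)}"

lemma prod_mem_lowered:
  assumes "finite T" and "\<And>j. j \<in> T \<Longrightarrow> r j \<in> ideal_gen (insert (g j) (X j))"
    and "j\<^sub>0 \<in> T" and "r j\<^sub>0 \<in> ideal_gen (X j\<^sub>0)"
  shows "prod r T \<in> ideal_gen (lowered T g X)"
proof -
  let ?Y = "\<lambda>j. if j = j\<^sub>0 then X j\<^sub>0 else insert (g j) (X j)"
  have "prod r T \<in> ideal_gen {\<Prod>i\<in>T. q i | q. \<forall>i\<in>T. q i \<in> ?Y i}"
    using assms by (intro prod_mem_ideal_gen) auto
  moreover have "{\<Prod>i\<in>T. q i | q. \<forall>i\<in>T. q i \<in> ?Y i} \<subseteq> lowered T g X"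
  proof
    fix y assume "y \<in> {\<Prod>i\<in>T. q i | q. \<forall>i\<in>T. q i \<in> ?Y i}"
    then obtain q where q: "y = prod q T" "\<forall>i\<in>T. q i \<in> ?Y i" by blast
    have "\<forall>i\<in>T. q i \<in> insert (g i) (X i)" using q(2) by (metis insertCI)
    moreover have "q j\<^sub>0 \<in> X j\<^sub>0" using q(2) assms(3) by metis
    ultimately show "y \<in> lowered T g X" unfolding lowered_def using q(1) assms(3) by blast
  qed
  ultimately show ?thesis using ideal_gen_mono by blast
qed

text \<open>
  The determinant trick.  If \<open>g\<^sub>i = \<Sum>\<^sub>k p\<^sub>i\<^sub>k\<close> with \<open>p\<^sub>i\<^sub>k\<close> in the ideal generated by \<open>X\<^sub>k\<close>, the
  rows of \<open>diag(g\<^sub>i) - (p\<^sub>i\<^sub>k)\<close> sum to zero, so its determinant vanishes.  In the Leibniz expansion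
  the identity contributes \<open>\<Prod>\<^sub>i g\<^sub>i\<close> plus products with some factor \<open>p\<^sub>i\<^sub>i\<close>, and every other permutation takes from
  each column \<open>k\<close> a member of the ideal of \<open>X\<^sub>k\<close> and \<open>g\<^sub>k\<close>, and from a column that it moves a
  member of the ideal of \<open>X\<^sub>k\<close>.
\<close>

lemma determinant_trick:
  fixes g :: "nat \<Rightarrow> 'r::comm_ring_1"
  assumes "m > 0"
    and sum: "\<And>i. i < m \<Longrightarrow> g i = (\<Sum>k<m. p i k)"
    and p: "\<And>i k. i < m \<Longrightarrow> k < m \<Longrightarrow> p i k \<in> ideal_gen (X k)"
  shows "(\<Prod>i\<in>{0..<m}. g i) \<in> ideal_gen (lowered {0..<m} g X)"
proof -
  let ?T = "{0..<m}" and ?Q = "ideal_gen (lowered {0..<m} g X)"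
  define M where "M = mat m m (\<lambda>(i, j). (if i = j then g i else 0) - p i j)"
  have M: "M \<in> carrier_mat m m" by (simp add: M_def)
  have Mij: "M $$ (i, j) = (if i = j then g i else 0) - p i j" if "i < m" "j < m" for i j
    using that by (simp add: M_def)
  have big: "x \<in> ideal_gen (insert (g k) (X k))" if "x \<in> ideal_gen (X k)" for x k
    using that ideal_gen_mono[of "X k" "insert (g k) (X k)"] by blast
  have M_big: "M $$ (i, j) \<in> ideal_gen (insert (g j) (X j))" if "i < m" "j < m" for i j
    unfolding Mij[OF that]
    by (intro ideal_gen_diff big[OF p[OF that]]) (simp add: ideal_gen_zero ideal_gen_base)
  have "det M = 0"
  proof (rule det_eq_0_if_row_sums_0[OF M assms(1)])
    fix i assume i: "i < m"
    have "(\<Sum>j<m. M $$ (i, j)) = (\<Sum>j<m. (if i = j then g i else 0) - p i j)"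
      by (intro sum.cong refl) (simp add: Mij i)
    also have "\<dots> = g i - (\<Sum>j<m. p i j)" using i by (simp add: sum_subtractf)
    finally show "(\<Sum>j<m. M $$ (i, j)) = 0" using sum[OF i] by simp
  qed
  let ?t = "\<lambda>\<pi>. signof \<pi> * (\<Prod>i\<in>?T. M $$ (i, \<pi> i)) :: 'r"
  let ?S = "{\<pi>. \<pi> permutes ?T}"
  have "0 = (\<Sum>\<pi>\<in>?S. ?t \<pi>)" using \<open>det M = 0\<close> det_def'[OF M] by simp
  also have "\<dots> = ?t id + (\<Sum>\<pi>\<in>?S - {id}. ?t \<pi>)"
    by (rule sum.remove) (auto simp: finite_permutations permutes_id)
  finally have id: "(\<Prod>i\<in>?T. M $$ (i, i)) = 0 - (\<Sum>\<pi>\<in>?S - {id}. ?t \<pi>)"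
    by (simp add: eq_neg_iff_add_eq_0)
  have others: "?t \<pi> \<in> ?Q" if \<pi>: "\<pi> \<in> ?S - {id}" for \<pi>
  proof -
    have perm: "\<pi> permutes ?T" using \<pi> by simp
    define \<rho> where "\<rho> = inv_into UNIV \<pi>"
    have \<rho>: "\<rho> permutes ?T" and \<pi>\<rho>: "\<And>j. \<pi> (\<rho> j) = j" and \<rho>\<pi>: "\<And>j. \<rho> (\<pi> j) = j"
      unfolding \<rho>_def using permutes_inv[OF perm] permutes_inverses[OF perm] by blast+
    have "(\<Prod>i\<in>?T. M $$ (i, \<pi> i)) = (\<Prod>j\<in>?T. M $$ (\<rho> j, \<pi> (\<rho> j)))"
      using prod.permute[OF \<rho>, of "\<lambda>i. M $$ (i, \<pi> i)"] by (simp add: comp_def)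
    then have eq: "(\<Prod>i\<in>?T. M $$ (i, \<pi> i)) = (\<Prod>j\<in>?T. M $$ (\<rho> j, j))" by (simp only: \<pi>\<rho>)
    obtain i where i: "\<pi> i \<noteq> i" using \<pi> by (auto simp: fun_eq_iff)
    then have im: "i < m" "\<pi> i < m"
      using permutes_in_image[OF perm, of i] permutes_not_in[OF perm, of i] by auto
    have "M $$ (\<rho> (\<pi> i), \<pi> i) = 0 - p i (\<pi> i)"
      using i im by (simp add: \<rho>\<pi> Mij)
    then have "M $$ (\<rho> (\<pi> i), \<pi> i) \<in> ideal_gen (X (\<pi> i))"
      using ideal_gen_diff[OF ideal_gen_zero p[OF im]] by simp
    moreover have "M $$ (\<rho> j, j) \<in> ideal_gen (insert (g j) (X j))" if "j \<in> ?T" for j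
      using that permutes_in_image[OF \<rho>, of j] by (intro M_big) auto
    ultimately have "(\<Prod>i\<in>?T. M $$ (i, \<pi> i)) \<in> ?Q"
      unfolding eq using im by (intro prod_mem_lowered[where j\<^sub>0 = "\<pi> i"]) auto
    then show ?thesis by (rule ideal_gen_mult)
  qed
  have diag: "(\<Prod>i\<in>?T. M $$ (i, i)) \<in> ?Q"
    unfolding id using others by (intro ideal_gen_diff ideal_gen_zero ideal_gen_sum)
  \<comment> \<open>replace the diagonal entries \<open>g\<^sub>i - p\<^sub>i\<^sub>i\<close> by \<open>g\<^sub>i\<close> one at a time\<close>
  have "(\<Prod>i\<in>?T. if i < l then g i else M $$ (i, i)) \<in> ?Q" if "l \<le> m" for l
    using that
  proof (induction l)
    case 0
    then show ?case using diag by simp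
  next
    case (Suc l)
    let ?r = "\<lambda>l i. if i < l then g i else M $$ (i, i)"
    let ?s = "\<lambda>i. if i = l then p l l else ?r l i"
    have l: "l \<in> ?T" using Suc.prems by simp
    have rest: "prod (?r (Suc l)) (?T - {l}) = prod (?r l) (?T - {l})"
      "prod ?s (?T - {l}) = prod (?r l) (?T - {l})" by (intro prod.cong; auto)+
    have "prod (?r (Suc l)) ?T = g l * prod (?r l) (?T - {l})"
      "prod (?r l) ?T = (g l - p l l) * prod (?r l) (?T - {l})"
      "prod ?s ?T = p l l * prod (?r l) (?T - {l})"
      using l rest by (simp_all add: prod.remove[of ?T l] Mij)
    then have "prod (?r (Suc l)) ?T = prod (?r l) ?T + prod ?s ?T" by (simp add: algebra_simps)
    moreover have "prod ?s ?T \<in> ?Q"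
      using l p M_big big by (intro prod_mem_lowered[where j\<^sub>0 = l]) (auto intro: ideal_gen_base)
    ultimately show ?case using ideal_gen_add Suc by simp
  qed
  from this[of m] show ?thesis by simp
qed

lemma ideal_gen_UN_decomp:
  assumes "finite T" and "y \<in> ideal_gen (\<Union>k\<in>T. X k)"
  shows "\<exists>p. y = (\<Sum>k\<in>T. p k) \<and> (\<forall>k\<in>T. p k \<in> ideal_gen (X k))"
  using assms(2) unfolding ideal_gen_def[of "\<Union>k\<in>T. X k"]
proof (induction rule: ideal.span_induct_alt)
  case base
  show ?case by (intro exI[of _ "\<lambda>_. 0"]) (simp add: ideal_gen_zero)
next
  case (step c x y)
  then obtain p k where p: "y = (\<Sum>k\<in>T. p k)" "\<forall>k\<in>T. p k \<in> ideal_gen (X k)"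
    and k: "k \<in> T" "x \<in> X k" by blast
  let ?p = "\<lambda>j. (if j = k then c * x else 0) + p j"
  have "c * x + y = (\<Sum>j\<in>T. ?p j)" using assms(1) k by (simp add: p sum.distrib)
  moreover have "\<forall>j\<in>T. ?p j \<in> ideal_gen (X j)"
    using p(2) k by (auto intro: ideal_gen_add ideal_gen_mult ideal_gen_base)
  ultimately show ?case by blast
qed

definition box_prod :: "nat \<Rightarrow> (nat \<times> nat \<Rightarrow> 'r::comm_ring_1) \<Rightarrow> (nat \<Rightarrow> nat) \<Rightarrow> 'r"
  where "box_prod n f a = (\<Prod>i\<in>{1..n}. f (i, a i))"

text \<open>
  Apply the determinant trick to the rows in \<open>T\<close>, with \<open>X\<^sub>k\<close> the set of all \<open>f (k, j)\<close> with
  \<open>j < a k\<close>: each lowered product, multiplied by the factors of the other rows, is the product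
  for some \<open>b < a\<close>.
\<close>

lemma box_prod_lower:
  fixes f :: "nat \<times> nat \<Rightarrow> 'r::comm_ring_1"
  assumes a: "a \<in> D_box n d" and T: "T \<subseteq> {1..n}" "T \<noteq> {}"
    and dep: "\<And>i. i \<in> T \<Longrightarrow> f (i, a i) \<in> ideal_gen (f ` Sigma T (\<lambda>k. {1..<a k}))"
  shows "box_prod n f a \<in> ideal_gen (box_prod n f ` {b \<in> D_box n d. b < a})"
proof -
  let ?X = "\<lambda>k. f ` ({k} \<times> {1..<a k})"
  have finT: "finite T" using T(1) finite_subset by blast
  then obtain h where h: "bij_betw h {0..<card T} T" using ex_bij_betw_nat_finite by blast
  let ?m = "card T"
  have hT: "h i \<in> T" if "i < ?m" for i using bij_betwE[OF h] that by auto
  have m: "?m > 0" using finT T(2) by (simp add: card_gt_0_iff)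
  have UN: "f ` Sigma T (\<lambda>k. {1..<a k}) = (\<Union>k\<in>T. ?X k)" by auto
  have "\<exists>p. f (i, a i) = (\<Sum>k\<in>T. p k) \<and> (\<forall>k\<in>T. p k \<in> ideal_gen (?X k))" if "i \<in> T" for i
    using ideal_gen_UN_decomp[OF finT] dep[OF that] unfolding UN by blast
  then obtain p where p: "\<And>i. i \<in> T \<Longrightarrow> f (i, a i) = (\<Sum>k\<in>T. p i k)"
    "\<And>i k. i \<in> T \<Longrightarrow> k \<in> T \<Longrightarrow> p i k \<in> ideal_gen (?X k)" by metis
  let ?g = "\<lambda>i. f (h i, a (h i))"
  have "(\<Prod>i\<in>{0..<?m}. ?g i) \<in> ideal_gen (lowered {0..<?m} ?g (\<lambda>i. ?X (h i)))"
  proof (rule determinant_trick[OF m, where p = "\<lambda>i k. p (h i) (h k)"])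
    fix i assume "i < ?m"
    then have "?g i = (\<Sum>k\<in>T. p (h i) k)" using p(1) hT by blast
    then show "?g i = (\<Sum>k<?m. p (h i) (h k))"
      using sum.reindex_bij_betw[OF h, of "p (h i)"] by (simp add: atLeast0LessThan)
  qed (use p(2) hT in blast)
  moreover have "(\<Prod>i\<in>{0..<?m}. ?g i) = (\<Prod>i\<in>T. f (i, a i))"
    by (rule prod.reindex_bij_betw[OF h])
  ultimately have prodT: "(\<Prod>i\<in>T. f (i, a i)) \<in> ideal_gen (lowered {0..<?m} ?g (\<lambda>i. ?X (h i)))"
    by (simp only:)
  let ?R = "\<Prod>i\<in>{1..n} - T. f (i, a i)" and ?B = "box_prod n f ` {b \<in> D_box n d. b < a}"
  have gens: "?R * y \<in> ?B" if y: "y \<in> lowered {0..<?m} ?g (\<lambda>i. ?X (h i))" for y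
  proof -
    obtain q where q: "y = prod q {0..<?m}" "\<And>i. i < ?m \<Longrightarrow> q i \<in> insert (?g i) (?X (h i))"
      "\<exists>i<?m. q i \<in> ?X (h i)"
      using y unfolding lowered_def Ball_def Bex_def atLeastLessThan_iff by blast
    have "\<exists>j. q i = f (h i, j) \<and> 1 \<le> j \<and> j \<le> a (h i) \<and> (q i \<in> ?X (h i) \<longrightarrow> j < a (h i))"
      if i: "i < ?m" for i
    proof (cases "q i \<in> ?X (h i)")
      case True
      then show ?thesis by auto
    next
      case False
      moreover have "a (h i) \<in> {1..d (h i)}" using D_box_mem[OF a] hT[OF i] T(1) by blast
      ultimately show ?thesis using q(2)[OF i] by auto
    qed
    then obtain j where j: "\<And>i. i < ?m \<Longrightarrow> q i = f (h i, j i) \<and> 1 \<le> j i \<and> j i \<le> a (h i) \<and>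
      (q i \<in> ?X (h i) \<longrightarrow> j i < a (h i))" by metis
    define h' where "h' = inv_into {0..<?m} h"
    have h': "h' k < ?m \<and> h (h' k) = k" if "k \<in> T" for k
      using that bij_betw_inv_into_right[OF h that] bij_betwE[OF bij_betw_inv_into[OF h]]
      by (auto simp: h'_def)
    have h'h: "h' (h i) = i" if "i < ?m" for i
      using bij_betw_inv_into_left[OF h] that by (simp add: h'_def)
    define b where "b k = (if k \<in> T then j (h' k) else a k)" for k
    have ba: "b k \<le> a k" for k using j[of "h' k"] h'[of k] by (auto simp: b_def)
    have "b \<in> D_box n d"
      unfolding D_box_def
    proof (rule PiE_I)
      fix k assume k: "k \<in> {1..n}"
      have "1 \<le> b k" using j[of "h' k"] h'[of k] D_box_mem[OF a k] by (auto simp: b_def)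
      then show "b k \<in> {1..d k}" using ba[of k] D_box_mem[OF a k] by auto
    next
      fix k assume k: "k \<notin> {1..n}"
      then have "k \<notin> T" using T(1) by blast
      then show "b k = undefined" using PiE_arb[OF a[unfolded D_box_def] k] by (simp add: b_def)
    qed
    moreover have "b < a"
    proof -
      obtain i where i: "i < ?m" "q i \<in> ?X (h i)" using q(3) by blast
      then have "b (h i) < a (h i)" using j[OF i(1)] h'h[OF i(1)] hT[OF i(1)] by (simp add: b_def)
      then show ?thesis using ba by (auto simp: less_le le_fun_def)
    qed
    moreover have "box_prod n f b = ?R * y"
    proof -
      have "box_prod n f b = (\<Prod>i\<in>{1..n} - T. f (i, b i)) * (\<Prod>i\<in>T. f (i, b i))"
        unfolding box_prod_def by (rule prod.subset_diff[OF T(1)]) simp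
      also have "(\<Prod>i\<in>{1..n} - T. f (i, b i)) = ?R" by (intro prod.cong) (auto simp: b_def)
      also have "(\<Prod>i\<in>T. f (i, b i)) = (\<Prod>i\<in>{0..<?m}. f (h i, b (h i)))"
        by (rule prod.reindex_bij_betw[OF h, symmetric])
      also have "\<dots> = prod q {0..<?m}"
        using j hT h'h by (intro prod.cong) (auto simp: b_def)
      finally show ?thesis by (simp only: q(1))
    qed
    ultimately show ?thesis by (metis (mono_tags, lifting) imageI mem_Collect_eq)
  qed
  have "?R * y \<in> ideal_gen ?B" if "y \<in> ideal_gen (lowered {0..<?m} ?g (\<lambda>i. ?X (h i)))" for y
    using that unfolding ideal_gen_def[of "lowered _ _ _"]
  proof (induction rule: ideal.span_induct_alt)
    case base
    show ?case by (simp only: mult_zero_right ideal_gen_zero)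
  next
    case (step c x y)
    have "c * (?R * x) + ?R * y \<in> ideal_gen ?B"
      by (rule ideal_gen_add[OF ideal_gen_mult[OF ideal_gen_base[OF gens[OF step(1)]]] step(2)])
    moreover have "c * (?R * x) + ?R * y = ?R * (c * x + y)" by (simp only: algebra_simps)
    ultimately show ?case by (simp only:)
  qed
  from this[OF prodT] show ?thesis
    unfolding box_prod_def using prod.subset_diff[OF T(1), of "\<lambda>i. f (i, a i)"] by simp
qed

text \<open>Descent from \<open>a \<notin> P\<close> to smaller tuples stops inside \<open>P\<close>, since \<open>\<Sum>\<^sub>i a i\<close> decreases.\<close>

lemma box_prod_mem_ideal:
  assumes "\<And>a. a \<in> D_box n d - P \<Longrightarrow> box_prod n f a \<in> ideal_gen (box_prod n f ` {b \<in> D_box n d. b < a})"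
    and "a \<in> D_box n d"
  shows "box_prod n f a \<in> ideal_gen (box_prod n f ` P)"
  using assms(2)
proof (induction "\<Sum>i\<in>{1..n}. a i" arbitrary: a rule: less_induct)
  case less
  show ?case
  proof (cases "a \<in> P")
    case True
    then show ?thesis by (intro ideal_gen_base) blast
  next
    case False
    have "box_prod n f b \<in> ideal_gen (box_prod n f ` P)" if b: "b \<in> D_box n d" "b < a" for b
    proof (rule less.hyps[OF _ b(1)])
      have le: "b i \<le> a i" for i using b(2) by (simp add: less_le le_fun_def)
      have "b \<noteq> a" using b(2) by (simp add: less_le)
      then obtain i where i: "b i \<noteq> a i" by (auto simp: fun_eq_iff)
      then have "i \<in> {1..n}"
        using PiE_arb[OF b(1)[unfolded D_box_def]] PiE_arb[OF less.prems[unfolded D_box_def]] by metis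
      then show "(\<Sum>i\<in>{1..n}. b i) < (\<Sum>i\<in>{1..n}. a i)"
        using le i by (intro sum_strict_mono_ex1) (auto simp: less_le)
    qed
    then have "box_prod n f ` {b \<in> D_box n d. b < a} \<subseteq> ideal_gen (box_prod n f ` P)" by blast
    then show ?thesis using assms(1)[of a] less.prems False ideal_gen_subset by blast
  qed
qed

section \<open>Linear forms\<close>

lemma vbasis_finite_dimensional:
  assumes "vector_space s" and "vbasis s bas"
  shows "finite_dimensional_vector_space s (range bas)"
proof -
  interpret vector_space s by fact
  show ?thesis
    using assms(2) by unfold_locales (auto simp: vbasis_def)
qed

context vector_space
begin

lemma vbasisD:
  assumes "vbasis scale bas"
  shows "independent (range bas)" and "v \<in> span (range bas)"
  using assms by (simp_all add: vbasis_def)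

lemma linear_form_add:
  assumes "vbasis scale bas"
  shows "linear_form scale bas (v + w) = linear_form scale bas v + linear_form scale bas w"
  unfolding linear_form_def representation_add[OF vbasisD[OF assms] vbasisD(2)[OF assms]]
  by (simp only: Const_add distrib_right sum.distrib)

lemma linear_form_scale:
  assumes "vbasis scale bas"
  shows "linear_form scale bas (scale c v) = Const c * linear_form scale bas v"
  unfolding linear_form_def representation_scale[OF vbasisD[OF assms]]
  by (simp only: Const_mult sum_distrib_left mult.assoc)

lemma linear_form_diff:
  assumes "vbasis scale bas"
  shows "linear_form scale bas (v - w) = linear_form scale bas v - linear_form scale bas w"
  using linear_form_add[OF assms, of "v - w" w] by (simp add: algebra_simps)

lemma linear_form_0:
  assumes "vbasis scale bas"
  shows "linear_form scale bas 0 = 0"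
  using linear_form_diff[OF assms, of 0 0] by simp

lemma linear_form_basis:
  assumes "vbasis scale bas"
  shows "linear_form scale bas (bas x) = Var x"
proof -
  have "representation (range bas) (bas x) (bas y) = (if y = x then 1 else 0)" for y
    using assms representation_basis[of "range bas" "bas x"]
    by (auto simp: vbasis_def inj_def)
  then have "linear_form scale bas (bas x) = (\<Sum>y\<in>UNIV. if y = x then Var y else 0)"
    unfolding linear_form_def by (intro sum.cong) (auto simp: Const_0 Const_1)
  then show ?thesis by simp
qed

lemma linear_form_span:
  assumes "vbasis scale bas" and "v \<in> span X"
  shows "linear_form scale bas v \<in> ideal_gen (linear_form scale bas ` X)"
  using assms(2)
proof (induction rule: span_induct_alt)
  case base
  show ?case by (simp only: linear_form_0[OF assms(1)] ideal_gen_zero)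
next
  case (step c x y)
  have "linear_form scale bas x \<in> ideal_gen (linear_form scale bas ` X)"
    using step(1) by (intro ideal_gen_base imageI)
  then have "Const c * linear_form scale bas x + linear_form scale bas y \<in> ideal_gen (linear_form scale bas ` X)"
    using step(2) by (intro ideal_gen_add ideal_gen_mult)
  then show ?case by (simp only: linear_form_add[OF assms(1)] linear_form_scale[OF assms(1)])
qed

lemma linear_form_mult_eq_0:
  assumes bas: "vbasis scale bas" and "v \<noteq> 0" and "linear_form scale bas v * c = 0"
  shows "c = 0"
proof -
  let ?r = "representation (range bas) v"
  note ind = vbasisD(1)[OF bas] and v = vbasisD(2)[OF bas, of v]
  have "\<exists>x. ?r (bas x) \<noteq> 0"
  proof (rule ccontr)
    assume "\<not> ?thesis"
    then have "{b. ?r b \<noteq> 0} = {}" using representation_ne_zero[of "range bas" v] by blast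
    then have "(\<Sum>b | ?r b \<noteq> 0. scale (?r b) b) = 0" by (simp only: sum.empty)
    then show False
      using sum_nonzero_representation_eq[OF ind v] assms(2) by simp
  qed
  then show ?thesis
    using linear_form_not_zero_divisor[of "\<lambda>x. ?r (bas x)" c] assms(3)
    by (auto simp: linear_form_def)
qed

text \<open>
  Modulo the linear forms of a set \<open>B\<close> the polynomial ring is again a polynomial ring: a linear
  projection \<open>p\<close> with kernel spanned by \<open>B\<close> induces a ring endomorphism \<open>\<phi>\<close> that kills the
  ideal of \<open>B\<close> and satisfies \<open>c - \<phi> c\<close> in that ideal for all \<open>c\<close>.  If \<open>p\<close> fixes \<open>v\<close>, then
  \<open>c v\<close> in the ideal gives \<open>\<phi> c \<cdot> v = 0\<close>, hence \<open>\<phi> c = 0\<close>.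
\<close>

lemma linear_form_regular:
  fixes c :: "('x::finite, 'a) mpoly"
  assumes bas: "vbasis scale bas" and ind: "independent (insert v B)" and v: "v \<notin> B"
    and c: "c * linear_form scale bas v \<in> ideal_gen (linear_form scale bas ` B)"
  shows "c \<in> ideal_gen (linear_form scale bas ` B)"
proof -
  let ?l = "linear_form scale bas" and ?I = "ideal_gen (linear_form scale bas ` B)"
  interpret vp: vector_space_pair scale scale ..
  define C where "C = extend_basis (insert v B)"
  have C: "insert v B \<subseteq> C" "independent C" "span C = UNIV"
    unfolding C_def
    using extend_basis_superset[OF ind] independent_extend_basis[OF ind] span_extend_basis[OF ind] by auto
  define p where "p = vp.construct C (\<lambda>b. if b \<in> B then 0 else b)"
  have lin: "Vector_Spaces.linear scale scale p"
    unfolding p_def by (rule vp.linear_construct[OF C(2)])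
  note p_add = vp.linear_add[OF lin] and p_scale = vp.linear_scale[OF lin]
  have p_C: "p b = (if b \<in> B then 0 else b)" if "b \<in> C" for b
    unfolding p_def by (rule vp.construct_basis[OF C(2) that])
  have pv: "p v = v" and pB: "\<And>b. b \<in> B \<Longrightarrow> p b = 0" using p_C C(1) v by auto
  have rest: "w - p w \<in> span B" for w
  proof -
    have "w \<in> span C" using C(3) by simp
    then show ?thesis
    proof (induction rule: span_induct_alt)
      case base
      then show ?case using vp.linear_0[OF lin] by (simp add: span_zero)
    next
      case (step k x y)
      have "x - p x \<in> span B" using p_C[OF step(1)] by (auto intro: span_zero span_base)
      moreover have "scale k x + y - p (scale k x + y) = scale k (x - p x) + (y - p y)"
        by (simp add: p_add p_scale scale_right_diff_distrib)
      ultimately show ?case using step(2) by (simp only: span_add span_scale)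
    qed
  qed
  define \<phi> where "\<phi> = subst (\<lambda>x. ?l (p (bas x)))"
  have \<phi>_l: "\<phi> (?l w) = ?l (p w)" for w
  proof -
    from vbasisD(2)[OF bas, of w] show ?thesis
    proof (induction rule: span_induct_alt)
      case base
      then show ?case
        by (simp add: linear_form_0[OF bas] vp.linear_0[OF lin] \<phi>_def subst_0)
    next
      case (step k x y)
      have "\<phi> (?l x) = ?l (p x)"
        using step(1) by (auto simp: linear_form_basis[OF bas] \<phi>_def subst_Var)
      then show ?case
        using step(2)
        by (simp add: linear_form_add[OF bas] linear_form_scale[OF bas] p_add p_scale \<phi>_def
            subst_add subst_mult subst_Const)
    qed
  qed
  have \<phi>_I: "\<phi> q = 0" if "q \<in> ?I" for q
    using that unfolding ideal_gen_def
  proof (induction rule: ideal.span_induct_alt)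
    case base
    then show ?case by (simp add: \<phi>_def subst_0)
  next
    case (step k x y)
    then have "\<phi> x = 0" using \<phi>_l pB linear_form_0[OF bas] by auto
    then show ?case using step(2) by (simp add: \<phi>_def subst_add subst_mult)
  qed
  have mod_I: "q - \<phi> q \<in> ?I" for q
  proof (induction q rule: mpoly_induct)
    case (Const k)
    show ?case by (simp add: \<phi>_def subst_Const ideal_gen_zero)
  next
    case (Var x)
    have "Var x - \<phi> (Var x) = ?l (bas x - p (bas x))"
      by (simp add: linear_form_diff[OF bas] linear_form_basis[OF bas] \<phi>_def subst_Var)
    then show ?case using linear_form_span[OF bas rest] by simp
  next
    case (add q r)
    have "q + r - \<phi> (q + r) = (q - \<phi> q) + (r - \<phi> r)" by (simp add: \<phi>_def subst_add)
    then show ?case using ideal_gen_add[OF add] by (simp only:)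
  next
    case (mult q r)
    have "q * r - \<phi> (q * r) = r * (q - \<phi> q) + \<phi> q * (r - \<phi> r)"
      by (simp add: \<phi>_def subst_mult algebra_simps)
    then show ?case
      using ideal_gen_add[OF ideal_gen_mult[OF mult(1)] ideal_gen_mult[OF mult(2)]] by (simp only:)
  qed
  have "?l v * \<phi> c = 0"
    using \<phi>_I[OF c] \<phi>_l[of v] pv by (simp add: \<phi>_def subst_mult mult.commute)
  moreover have "v \<noteq> 0" using ind dependent_zero by blast
  ultimately have "\<phi> c = 0" using linear_form_mult_eq_0[OF bas] by blast
  then show ?thesis using mod_I[of c] by simp
qed

lemma linear_forms_regular_family:
  assumes bas: "vbasis scale bas" and inj: "inj_on u E" and ind: "independent (u ` E)"
  shows "regular_family (\<lambda>e. linear_form scale bas (u e)) E"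
  unfolding regular_family_def
proof (intro ballI allI impI)
  fix e E' c
  assume e: "e \<in> E" and E': "E' \<subseteq> E - {e}"
    and c: "c * linear_form scale bas (u e) \<in> ideal_gen ((\<lambda>e. linear_form scale bas (u e)) ` E')"
  have "independent (insert (u e) (u ` E'))"
    using e E' by (intro independent_mono[OF ind]) auto
  moreover have "u e \<notin> u ` E'" using inj_on_image_mem_iff[OF inj e, of E'] E' by blast
  ultimately have "c \<in> ideal_gen (linear_form scale bas ` u ` E')"
    by (rule linear_form_regular[OF bas]) (use c in \<open>simp only: image_image\<close>)
  then show "c \<in> ideal_gen ((\<lambda>e. linear_form scale bas (u e)) ` E')" by (simp only: image_image)
qed

end

section \<open>The poset ideal of an arrangement\<close>

lemma exists_nat_family_with_sum:
  assumes "finite T" and "r \<le> (\<Sum>i\<in>T. c i)"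
  shows "\<exists>b :: 'i \<Rightarrow> nat. (\<forall>i\<in>T. b i \<le> c i) \<and> (\<Sum>i\<in>T. b i) = r"
  using assms
proof (induction T arbitrary: r rule: finite_induct)
  case (insert i T)
  have "min r (\<Sum>j\<in>T. c j) \<le> (\<Sum>j\<in>T. c j)" by simp
  then obtain b where b: "\<forall>j\<in>T. b j \<le> c j" "(\<Sum>j\<in>T. b j) = min r (\<Sum>j\<in>T. c j)"
    using insert.IH by blast
  let ?b = "b(i := r - min r (\<Sum>j\<in>T. c j))"
  have "(\<Sum>j\<in>T. ?b j) = (\<Sum>j\<in>T. b j)" using insert.hyps by (intro sum.cong) auto
  then have "(\<Sum>j\<in>insert i T. ?b j) = r" using insert.hyps b(2) by simp
  moreover have "\<forall>j\<in>insert i T. ?b j \<le> c j"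
    using b(1) insert.prems insert.hyps by auto
  ultimately show ?case by blast
qed simp

context finite_dimensional_vector_space
begin

lemma rk_mono:
  assumes "subspace_arrangement scale n Vs" and "T \<subseteq> U" and "U \<subseteq> {1..n}"
  shows "rk scale Vs T \<le> rk scale Vs U"
proof -
  have fin: "finite U" "finite T"
    using finite_subset[OF assms(3)] finite_subset[OF assms(2)] by simp_all
  have sub: "subspace (Vs i)" if "i \<in> U" for i
    using assms(1,3) that unfolding subspace_arrangement_def by blast
  have "rk scale Vs T = dim (\<Union>i\<in>T. Vs i)"
    using assms(2) by (intro rk_eq_dim_Union fin sub) blast
  also have "\<dots> \<le> dim (\<Union>i\<in>U. Vs i)" using assms(2) by (intro dim_subset) blast
  also have "\<dots> = rk scale Vs U" by (intro rk_eq_dim_Union[symmetric] fin sub)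
  finally show ?thesis .
qed

text \<open>
  The defining inequalities of \<open>D\<^sub>\<V>\<close> leave room for one more vector: not only the \<open>f\<^sub>i\<^sub>j\<close> with
  \<open>j < a\<^sub>i\<close> are independent, but also these together with any one \<open>f\<^bsub>i a\<^sub>i\<^esub>\<close>.
\<close>

lemma D_arr_independent:
  assumes arr: "subspace_arrangement scale n Vs" and gen: "generic_bases scale n Vs f"
    and a: "a \<in> D_arr scale n Vs" and i: "i \<in> {1..n}"
  shows "inj_on (\<lambda>(i, j). f i j) (insert (i, a i) (below n a))"
    and "independent ((\<lambda>(i, j). f i j) ` insert (i, a i) (below n a))"
proof -
  let ?b = "\<lambda>k. if k = i then a k else a k - 1"
  have aD: "a \<in> D_box n (dims scale Vs)" using a by (simp add: D_arr_def)
  have a1: "a k \<ge> 1" if "k \<in> {1..n}" for k using D_box_mem[OF aD that] by simp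
  have eq: "insert (i, a i) (below n a) = Sigma {1..n} (\<lambda>k. {1..?b k})"
    using i a1 by (fastforce simp: below_def split: if_splits)
  have hall: "(\<Sum>k\<in>T. ?b k) \<le> rk scale Vs T" if T: "T \<subseteq> {1..n}" for T
  proof (cases "T = {}")
    case False
    have fin: "finite T" using T finite_subset by blast
    have "(\<Sum>k\<in>T. int (?b k)) \<le> (\<Sum>k\<in>T. int (a k) - 1 + (if k = i then 1 else 0))"
      using T a1 by (intro sum_mono) (auto simp: of_nat_diff subset_iff)
    also have "\<dots> \<le> int (\<Sum>k\<in>T. a k) - int (card T) + 1"
      using fin by (simp add: sum.distrib sum_subtractf)
    also have "\<dots> \<le> int (rk scale Vs T)" using a T False by (auto simp: D_arr_def)
    finally show ?thesis by (simp flip: of_nat_sum)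
  qed simp
  show "inj_on (\<lambda>(i, j). f i j) (insert (i, a i) (below n a))"
    "independent ((\<lambda>(i, j). f i j) ` insert (i, a i) (below n a))"
    unfolding eq by (rule generic_bases_independent[OF arr gen hall]; assumption)+
qed

text \<open>
  If \<open>a \<notin> D\<^sub>\<V>\<close>, a minimal violating set \<open>T\<close> of rows satisfies \<open>\<Sum>\<^sub>T (a\<^sub>i - 1) \<ge> rk T\<close> with
  strict inequality in the other direction for its proper subsets.  Lowering the \<open>a\<^sub>i - 1\<close>
  until their sum is \<open>rk T\<close> yields independent vectors that span \<open>\<Sum>\<^sub>T V\<^sub>i\<close>.
\<close>

lemma not_D_arr_dependent:
  assumes arr: "subspace_arrangement scale n Vs" and gen: "generic_bases scale n Vs f"
    and a: "a \<in> D_box n (dims scale Vs) - D_arr scale n Vs"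
  obtains T where "T \<subseteq> {1..n}" and "T \<noteq> {}"
    and "\<And>i. i \<in> T \<Longrightarrow> Vs i \<subseteq> span ((\<lambda>(i, j). f i j) ` Sigma T (\<lambda>k. {1..<a k}))"
proof -
  have a1: "a k \<ge> 1" if "k \<in> {1..n}" for k using D_box_mem[of a n _ k] a that by force
  have conv: "int (\<Sum>i\<in>T. a i) - int (card T) = int (\<Sum>i\<in>T. a i - 1)" if T: "T \<subseteq> {1..n}" for T
  proof -
    have "int (\<Sum>i\<in>T. a i - 1) = (\<Sum>i\<in>T. int (a i) - 1)"
      using T a1 by (auto intro!: sum.cong simp: of_nat_diff subset_iff)
    then show ?thesis by (simp add: sum_subtractf)
  qed
  let ?bad = "\<lambda>T. T \<subseteq> {1..n} \<and> T \<noteq> {} \<and> rk scale Vs T \<le> (\<Sum>i\<in>T. a i - 1)"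
  obtain T' where T': "T' \<subseteq> {1..n}" "T' \<noteq> {}"
    "\<not> int (\<Sum>i\<in>T'. a i) - int (card T') \<le> int (rk scale Vs T') - 1"
    using a by (auto simp: D_arr_def)
  then have "?bad T'" unfolding conv[OF T'(1)] by linarith
  then obtain T where T: "?bad T" and min: "\<And>U. ?bad U \<Longrightarrow> card T \<le> card U"
    using exists_least_iff[of "\<lambda>m. \<exists>T. ?bad T \<and> card T = m"] by (metis not_less)
  have finT: "finite T" using T finite_subset by blast
  obtain b where b: "\<forall>i\<in>T. b i \<le> a i - 1" "(\<Sum>i\<in>T. b i) = rk scale Vs T"
    using exists_nat_family_with_sum[OF finT, of "rk scale Vs T" "\<lambda>i. a i - 1"] T by blast
  let ?b = "\<lambda>i. if i \<in> T then b i else 0"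
  have hall: "(\<Sum>i\<in>U. ?b i) \<le> rk scale Vs U" if U: "U \<subseteq> {1..n}" for U
  proof -
    have finU: "finite U" using U finite_subset by blast
    have sum: "(\<Sum>i\<in>U. ?b i) = (\<Sum>i\<in>U \<inter> T. b i)"
      using finU by (simp add: sum.inter_restrict)
    have mono: "rk scale Vs (U \<inter> T) \<le> rk scale Vs U" by (rule rk_mono[OF arr _ U]) blast
    consider "U \<inter> T = {}" | "U \<inter> T = T" | "U \<inter> T \<noteq> {}" "U \<inter> T \<subset> T" by blast
    then show ?thesis
    proof cases
      case 1
      then show ?thesis by (simp add: sum)
    next
      case 2
      then show ?thesis using sum b(2) mono by simp
    next
      case 3
      then have "card (U \<inter> T) < card T" using finT by (intro psubset_card_mono) auto
      then have "\<not> ?bad (U \<inter> T)" using min[of "U \<inter> T"] by linarith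
      then have "(\<Sum>i\<in>U \<inter> T. a i - 1) \<le> rk scale Vs (U \<inter> T)" using 3 U by auto
      moreover have "(\<Sum>i\<in>U \<inter> T. b i) \<le> (\<Sum>i\<in>U \<inter> T. a i - 1)" using b(1) by (intro sum_mono) auto
      ultimately show ?thesis using sum mono by linarith
    qed
  qed
  let ?f = "\<lambda>(i, j). f i j" and ?S = "Sigma {1..n} (\<lambda>i. {1..?b i})"
  note indep = generic_bases_independent[OF arr gen, of ?b, OF hall]
  have S: "?S \<subseteq> Sigma T (\<lambda>k. {1..<a k})"
  proof
    fix e assume "e \<in> ?S"
    then obtain i j where e: "e = (i, j)" "i \<in> T" "1 \<le> j" "j \<le> b i" by (auto split: if_splits)
    then have "i \<in> {1..n}" using T by blast
    then have "j < a i" using e b(1) a1[of i] by fastforce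
    then show "e \<in> Sigma T (\<lambda>k. {1..<a k})" using e by simp
  qed
  have "card ?S = (\<Sum>i\<in>{1..n}. ?b i)" by simp
  also have "\<dots> = (\<Sum>i\<in>T. b i)"
    using T by (intro sum.mono_neutral_cong_right) auto
  finally have "card (?f ` ?S) = rk scale Vs T" using b(2) card_image[OF indep(1)] by simp
  moreover have "rk scale Vs T = dim (\<Union>i\<in>T. Vs i)"
    using finT T arr by (intro rk_eq_dim_Union) (auto simp: subspace_arrangement_def)
  ultimately have dim_le: "dim (\<Union>i\<in>T. Vs i) \<le> card (?f ` ?S)" by simp
  have "?f ` ?S \<subseteq> (\<Union>i\<in>T. Vs i)"
  proof
    fix v assume "v \<in> ?f ` ?S"
    then obtain i j where v: "v = f i j" "i \<in> T" "1 \<le> j" "j \<le> b i" by (auto split: if_splits)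
    then have i: "i \<in> {1..n}" using T by blast
    have "a i \<in> {1..dims scale Vs i}" using a i by (intro D_box_mem) auto
    moreover have "b i \<le> a i" using b(1) v(2) by fastforce
    ultimately have "j \<in> {1..dims scale Vs i}" using v by auto
    then have "v \<in> span (f i ` {1..dims scale Vs i})" using v by (intro span_base) blast
    moreover have "span (f i ` {1..dims scale Vs i}) = Vs i"
      using gen i by (simp add: generic_bases_def collection_of_bases_def)
    ultimately show "v \<in> (\<Union>i\<in>T. Vs i)" using v(2) by blast
  qed
  then have "(\<Union>i\<in>T. Vs i) \<subseteq> span (?f ` ?S)"
    using card_ge_dim_independent[OF _ indep(2) dim_le] by blast
  also have "\<dots> \<subseteq> span (?f ` Sigma T (\<lambda>k. {1..<a k}))"
    using S by (intro span_mono image_mono)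
  finally show ?thesis using T by (intro that[of T]) auto
qed

end

section \<open>The complex of a poset ideal as a truncated Koszul complex\<close>

definition enc :: "nat \<Rightarrow> (nat \<Rightarrow> nat set) \<Rightarrow> (nat \<times> nat) set"
  where "enc n A = Sigma {1..n} A"

definition dec :: "nat \<Rightarrow> (nat \<times> nat) set \<Rightarrow> nat \<Rightarrow> nat set"
  where "dec n F = (\<lambda>i\<in>{1..n}. F `` {i})"

definition fams :: "nat \<Rightarrow> (nat \<Rightarrow> nat) \<Rightarrow> (nat \<Rightarrow> nat set) set"
  where "fams n d = (\<Pi>\<^sub>E i\<in>{1..n}. Pow {1..d i} - {{}})"

text \<open>
  The basis of the complex, stated without reference to a coefficient ring so that the complex
  over \<open>T\<close> and its base change to \<open>S\<close> share it.
\<close>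

definition K_gens :: "nat \<Rightarrow> (nat \<Rightarrow> nat) \<Rightarrow> (nat \<Rightarrow> nat) set \<Rightarrow> nat \<Rightarrow> (nat \<Rightarrow> nat set) set"
  where "K_gens n d P k =
    {A \<in> fams n d. (\<lambda>i\<in>{1..n}. Max (A i)) \<in> P \<and> (\<Sum>i\<in>{1..n}. card (A i)) = k + n}"

lemma gens_K_complex: "gens (K_complex n d P) k = K_gens n d P k"
  by (simp add: K_complex_def fams_def K_gens_def)

lemma fams_row:
  assumes "A \<in> fams n d" and "i \<in> {1..n}"
  shows "A i \<subseteq> {1..d i}" and "A i \<noteq> {}" and "finite (A i)" and "card (A i) \<ge> 1"
proof -
  show *: "A i \<subseteq> {1..d i}" "A i \<noteq> {}" using PiE_mem[OF assms[unfolded fams_def]] by auto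
  show "finite (A i)" using finite_subset[OF *(1)] by simp
  then show "card (A i) \<ge> 1" using *(2) by (simp add: Suc_le_eq card_gt_0_iff)
qed

lemma enc_row: "i \<in> {1..n} \<Longrightarrow> enc n A `` {i} = A i"
  by (auto simp: enc_def)

lemma enc_full:
  assumes "A \<in> fams n d"
  shows "enc n A \<in> full n d"
  unfolding full_def
proof (intro CollectI conjI ballI)
  show "enc n A \<subseteq> grid n d" using fams_row(1)[OF assms] unfolding enc_def grid_def by blast
  show "enc n A `` {i} \<noteq> {}" if "i \<in> {1..n}" for i
    using fams_row(2)[OF assms that] enc_row[OF that] by simp
qed

lemma dec_fams:
  assumes "F \<in> full n d"
  shows "dec n F \<in> fams n d"
  unfolding fams_def dec_def
proof (rule restrict_PiE_iff[THEN iffD2], rule ballI)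
  fix i assume i: "i \<in> {1..n}"
  have "F `` {i} \<subseteq> {1..d i}" using fullD(1)[OF assms] unfolding grid_def by blast
  then show "F `` {i} \<in> Pow {1..d i} - {{}}" using full_row[OF assms i] by blast
qed

lemma dec_enc: "A \<in> fams n d \<Longrightarrow> dec n (enc n A) = A"
  unfolding fams_def dec_def
  by (rule ext) (metis PiE_arb enc_row restrict_apply)

lemma enc_dec: "F \<in> full n d \<Longrightarrow> enc n (dec n F) = F"
  using fullD(1)[of F n d] by (auto simp: enc_def dec_def grid_def)

lemma row_tops_enc: "row_tops n (enc n A) = (\<lambda>i\<in>{1..n}. Max (A i))"
  unfolding row_tops_def by (rule restrict_ext) (simp only: enc_row)

lemma card_enc:
  assumes "A \<in> fams n d"
  shows "card (enc n A) = (\<Sum>i\<in>{1..n}. card (A i))"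
  unfolding enc_def using fams_row(3)[OF assms] by (intro card_SigmaI) auto

lemma enc_cells_iff:
  assumes "A \<in> fams n d"
  shows "enc n A \<in> cells n d P k \<longleftrightarrow> A \<in> K_gens n d P k"
  using assms enc_full[OF assms] by (simp add: K_gens_def cells_def row_tops_enc card_enc[OF assms])

lemma gens_fams: "A \<in> K_gens n d P k \<Longrightarrow> A \<in> fams n d"
  by (simp add: K_gens_def)

lemma finite_gens_K_complex: "finite (K_gens n d P k)"
proof -
  have "finite (fams n d)" unfolding fams_def by (intro finite_PiE) auto
  moreover have "K_gens n d P k \<subseteq> fams n d" using gens_fams by blast
  ultimately show ?thesis by (rule finite_subset[rotated])
qed

lemma fams_insert:
  assumes "B \<in> fams n d" and "i \<in> {1..n}" and "b \<in> {1..d i}"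
  shows "B(i := insert b (B i)) \<in> fams n d"
    and "enc n (B(i := insert b (B i))) = insert (i, b) (enc n B)"
proof -
  show "B(i := insert b (B i)) \<in> fams n d"
    unfolding fams_def
  proof (rule PiE_I)
    fix j assume j: "j \<in> {1..n}"
    show "(B(i := insert b (B i))) j \<in> Pow {1..d j} - {{}}"
      using fams_row(1,2)[OF assms(1) j] assms(3) by auto
  next
    fix j assume j: "j \<notin> {1..n}"
    then have "j \<noteq> i" using assms(2) by blast
    then show "(B(i := insert b (B i))) j = undefined"
      using PiE_arb[OF assms(1)[unfolded fams_def] j] by simp
  qed
  show "enc n (B(i := insert b (B i))) = insert (i, b) (enc n B)"
    using assms(2) by (auto simp: enc_def split: if_splits)
qed

text \<open>
  Each of the \<open>i - 1\<close> earlier rows contributes one more to the lexicographic count than to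
  \<open>\<sigma>(i, b)\<close>, which the factor \<open>(-1)\<^bsup>i-1\<^esup>\<close> of \<^const>\<open>row_signed\<close> compensates.
\<close>

lemma K_sign_eq:
  fixes g :: "nat \<times> nat \<Rightarrow> 'r::comm_ring_1"
  assumes B: "B \<in> fams n d" and i: "i \<in> {1..n}"
  shows "(- 1) ^ K_sign (B(i := insert b (B i))) i b * g (i, b)
    = (- 1) ^ card {c \<in> enc n B. c < (i, b)} * row_signed g (i, b)"
proof -
  have rows: "card (B j) = card (B j) - 1 + 1" if "j \<in> {1..<i}" for j
    using fams_row(4)[OF B, of j] that i by simp
  have "{c \<in> enc n B. c < (i, b)} = Sigma {1..<i} B \<union> Pair i ` {c \<in> B i. c < b}"
    using i by (auto simp: enc_def less_prod_def')
  moreover have "card (Sigma {1..<i} B \<union> Pair i ` {c \<in> B i. c < b})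
      = card (Sigma {1..<i} B) + card (Pair i ` {c \<in> B i. c < b})"
    using fams_row(3)[OF B] i by (intro card_Un_disjoint finite_SigmaI) auto
  moreover have "card (Sigma {1..<i} B) = (\<Sum>j\<in>{1..<i}. card (B j))"
    using fams_row(3)[OF B] i by (intro card_SigmaI) auto
  moreover have "\<dots> = (\<Sum>j\<in>{1..<i}. card (B j) - 1 + 1)" by (rule sum.cong[OF refl rows])
  moreover have "\<dots> = (\<Sum>j\<in>{1..<i}. card (B j) - 1) + (i - 1)" by (simp only: sum.distrib) simp
  moreover have "card (Pair i ` {c \<in> B i. c < b}) = card {c \<in> B i. c < b}"
    by (intro card_image) (auto simp: inj_on_def)
  ultimately have card: "card {c \<in> enc n B. c < (i, b)}
      = (\<Sum>j\<in>{1..<i}. card (B j) - 1) + card {c \<in> B i. c < b} + (i - 1)" by (simp only:)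
  have "(\<Sum>j\<in>{1..<i}. card ((B(i := insert b (B i))) j) - 1) = (\<Sum>j\<in>{1..<i}. card (B j) - 1)"
    by (intro sum.cong) auto
  moreover have "{c \<in> insert b (B i). c < b} = {c \<in> B i. c < b}" by auto
  ultimately have "K_sign (B(i := insert b (B i))) i b
      = (\<Sum>j\<in>{1..<i}. card (B j) - 1) + card {c \<in> B i. c < b}"
    by (simp only: K_sign_def fun_upd_same)
  moreover have "(- 1 :: 'r) ^ (i - 1) * ((- 1) ^ (i - 1) * g (i, b)) = g (i, b)"
    by (simp add: mult.assoc[symmetric] flip: power_mult_distrib)
  ultimately show ?thesis
    unfolding card row_signed_def prod.case by (simp only: power_add mult.assoc)
qed

lemma sum_if_cong:
  assumes "finite X" and "finite Y" and "\<And>e. e \<in> X \<and> Q e \<longleftrightarrow> e \<in> Y \<and> R e"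
  shows "(\<Sum>e\<in>X. if Q e then h e else 0) = (\<Sum>e\<in>Y. if R e then h e else (0 :: 'r::comm_monoid_add))"
proof -
  have "(\<Sum>e\<in>X. if Q e then h e else 0) = sum h {e \<in> X. Q e}"
    using assms(1) by (simp add: sum.inter_filter)
  also have "{e \<in> X. Q e} = {e \<in> Y. R e}" using assms(3) by blast
  also have "sum h \<dots> = (\<Sum>e\<in>Y. if R e then h e else 0)"
    using assms(2) by (simp add: sum.inter_filter)
  finally show ?thesis .
qed

text \<open>
  The matrix of the differential, read by rows instead of columns: \<open>e\<^sub>B\<close> occurs in the boundary
  of \<open>e\<^sub>A\<close> exactly if \<open>A\<close> is \<open>B\<close> with one new element.
\<close>

lemma K_bdry_by_rows:
  fixes g :: "nat \<times> nat \<Rightarrow> 'r::comm_ring_1"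
  assumes A: "A \<in> fams n d" and B: "B \<in> fams n d"
  shows "(\<Sum>i\<in>{i \<in> {1..n}. card (A i) > 1}. \<Sum>b\<in>A i.
        (- 1) ^ K_sign A i b * g (i, b) * Defs.unit_vec (A(i := A i - {b})) B)
    = (\<Sum>e\<in>grid n d - enc n B. if A = B(fst e := insert (snd e) (B (fst e)))
        then (- 1) ^ K_sign A (fst e) (snd e) * g e else 0)"
proof -
  let ?X = "Sigma {i \<in> {1..n}. card (A i) > 1} A"
  let ?h = "\<lambda>e. (- 1) ^ K_sign A (fst e) (snd e) * g e"
  let ?Q = "\<lambda>e. B = A(fst e := A (fst e) - {snd e})"
  let ?R = "\<lambda>e. A = B(fst e := insert (snd e) (B (fst e)))"
  have fin: "finite ?X" using fams_row(3)[OF A] by (intro finite_SigmaI) auto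
  have iff: "e \<in> ?X \<and> ?Q e \<longleftrightarrow> e \<in> grid n d - enc n B \<and> ?R e" for e
  proof
    assume L: "e \<in> ?X \<and> ?Q e"
    then obtain i b where e: "e = (i, b)" "i \<in> {1..n}" "b \<in> A i" by auto
    then have Bi: "B i = A i - {b}" using L by auto
    have "e \<in> grid n d" using fams_row(1)[OF A e(2)] e unfolding grid_def by blast
    moreover have "e \<notin> enc n B" using e Bi by (auto simp: enc_def)
    moreover have "?R e" using L e by (auto simp: fun_eq_iff)
    ultimately show "e \<in> grid n d - enc n B \<and> ?R e" by blast
  next
    assume R: "e \<in> grid n d - enc n B \<and> ?R e"
    obtain i b where e0: "e = (i, b)" by (cases e)
    then have e: "e = (i, b)" "i \<in> {1..n}" "b \<notin> B i" using R by (auto simp: grid_def enc_def)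
    have Ai: "A i = insert b (B i)" using R e by auto
    have "card (A i) > 1"
      using fams_row(3,4)[OF B e(2)] e(3) by (simp add: Ai)
    then have "e \<in> ?X" using e Ai by auto
    moreover have "?Q e" using R e Ai by (auto simp: fun_eq_iff)
    ultimately show "e \<in> ?X \<and> ?Q e" by blast
  qed
  have "(\<Sum>i\<in>{i \<in> {1..n}. card (A i) > 1}. \<Sum>b\<in>A i.
        (- 1) ^ K_sign A i b * g (i, b) * Defs.unit_vec (A(i := A i - {b})) B)
      = (\<Sum>e\<in>?X. if ?Q e then ?h e else 0)"
    using fams_row(3)[OF A] by (subst sum.Sigma) (auto intro!: sum.cong simp: Defs.unit_vec_def)
  also have "\<dots> = (\<Sum>e\<in>grid n d - enc n B. if ?R e then ?h e else 0)"
    by (rule sum_if_cong[OF fin _ iff]) simp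
  finally show ?thesis .
qed

text \<open>Reading a chain of the augmented complex as a Koszul chain, in every positive degree.\<close>

definition chain_of :: "nat \<Rightarrow> (nat \<Rightarrow> nat) \<Rightarrow> ((nat \<Rightarrow> nat set) option \<Rightarrow> 'r::comm_ring_1) \<Rightarrow> (nat \<times> nat) set \<Rightarrow> 'r"
  where "chain_of n d c F = (if F \<in> full n d then c (Some (dec n F)) else 0)"

text \<open>
  The base change depends only on the images \<open>g (i, j)\<close> of the variables \<open>x\<^bsub>ij\<^esub>\<close>, which may be
  arbitrary polynomials here.
\<close>

definition K_tilde_at :: "nat \<Rightarrow> (nat \<Rightarrow> nat) \<Rightarrow> (nat \<Rightarrow> nat) set \<Rightarrow> (nat \<times> nat \<Rightarrow> ('x, 'k::comm_ring_1) mpoly)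
    \<Rightarrow> ((nat \<Rightarrow> nat set) option, ('x, 'k) mpoly) based_complex"
  where "K_tilde_at n d P g = base_change (subst g) (K_tilde n d P)"

lemma gens_K_tilde_at:
  "gens (K_tilde_at n d P g) 0 = {None}"
  "gens (K_tilde_at n d P g) (Suc k) = Some ` K_gens n d P k"
  by (simp_all add: K_tilde_at_def base_change_def K_tilde_def augment_def gens_K_complex)

lemma bdry_K_tilde_at:
  "bdry (K_tilde_at n d P g) (Suc 0) (Some A) None = (\<Prod>i\<in>{1..n}. g (i, Max (A i)))"
  "bdry (K_tilde_at n d P g) (Suc 0) (Some A) (Some B) = 0"
  "bdry (K_tilde_at n d P g) (Suc (Suc k)) (Some A) None = 0"
  "bdry (K_tilde_at n d P g) (Suc (Suc k)) (Some A) (Some B)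
    = (\<Sum>i\<in>{i \<in> {1..n}. card (A i) > 1}. \<Sum>b\<in>A i.
        (- 1) ^ K_sign A i b * g (i, b) * Defs.unit_vec (A(i := A i - {b})) B)"
proof -
  have sgn: "subst g ((- 1) ^ m) = (- 1) ^ m" for m
    by (induction m) (simp_all add: subst_1 subst_mult subst_uminus)
  have unit: "subst g (Defs.unit_vec A B) = Defs.unit_vec A B" for A B :: "nat \<Rightarrow> nat set"
    by (simp add: Defs.unit_vec_def subst_1 subst_0)
  show "bdry (K_tilde_at n d P g) (Suc 0) (Some A) None = (\<Prod>i\<in>{1..n}. g (i, Max (A i)))"
    by (simp add: K_tilde_at_def base_change_def K_tilde_def augment_def subst_prod subst_Var)
  show "bdry (K_tilde_at n d P g) (Suc 0) (Some A) (Some B) = 0"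
    "bdry (K_tilde_at n d P g) (Suc (Suc k)) (Some A) None = 0"
    by (simp_all add: K_tilde_at_def base_change_def K_tilde_def augment_def subst_0)
  show "bdry (K_tilde_at n d P g) (Suc (Suc k)) (Some A) (Some B)
    = (\<Sum>i\<in>{i \<in> {1..n}. card (A i) > 1}. \<Sum>b\<in>A i.
        (- 1) ^ K_sign A i b * g (i, b) * Defs.unit_vec (A(i := A i - {b})) B)"
    by (simp add: K_tilde_at_def base_change_def K_tilde_def augment_def K_complex_def
        subst_sum subst_mult subst_Var sgn unit)
qed

lemma diff_Suc_Suc_None: "diff (K_tilde_at n d P g) (Suc (Suc k)) c None = 0"
  unfolding diff_def gens_K_tilde_at by (rule sum.neutral) (auto simp: bdry_K_tilde_at)

lemma diff_Suc_0_Some: "diff (K_tilde_at n d P g) (Suc 0) c (Some B) = 0"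
  unfolding diff_def gens_K_tilde_at by (rule sum.neutral) (auto simp: bdry_K_tilde_at)

lemma diff_eq_kosz:
  fixes g :: "nat \<times> nat \<Rightarrow> ('x, 'k::comm_ring_1) mpoly"
  assumes c: "c \<in> chains (K_tilde_at n d P g) (Suc (Suc k))" and B: "B \<in> fams n d"
  shows "diff (K_tilde_at n d P g) (Suc (Suc k)) c (Some B)
    = kosz (row_signed g) (grid n d) (chain_of n d c) (enc n B)"
proof -
  let ?G = "K_gens n d P (Suc k)"
  let ?ins = "\<lambda>e. B(fst e := insert (snd e) (B (fst e)))"
  let ?h = "\<lambda>A e. (- 1) ^ K_sign A (fst e) (snd e) * g e"
  have "diff (K_tilde_at n d P g) (Suc (Suc k)) c (Some B)
      = (\<Sum>A\<in>?G. c (Some A) * bdry (K_tilde_at n d P g) (Suc (Suc k)) (Some A) (Some B))"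
    unfolding diff_def gens_K_tilde_at by (subst sum.reindex) (auto simp: inj_on_def)
  also have "\<dots> = (\<Sum>A\<in>?G. \<Sum>e\<in>grid n d - enc n B. if A = ?ins e then c (Some A) * ?h A e else 0)"
  proof (rule sum.cong[OF refl])
    fix A assume "A \<in> ?G"
    then have A: "A \<in> fams n d" by (rule gens_fams)
    show "c (Some A) * bdry (K_tilde_at n d P g) (Suc (Suc k)) (Some A) (Some B)
      = (\<Sum>e\<in>grid n d - enc n B. if A = ?ins e then c (Some A) * ?h A e else 0)"
      unfolding bdry_K_tilde_at K_bdry_by_rows[OF A B] sum_distrib_left
      by (intro sum.cong refl) simp
  qed
  also have "\<dots> = (\<Sum>e\<in>grid n d - enc n B. \<Sum>A\<in>?G. if A = ?ins e then c (Some A) * ?h A e else 0)"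
    by (rule sum.swap)
  also have "\<dots> = kosz (row_signed g) (grid n d) (chain_of n d c) (enc n B)"
    unfolding kosz_def
  proof (rule sum.cong[OF refl])
    fix e assume "e \<in> grid n d - enc n B"
    then obtain i b where e: "e = (i, b)" "i \<in> {1..n}" "b \<in> {1..d i}" by (auto simp: grid_def)
    have chain: "chain_of n d c (insert e (enc n B)) = c (Some (?ins e))"
      using enc_full[OF fams_insert(1)[OF B e(2,3)]] dec_enc[OF fams_insert(1)[OF B e(2,3)]]
        fams_insert(2)[OF B e(2,3)] by (simp add: chain_of_def e)
    have "c (Some A) = 0" if "A \<notin> ?G" for A
      using c that unfolding chains_def gens_K_tilde_at by blast
    then have "(\<Sum>A\<in>?G. if A = ?ins e then c (Some A) * ?h A e else 0) = c (Some (?ins e)) * ?h (?ins e) e"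
      by (subst sum.delta[OF finite_gens_K_complex]) simp
    also have "?h (?ins e) e = (- 1) ^ card {c \<in> enc n B. c < e} * row_signed g e"
      using K_sign_eq[OF B e(2), of b g] by (simp only: e fst_conv snd_conv)
    finally show "(\<Sum>A\<in>?G. if A = ?ins e then c (Some A) * ?h A e else 0)
      = (- 1) ^ card {c \<in> enc n B. c < e} * row_signed g e * chain_of n d c (insert e (enc n B))"
      unfolding chain by (simp only: mult.commute)
  qed
  finally show ?thesis .
qed

lemma gens_graph:
  assumes "P \<subseteq> D_box n d" and "a \<in> D_box n d"
  shows "dec n (graph_of n a) \<in> K_gens n d P 0 \<longleftrightarrow> a \<in> P"
proof -
  have full: "graph_of n a \<in> full n d" and tops: "row_tops n (graph_of n a) = a"
    using cell_full[OF assms(2), of "{}"] cell_tops[OF assms(2), of "{}"] by simp_all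
  then show ?thesis
    using enc_cells_iff[OF dec_fams[OF full], of P 0] enc_dec[OF full]
    by (simp add: cells_def card_graph_of)
qed

lemma gens_0_eq:
  assumes "P \<subseteq> D_box n d"
  shows "K_gens n d P 0 = (\<lambda>a. dec n (graph_of n a)) ` P"
proof (intro subset_antisym subsetI)
  fix A assume A: "A \<in> K_gens n d P 0"
  then have Af: "A \<in> fams n d" by (rule gens_fams)
  have F: "enc n A \<in> cells n d P 0" using A enc_cells_iff[OF Af] by blast
  define a where "a = row_tops n (enc n A)"
  have a: "a \<in> P" using F by (simp add: cells_def a_def)
  then have "graph_of n a \<subseteq> enc n A" "card (enc n A) = card (graph_of n a)"
    using cell_decomp(1)[OF enc_full[OF Af] a_def] F by (auto simp: cells_def card_graph_of)
  then have "graph_of n a = enc n A" using fullD(2)[OF enc_full[OF Af]] by (simp add: card_subset_eq)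
  then have "A = dec n (graph_of n a)" using dec_enc[OF Af] by simp
  then show "A \<in> (\<lambda>a. dec n (graph_of n a)) ` P" using a by blast
next
  fix A assume "A \<in> (\<lambda>a. dec n (graph_of n a)) ` P"
  then show "A \<in> K_gens n d P 0" using gens_graph[OF assms] assms by blast
qed

lemma diff_eq_aug:
  fixes g :: "nat \<times> nat \<Rightarrow> ('x, 'k::comm_ring_1) mpoly"
  assumes P: "P \<subseteq> D_box n d" and c: "c \<in> chains (K_tilde_at n d P g) (Suc 0)"
  shows "diff (K_tilde_at n d P g) (Suc 0) c None = aug n d g (chain_of n d c)"
proof -
  have graph: "graph_of n a \<in> full n d" "row_tops n (graph_of n a) = a" if "a \<in> D_box n d" for a
    using cell_full[OF that, of "{}"] cell_tops[OF that, of "{}"] by simp_all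
  have inj: "inj_on (\<lambda>a. dec n (graph_of n a)) P"
    using P graph enc_dec by (intro inj_onI) (metis subsetD)
  have zero: "c (Some A) = 0" if "A \<notin> K_gens n d P 0" for A
    using c that unfolding chains_def gens_K_tilde_at by blast
  have "diff (K_tilde_at n d P g) (Suc 0) c None
      = (\<Sum>A\<in>K_gens n d P 0. c (Some A) * (\<Prod>i\<in>{1..n}. g (i, Max (A i))))"
    unfolding diff_def gens_K_tilde_at by (subst sum.reindex) (auto simp: inj_on_def bdry_K_tilde_at)
  also have "\<dots> = (\<Sum>a\<in>P. c (Some (dec n (graph_of n a))) * (\<Prod>i\<in>{1..n}. g (i, Max (dec n (graph_of n a) i))))"
    unfolding gens_0_eq[OF P] by (subst sum.reindex[OF inj]) simp
  also have "\<dots> = (\<Sum>a\<in>P. chain_of n d c (graph_of n a) * (\<Prod>i\<in>{1..n}. g (i, a i)))"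
  proof (intro sum.cong refl)
    fix a assume a: "a \<in> P"
    then have aD: "a \<in> D_box n d" using P by blast
    have "Max (dec n (graph_of n a) i) = a i" if "i \<in> {1..n}" for i
      using graph(2)[OF aD] that unfolding row_tops_def dec_def by (metis restrict_apply')
    then have "(\<Prod>i\<in>{1..n}. g (i, Max (dec n (graph_of n a) i))) = (\<Prod>i\<in>{1..n}. g (i, a i))"
      by (intro prod.cong refl) (simp only:)
    then show "c (Some (dec n (graph_of n a))) * (\<Prod>i\<in>{1..n}. g (i, Max (dec n (graph_of n a) i)))
      = chain_of n d c (graph_of n a) * (\<Prod>i\<in>{1..n}. g (i, a i))"
      using graph(1)[OF aD] by (simp only: chain_of_def if_True)
  qed
  also have "\<dots> = aug n d g (chain_of n d c)"
    unfolding aug_def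
  proof (rule sum.mono_neutral_left[OF finite_D_box P], rule ballI)
    fix a assume a: "a \<in> D_box n d - P"
    then have "c (Some (dec n (graph_of n a))) = 0" using gens_graph[OF P] zero by blast
    then show "chain_of n d c (graph_of n a) * (\<Prod>i\<in>{1..n}. g (i, a i)) = 0"
      by (simp add: chain_of_def)
  qed
  finally show ?thesis .
qed

definition of_chain :: "nat \<Rightarrow> (nat \<Rightarrow> nat) \<Rightarrow> ((nat \<times> nat) set \<Rightarrow> 'r::comm_ring_1) \<Rightarrow> (nat \<Rightarrow> nat set) option \<Rightarrow> 'r"
  where "of_chain n d w u = (case u of None \<Rightarrow> 0 | Some A \<Rightarrow> if A \<in> fams n d then w (enc n A) else 0)"

lemma of_chain:
  assumes "\<And>F. w F \<noteq> 0 \<Longrightarrow> F \<in> cells n d P k"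
  shows "of_chain n d w \<in> chains (K_tilde_at n d P g) (Suc k)"
    and "chain_of n d (of_chain n d w) = w"
proof -
  show "of_chain n d w \<in> chains (K_tilde_at n d P g) (Suc k)"
    unfolding chains_def
  proof (intro CollectI allI impI)
    fix u assume u: "u \<notin> gens (K_tilde_at n d P g) (Suc k)"
    show "of_chain n d w u = 0"
    proof (cases u)
      case (Some A)
      then have "A \<notin> K_gens n d P k" using u by (simp add: gens_K_tilde_at image_iff)
      then have "w (enc n A) = 0" if "A \<in> fams n d" using assms enc_cells_iff[OF that] by blast
      then show ?thesis by (simp add: of_chain_def Some)
    qed (simp add: of_chain_def)
  qed
  show "chain_of n d (of_chain n d w) = w"
  proof
    fix F
    show "chain_of n d (of_chain n d w) F = w F"
    proof (cases "F \<in> full n d")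
      case True
      then show ?thesis by (simp add: chain_of_def of_chain_def dec_fams enc_dec)
    next
      case False
      then have "w F = 0" using assms unfolding cells_def by blast
      then show ?thesis using False by (simp add: chain_of_def)
    qed
  qed
qed

lemma chain_of_cells:
  assumes "c \<in> chains (K_tilde_at n d P g) (Suc k)" and "chain_of n d c F \<noteq> 0"
  shows "F \<in> cells n d P k"
proof -
  have F: "F \<in> full n d" "c (Some (dec n F)) \<noteq> 0"
    using assms(2) by (auto simp: chain_of_def split: if_splits)
  then have "dec n F \<in> K_gens n d P k"
    using assms(1) unfolding chains_def gens_K_tilde_at by blast
  then show ?thesis using enc_cells_iff[OF dec_fams[OF F(1)]] enc_dec[OF F(1)] by simp
qed

lemma chain_of_diff:
  assumes "c \<in> chains (K_tilde_at n d P g) (Suc (Suc k))" and "F \<in> full n d"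
  shows "chain_of n d (diff (K_tilde_at n d P g) (Suc (Suc k)) c) F
    = kosz (row_signed g) (grid n d) (chain_of n d c) F"
  using diff_eq_kosz[OF assms(1) dec_fams[OF assms(2)]] assms(2) enc_dec[OF assms(2)]
  by (simp add: chain_of_def)

text \<open>
  Removing an element cannot raise the row tops, so it stays within a poset ideal; this makes the
  boundary of a basis element a chain over the same \<open>P\<close>.
\<close>

lemma gens_remove:
  assumes P: "poset_ideal n d P" and A: "A \<in> K_gens n d P (Suc k)"
    and i: "i \<in> {1..n}" and card: "card (A i) > 1" and b: "b \<in> A i"
  shows "A(i := A i - {b}) \<in> K_gens n d P k"
proof -
  let ?B = "A(i := A i - {b})"
  have Af: "A \<in> fams n d" using A by (rule gens_fams)
  have ne: "A i - {b} \<noteq> {}"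
  proof
    assume "A i - {b} = {}"
    then have "A i = {b}" using b by blast
    then show False using card by simp
  qed
  have Bf: "?B \<in> fams n d"
    unfolding fams_def
  proof (rule PiE_I)
    fix j assume j: "j \<in> {1..n}"
    show "?B j \<in> Pow {1..d j} - {{}}" using fams_row(1,2)[OF Af j] ne by auto
  next
    fix j assume j: "j \<notin> {1..n}"
    then have "j \<noteq> i" using i by blast
    then show "?B j = undefined" using PiE_arb[OF Af[unfolded fams_def] j] by simp
  qed
  have bd: "b \<in> {1..d i}" using fams_row(1)[OF Af i] b by blast
  have "A = ?B(i := insert b (?B i))" using b by (auto simp: fun_eq_iff)
  then have enc: "enc n A = insert (i, b) (enc n ?B)" using fams_insert(2)[OF Bf i bd] by simp
  have e: "(i, b) \<in> grid n d" "(i, b) \<notin> enc n ?B" using i bd by (auto simp: grid_def enc_def)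
  have cell: "enc n A \<in> cells n d P (Suc k)" using A enc_cells_iff[OF Af] by blast
  have "row_tops n (enc n ?B) \<le> row_tops n (enc n A)"
    unfolding enc by (rule row_tops_insert_le[OF enc_full[OF Bf] e(1)])
  then have "row_tops n (enc n ?B) \<in> P"
    using P cell row_tops_in_D_box[OF enc_full[OF Bf]] unfolding poset_ideal_def cells_def by blast
  moreover have "card (enc n A) = Suc (card (enc n ?B))"
    unfolding enc using e(2) fullD(2)[OF enc_full[OF Bf]] by simp
  ultimately have "enc n ?B \<in> cells n d P k"
    using cell enc_full[OF Bf] by (simp add: cells_def)
  then show ?thesis using enc_cells_iff[OF Bf] by blast
qed

lemma bdry_nonzero:
  assumes "bdry (K_tilde_at n d P g) (Suc (Suc k)) (Some A) (Some B) \<noteq> 0"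
  obtains i b where "i \<in> {1..n}" and "card (A i) > 1" and "b \<in> A i" and "B = A(i := A i - {b})"
proof (rule ccontr)
  assume neg: "\<not> thesis"
  have "bdry (K_tilde_at n d P g) (Suc (Suc k)) (Some A) (Some B) = 0"
    unfolding bdry_K_tilde_at
  proof (intro sum.neutral ballI)
    fix i b assume "i \<in> {i \<in> {1..n}. card (A i) > 1}" "b \<in> A i"
    then have "B \<noteq> A(i := A i - {b})" using that neg by blast
    then show "(- 1) ^ K_sign A i b * g (i, b) * Defs.unit_vec (A(i := A i - {b})) B = 0"
      by (simp add: Defs.unit_vec_def)
  qed
  then show False using assms by simp
qed

lemma bdry_in_chains:
  assumes P: "poset_ideal n d P" and v: "v \<in> gens (K_tilde_at n d P g) (Suc k)"
  shows "bdry (K_tilde_at n d P g) (Suc k) v \<in> chains (K_tilde_at n d P g) k"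
  unfolding chains_def
proof (intro CollectI allI impI)
  let ?C = "K_tilde_at n d P g"
  fix u assume u: "u \<notin> gens ?C k"
  obtain A where A: "v = Some A" "A \<in> K_gens n d P k"
    using v unfolding gens_K_tilde_at by blast
  show "bdry ?C (Suc k) v u = 0"
  proof (cases k)
    case 0
    then show ?thesis using u by (cases u) (simp_all add: A gens_K_tilde_at bdry_K_tilde_at)
  next
    case (Suc l)
    show ?thesis
    proof (cases u)
      case None
      then show ?thesis by (simp add: A Suc bdry_K_tilde_at)
    next
      case (Some B)
      show ?thesis
      proof (rule ccontr)
        assume "\<not> ?thesis"
        then have "bdry ?C (Suc (Suc l)) (Some A) (Some B) \<noteq> 0" by (simp add: A Suc Some)
        then obtain i b where "i \<in> {1..n}" "card (A i) > 1" "b \<in> A i" "B = A(i := A i - {b})"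
          by (rule bdry_nonzero)
        then have "B \<in> K_gens n d P l" using gens_remove[OF P A(2)[unfolded Suc]] by simp
        then show False using u by (simp add: Suc Some gens_K_tilde_at)
      qed
    qed
  qed
qed

lemma diff_in_chains:
  assumes "poset_ideal n d P"
  shows "diff (K_tilde_at n d P g) (Suc k) c \<in> chains (K_tilde_at n d P g) k"
  unfolding chains_def diff_def
proof (intro CollectI allI impI sum.neutral ballI)
  fix u v assume "u \<notin> gens (K_tilde_at n d P g) k" "v \<in> gens (K_tilde_at n d P g) (Suc k)"
  then have "bdry (K_tilde_at n d P g) (Suc k) v u = 0"
    using bdry_in_chains[OF assms] unfolding chains_def by blast
  then show "c v * bdry (K_tilde_at n d P g) (Suc k) v u = 0" by simp
qed

lemma aug_cong: "(\<And>F. F \<in> full n d \<Longrightarrow> z F = w F) \<Longrightarrow> aug n d f z = aug n d f w"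
  unfolding aug_def using cell_full[of _ n d "{}"] by (intro sum.cong refl) simp

lemma K_tilde_at_is_complex:
  assumes P: "poset_ideal n d P"
  shows "is_complex (K_tilde_at n d P g)"
  unfolding is_complex_def
proof (intro conjI allI ballI)
  let ?C = "K_tilde_at n d P g"
  have PD: "P \<subseteq> D_box n d" using P by (simp add: poset_ideal_def)
  show "finite (gens ?C k)" for k
    by (cases k) (simp_all add: gens_K_tilde_at finite_gens_K_complex)
  show "bdry ?C (Suc k) v \<in> chains ?C k" if "v \<in> gens ?C (Suc k)" for k v
    by (rule bdry_in_chains[OF P that])
  show "diff ?C (Suc k) (diff ?C (Suc (Suc k)) c) = (\<lambda>_. 0)" if c: "c \<in> chains ?C (Suc (Suc k))" for k c
  proof
    fix u
    let ?K = "kosz (row_signed g) (grid n d)"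
    note d = diff_in_chains[OF P, of g "Suc k" c]
    note d' = diff_in_chains[OF P, of g k "diff ?C (Suc (Suc k)) c"]
    show "diff ?C (Suc k) (diff ?C (Suc (Suc k)) c) u = 0"
    proof (cases k)
      case 0
      have "diff ?C (Suc 0) (diff ?C (Suc (Suc 0)) c) None
          = aug n d g (chain_of n d (diff ?C (Suc (Suc 0)) c))"
        by (rule diff_eq_aug[OF PD d[unfolded 0]])
      also have "\<dots> = aug n d g (?K (chain_of n d c))"
        by (rule aug_cong) (rule chain_of_diff[OF c[unfolded 0]])
      also have "\<dots> = 0" by (rule aug_kosz)
      finally show ?thesis using 0 by (cases u) (simp_all add: diff_Suc_0_Some)
    next
      case (Suc l)
      show ?thesis
      proof (cases u)
        case None
        then show ?thesis by (simp add: Suc diff_Suc_Suc_None)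
      next
        case (Some B)
        show ?thesis
        proof (cases "B \<in> fams n d")
          case False
          then have "u \<notin> gens ?C k" using gens_fams by (auto simp: Suc Some gens_K_tilde_at)
          then show ?thesis using d' unfolding chains_def by blast
        next
          case True
          have "diff ?C (Suc (Suc l)) (diff ?C (Suc (Suc (Suc l))) c) (Some B)
              = ?K (chain_of n d (diff ?C (Suc (Suc (Suc l))) c)) (enc n B)"
            by (rule diff_eq_kosz[OF d[unfolded Suc] True])
          also have "\<dots> = ?K (?K (chain_of n d c)) (enc n B)"
            using full_insert[OF enc_full[OF True]]
            by (intro kosz_cong chain_of_diff[OF c[unfolded Suc]]) blast
          also have "\<dots> = 0" by (rule kosz_kosz[OF finite_grid fullD(1)[OF enc_full[OF True]]])
          finally show ?thesis by (simp add: Suc Some)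
        qed
      qed
    qed
  qed
qed

text \<open>
  The image of the augmentation is the ideal of the products \<open>\<Prod>\<^sub>i g (i, a i)\<close> with \<open>a \<in> P\<close>; in all
  other degrees exactness is \<open>poset_ideal_acyclic\<close>, transported along the encoding.
\<close>

lemma K_tilde_at_resolution:
  fixes g :: "nat \<times> nat \<Rightarrow> ('x, 'k::comm_ring_1) mpoly"
  assumes n: "n \<ge> 1" and P: "poset_ideal n d P"
    and reg: "\<And>a i. a \<in> P \<Longrightarrow> i \<in> {1..n} \<Longrightarrow> regular_family g (insert (i, a i) (below n a))"
  shows "free_resolution_via (K_tilde_at n d P g) (ideal_gen (box_prod n g ` P)) (\<lambda>_. 1)"
  unfolding free_resolution_via_def
proof (intro conjI allI)
  let ?C = "K_tilde_at n d P g" and ?K = "kosz (row_signed g) (grid n d)"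
  let ?J = "ideal_gen (box_prod n g ` P)"
  have PD: "P \<subseteq> D_box n d" using P by (simp add: poset_ideal_def)
  have finP: "finite P" using finite_subset[OF PD finite_D_box] .
  show complex: "is_complex ?C" by (rule K_tilde_at_is_complex[OF P])
  have reg_below: "regular_family g (below n a)" if "a \<in> P" for a
    by (rule regular_family_mono[OF reg[OF that, of 1]]) (use n in auto)
  have reg_top: "c \<in> ideal_gen (g ` below n a)"
    if "a \<in> P" "i \<in> {1..n}" "c * g (i, a i) \<in> ideal_gen (g ` below n a)" for a i c
  proof -
    have "below n a \<subseteq> insert (i, a i) (below n a) - {(i, a i)}" by (auto simp: below_def)
    then show ?thesis using reg[OF that(1,2)] that(3) unfolding regular_family_def by blast
  qed
  show "{c \<in> chains ?C (Suc k). diff ?C (Suc k) c = (\<lambda>_. 0)} = diff ?C (Suc (Suc k)) ` chains ?C (Suc (Suc k))" for k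
  proof (intro subset_antisym subsetI)
    fix c assume "c \<in> diff ?C (Suc (Suc k)) ` chains ?C (Suc (Suc k))"
    then show "c \<in> {c \<in> chains ?C (Suc k). diff ?C (Suc k) c = (\<lambda>_. 0)}"
      using complex diff_in_chains[OF P] unfolding is_complex_def by blast
  next
    fix c assume "c \<in> {c \<in> chains ?C (Suc k). diff ?C (Suc k) c = (\<lambda>_. 0)}"
    then have c: "c \<in> chains ?C (Suc k)" and dc: "diff ?C (Suc k) c u = 0" for u by simp_all
    have cyc: "cycles n d g k (chain_of n d c)"
    proof (cases k)
      case 0
      then show ?thesis using diff_eq_aug[OF PD c[unfolded 0]] dc[of None] by (simp add: cycles_def)
    next
      case (Suc l)
      have "?K (chain_of n d c) F = 0" if F: "F \<in> full n d" for F
        using diff_eq_kosz[OF c[unfolded Suc] dec_fams[OF F]] dc[of "Some (dec n F)"] enc_dec[OF F]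
        by (simp add: Suc)
      then show ?thesis by (simp add: Suc cycles_def)
    qed
    obtain w where w: "\<And>F. w F \<noteq> 0 \<Longrightarrow> F \<in> cells n d P (Suc k)"
      "\<And>F. F \<in> full n d \<Longrightarrow> ?K w F = chain_of n d c F"
      by (rule poset_ideal_acyclic[OF finP P, of g "chain_of n d c" k], erule reg_below,
          erule (2) reg_top, erule chain_of_cells[OF c], rule cyc, rule that)
    let ?w = "of_chain n d w"
    have w_chain: "?w \<in> chains ?C (Suc (Suc k))" by (rule of_chain(1)[OF w(1)])
    have w_eq: "chain_of n d ?w = w" by (rule of_chain(2)[OF w(1)])
    have "diff ?C (Suc (Suc k)) ?w = c"
    proof
      fix u
      show "diff ?C (Suc (Suc k)) ?w u = c u"
      proof (cases "u \<in> gens ?C (Suc k)")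
        case False
        then show ?thesis using c diff_in_chains[OF P, of g "Suc k" ?w] unfolding chains_def by simp
      next
        case True
        then obtain B where B: "u = Some B" "B \<in> K_gens n d P k"
          unfolding gens_K_tilde_at by blast
        note Bf = gens_fams[OF B(2)]
        have "diff ?C (Suc (Suc k)) ?w (Some B) = ?K w (enc n B)"
          using diff_eq_kosz[OF w_chain Bf] by (simp only: w_eq)
        also have "\<dots> = c (Some B)"
          using w(2)[OF enc_full[OF Bf]] enc_full[OF Bf] dec_enc[OF Bf] by (simp add: chain_of_def)
        finally show ?thesis by (simp add: B)
      qed
    qed
    then show "c \<in> diff ?C (Suc (Suc k)) ` chains ?C (Suc (Suc k))" using w_chain by blast
  qed
  have aug: "aug n d g z = (\<Sum>a\<in>P. z (graph_of n a) * box_prod n g a)"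
    if z: "\<And>F. z F \<noteq> 0 \<Longrightarrow> F \<in> cells n d P 0" for z
    unfolding aug_def box_prod_def
  proof (rule sum.mono_neutral_right[OF finite_D_box PD], rule ballI)
    fix a assume a: "a \<in> D_box n d - P"
    then have "row_tops n (graph_of n a) \<notin> P" using cell_tops[of a n d "{}"] by simp
    then have "z (graph_of n a) = 0" using z unfolding cells_def by blast
    then show "z (graph_of n a) * (\<Prod>i\<in>{1..n}. g (i, a i)) = 0" by simp
  qed
  show "{c \<in> chains ?C 0. (\<Sum>b\<in>gens ?C 0. c b * 1) \<in> ?J} = diff ?C (Suc 0) ` chains ?C (Suc 0)"
  proof (intro subset_antisym subsetI)
    fix c assume "c \<in> diff ?C (Suc 0) ` chains ?C (Suc 0)"
    then obtain b where b: "b \<in> chains ?C (Suc 0)" "c = diff ?C (Suc 0) b" by blast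
    have "c None = (\<Sum>a\<in>P. chain_of n d b (graph_of n a) * box_prod n g a)"
      unfolding b(2) diff_eq_aug[OF PD b(1)] by (rule aug[OF chain_of_cells[OF b(1)]])
    then have "c None \<in> ?J" unfolding ideal_gen_image_iff[OF finP]
      by (rule exI[of _ "\<lambda>a. chain_of n d b (graph_of n a)"])
    then show "c \<in> {c \<in> chains ?C 0. (\<Sum>b\<in>gens ?C 0. c b * 1) \<in> ?J}"
      using diff_in_chains[OF P, of g 0 b] by (simp add: b(2) gens_K_tilde_at)
  next
    fix c assume "c \<in> {c \<in> chains ?C 0. (\<Sum>b\<in>gens ?C 0. c b * 1) \<in> ?J}"
    then have c: "c \<in> chains ?C 0" "c None \<in> ?J" by (simp_all add: gens_K_tilde_at)
    then obtain u where u: "c None = (\<Sum>a\<in>P. u a * box_prod n g a)"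
      unfolding ideal_gen_image_iff[OF finP] by (elim exE)
    define w where "w F = (if F \<in> cells n d P 0 then u (row_tops n F) else 0)" for F
    have w: "F \<in> cells n d P 0" if "w F \<noteq> 0" for F using that by (simp add: w_def split: if_splits)
    let ?w = "of_chain n d w"
    have w_chain: "?w \<in> chains ?C (Suc 0)" by (rule of_chain(1)[OF w])
    have w_eq: "chain_of n d ?w = w" by (rule of_chain(2)[OF w])
    have w_graph: "w (graph_of n a) = u a" if "a \<in> P" for a
    proof -
      have aD: "a \<in> D_box n d" using that PD by blast
      show ?thesis
        using cell_full[OF aD, of "{}"] cell_tops[OF aD, of "{}"] that
        by (simp add: w_def cells_def card_graph_of)
    qed
    have "diff ?C (Suc 0) ?w None = aug n d g w" using diff_eq_aug[OF PD w_chain] by (simp only: w_eq)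
    also have "\<dots> = (\<Sum>a\<in>P. w (graph_of n a) * box_prod n g a)" by (rule aug[OF w])
    also have "\<dots> = c None" unfolding u by (intro sum.cong refl) (simp only: w_graph)
    finally have None: "diff ?C (Suc 0) ?w None = c None" .
    have "diff ?C (Suc 0) ?w = c"
    proof
      fix v
      show "diff ?C (Suc 0) ?w v = c v"
      proof (cases v)
        case (Some B)
        then have "v \<notin> gens ?C 0" by (simp add: gens_K_tilde_at)
        then have "c v = 0" using c(1) unfolding chains_def by blast
        then show ?thesis by (simp add: Some diff_Suc_0_Some)
      qed (simp add: None)
    qed
    then show "c \<in> diff ?C (Suc 0) ` chains ?C (Suc 0)" using w_chain by blast
  qed
  show "\<exists>c\<in>chains ?C 0. (\<Sum>b\<in>gens ?C 0. c b * 1) - r \<in> ?J" for r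
    by (rule bexI[of _ "\<lambda>v. if v = None then r else 0"])
      (simp_all add: gens_K_tilde_at ideal_gen_zero chains_def)
qed

section \<open>Grading and minimality\<close>

lemma mdeg_add: "mdeg (m + m') = mdeg m + mdeg m'"
proof -
  have sup: "mdeg p = (\<Sum>x\<in>X. Poly_Mapping.lookup p x)"
    if "finite X" "Poly_Mapping.keys p \<subseteq> X" for X and p :: "'x \<Rightarrow>\<^sub>0 nat"
    unfolding mdeg_def using that by (intro sum.mono_neutral_left) (auto simp: in_keys_iff)
  let ?X = "Poly_Mapping.keys m \<union> Poly_Mapping.keys m'"
  have "mdeg (m + m') = (\<Sum>x\<in>?X. Poly_Mapping.lookup (m + m') x)"
    by (rule sup) (auto dest: set_mp[OF keys_add])
  moreover have "mdeg m = (\<Sum>x\<in>?X. Poly_Mapping.lookup m x)" "mdeg m' = (\<Sum>x\<in>?X. Poly_Mapping.lookup m' x)"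
    by (rule sup; auto)+
  ultimately show ?thesis by (simp add: lookup_add sum.distrib)
qed

lemma homogeneous_0: "homogeneous z 0"
  by (simp add: homogeneous_def)

lemma homogeneous_Const: "homogeneous 0 (Const c)"
  by (simp add: homogeneous_def Const_def mdeg_def)

lemma homogeneous_1: "homogeneous 0 (1 :: ('x, 'k::comm_ring_1) mpoly)"
  by (simp add: homogeneous_Const flip: Const_1)

lemma homogeneous_Var: "homogeneous 1 (Var x :: ('x, 'k::comm_ring_1) mpoly)"
  by (simp add: homogeneous_def Var_def mdeg_def)

lemma homogeneous_add:
  "homogeneous z p \<Longrightarrow> homogeneous z q \<Longrightarrow> homogeneous z (p + q :: ('x, 'k::comm_ring_1) mpoly)"
  unfolding homogeneous_def using keys_add[of p q] by blast

lemma homogeneous_uminus: "homogeneous z p \<Longrightarrow> homogeneous z (- p :: ('x, 'k::comm_ring_1) mpoly)"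
  by (simp add: homogeneous_def in_keys_iff)

lemma homogeneous_sum:
  "(\<And>i. i \<in> I \<Longrightarrow> homogeneous z (h i)) \<Longrightarrow> homogeneous z (sum h I :: ('x, 'k::comm_ring_1) mpoly)"
  by (induction I rule: infinite_finite_induct) (auto intro: homogeneous_add homogeneous_0)

lemma homogeneous_mult:
  fixes p q :: "('x, 'k::comm_ring_1) mpoly"
  assumes "homogeneous y p" and "homogeneous z q"
  shows "homogeneous (y + z) (p * q)"
  unfolding homogeneous_def
proof
  fix m assume "m \<in> Poly_Mapping.keys (p * q)"
  then obtain a b where "m = a + b" "a \<in> Poly_Mapping.keys p" "b \<in> Poly_Mapping.keys q"
    using keys_mult[of p q] by blast
  then show "int (mdeg m) = y + z" using assms by (simp add: homogeneous_def mdeg_add)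
qed

lemma homogeneous_prod:
  assumes "finite I" and "\<And>i. i \<in> I \<Longrightarrow> homogeneous 1 (h i)"
  shows "homogeneous (int (card I)) (prod h I :: ('x, 'k::comm_ring_1) mpoly)"
  using assms
proof (induction I rule: finite_induct)
  case empty
  then show ?case by (simp add: homogeneous_1)
next
  case (insert i I)
  then have "homogeneous (1 + int (card I)) (h i * prod h I)" by (intro homogeneous_mult) auto
  then show ?case using insert.hyps by (simp add: add.commute)
qed

lemma linear_form_homogeneous: "homogeneous 1 (linear_form s bas v)"
  unfolding linear_form_def
  using homogeneous_mult[OF homogeneous_Const homogeneous_Var] by (intro homogeneous_sum) simp

lemma linear_form_irrelevant: "linear_form s bas v \<in> irrelevant_ideal"
  unfolding linear_form_def irrelevant_ideal_def
  by (intro ideal_gen_sum ideal_gen_mult ideal_gen_base rangeI)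

lemma bdry_Suc_Suc_cases:
  fixes g :: "nat \<times> nat \<Rightarrow> ('x, 'k::comm_ring_1) mpoly"
  assumes lin: "\<And>e. homogeneous 1 (g e)" "\<And>e. g e \<in> irrelevant_ideal"
  shows "homogeneous 1 (bdry (K_tilde_at n d P g) (Suc (Suc k)) (Some A) (Some B))"
    and "bdry (K_tilde_at n d P g) (Suc (Suc k)) (Some A) (Some B) \<in> irrelevant_ideal"
proof -
  have summand: "homogeneous 1 ((- 1) ^ m * g e * Defs.unit_vec C B)" for m e and C :: "nat \<Rightarrow> nat set"
  proof -
    have "homogeneous 0 ((- 1) ^ m :: ('x, 'k) mpoly)"
    proof (induction m)
      case 0
      show ?case by (simp add: homogeneous_1)
    next
      case (Suc m)
      then show ?case using homogeneous_uminus[of 0 "(- 1) ^ m"] by simp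
    qed
    from homogeneous_mult[OF this lin(1)] show ?thesis
      by (simp add: Defs.unit_vec_def homogeneous_0)
  qed
  show "homogeneous 1 (bdry (K_tilde_at n d P g) (Suc (Suc k)) (Some A) (Some B))"
    unfolding bdry_K_tilde_at by (intro homogeneous_sum summand)
  show "bdry (K_tilde_at n d P g) (Suc (Suc k)) (Some A) (Some B) \<in> irrelevant_ideal"
    using lin(2) unfolding bdry_K_tilde_at irrelevant_ideal_def
    by (intro ideal_gen_sum ideal_gen_mult_right ideal_gen_mult)
qed

text \<open>The basis element \<open>e\<^sub>A\<close> of degree \<open>k + 1\<close> has internal degree \<open>k + n\<close>: the resolution is linear.\<close>

lemma K_tilde_at_minimal:
  fixes g :: "nat \<times> nat \<Rightarrow> ('x, 'k::comm_ring_1) mpoly"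
  assumes n: "n \<ge> 1" and lin: "\<And>e. homogeneous 1 (g e)" "\<And>e. g e \<in> irrelevant_ideal"
    and res: "free_resolution_via (K_tilde_at n d P g) J (\<lambda>_. 1)"
  shows "minimal_free_resolution (K_tilde_at n d P g) J"
proof -
  let ?C = "K_tilde_at n d P g"
  define \<delta> :: "nat \<Rightarrow> (nat \<Rightarrow> nat set) option \<Rightarrow> int"
    where "\<delta> k b = (case k of 0 \<Rightarrow> 0 | Suc j \<Rightarrow> int (j + n))" for k b
  have entry: "homogeneous (\<delta> (Suc k) b - \<delta> k b') (bdry ?C (Suc k) b b') \<and> bdry ?C (Suc k) b b' \<in> irrelevant_ideal"
    if b: "b \<in> gens ?C (Suc k)" and b': "b' \<in> gens ?C k" for k b b'
  proof -
    obtain A where A: "b = Some A" using b unfolding gens_K_tilde_at by blast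
    show ?thesis
    proof (cases k)
      case 0
      have "homogeneous (int (card {1..n})) (\<Prod>i\<in>{1..n}. g (i, Max (A i)))"
        by (rule homogeneous_prod) (use lin in auto)
      moreover have "(\<Prod>i\<in>{1..n}. g (i, Max (A i))) \<in> irrelevant_ideal"
        using n lin(2) unfolding irrelevant_ideal_def by (intro ideal_gen_prod[of _ 1]) auto
      moreover have "b' = None" using b' by (simp add: 0 gens_K_tilde_at)
      ultimately show ?thesis by (simp add: 0 A bdry_K_tilde_at(1) \<delta>_def)
    next
      case (Suc l)
      obtain B where "b' = Some B" using b' unfolding Suc gens_K_tilde_at by blast
      then show ?thesis using bdry_Suc_Suc_cases[OF lin] by (simp add: Suc A \<delta>_def)
    qed
  qed
  have "diff ?C (Suc k) c b' \<in> irrelevant_ideal" if "b' \<in> gens ?C k" for k c b'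
    unfolding diff_def irrelevant_ideal_def
    using entry[OF _ that] unfolding irrelevant_ideal_def by (intro ideal_gen_sum ideal_gen_mult) blast
  moreover have "\<forall>b\<in>gens ?C 0. homogeneous (\<delta> 0 b) (1 :: ('x, 'k) mpoly)"
    by (simp add: \<delta>_def homogeneous_1)
  ultimately show ?thesis
    unfolding minimal_free_resolution_def using res entry by blast
qed

section \<open>The resolution of a product of linear ideals\<close>

lemma (in vector_space) ideal_prod_eq:
  assumes bas: "vbasis scale bas" and f: "collection_of_bases scale n Vs f"
  shows "ideal_prod {1..n} (\<lambda>i. subspace_ideal scale bas (Vs i))
    = ideal_gen (box_prod n (\<lambda>(i, j). linear_form scale bas (f i j)) ` D_box n (dims scale Vs))"
proof -
  let ?l = "linear_form scale bas" and ?d = "dims scale Vs"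
  let ?g = "\<lambda>(i, j). ?l (f i j)"
  have Vs: "span (f i ` {1..?d i}) = Vs i" if "i \<in> {1..n}" for i
    using f that by (simp add: collection_of_bases_def)
  have gens: "subspace_ideal scale bas (Vs i) \<subseteq> ideal_gen (?l ` f i ` {1..?d i})" if i: "i \<in> {1..n}" for i
    unfolding subspace_ideal_def using linear_form_span[OF bas] Vs[OF i] by (intro ideal_gen_subset) blast
  have "ideal_prod {1..n} (\<lambda>i. subspace_ideal scale bas (Vs i)) \<subseteq> ideal_gen (box_prod n ?g ` D_box n ?d)"
    unfolding ideal_prod_def
  proof (rule ideal_gen_subset, rule subsetI)
    fix y assume "y \<in> {\<Prod>i\<in>{1..n}. q i | q. \<forall>i\<in>{1..n}. q i \<in> subspace_ideal scale bas (Vs i)}"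
    then obtain q where q: "y = prod q {1..n}" "\<forall>i\<in>{1..n}. q i \<in> subspace_ideal scale bas (Vs i)" by blast
    have "prod q {1..n} \<in> ideal_gen {\<Prod>i\<in>{1..n}. r i | r. \<forall>i\<in>{1..n}. r i \<in> ?l ` f i ` {1..?d i}}"
      using q(2) gens by (intro prod_mem_ideal_gen) blast+
    moreover have "{\<Prod>i\<in>{1..n}. r i | r. \<forall>i\<in>{1..n}. r i \<in> ?l ` f i ` {1..?d i}} \<subseteq> box_prod n ?g ` D_box n ?d"
    proof
      fix x assume "x \<in> {\<Prod>i\<in>{1..n}. r i | r. \<forall>i\<in>{1..n}. r i \<in> ?l ` f i ` {1..?d i}}"
      then obtain r where r: "x = prod r {1..n}" "\<forall>i\<in>{1..n}. r i \<in> ?l ` f i ` {1..?d i}" by blast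
      then have "\<forall>i\<in>{1..n}. \<exists>j. j \<in> {1..?d i} \<and> r i = ?l (f i j)" by blast
      then obtain a where a: "\<forall>i\<in>{1..n}. a i \<in> {1..?d i} \<and> r i = ?l (f i (a i))" by metis
      have "restrict a {1..n} \<in> D_box n ?d" using a unfolding D_box_def restrict_PiE_iff by blast
      moreover have "x = box_prod n ?g (restrict a {1..n})"
        unfolding r(1) box_prod_def using a by (intro prod.cong) auto
      ultimately show "x \<in> box_prod n ?g ` D_box n ?d" by blast
    qed
    ultimately show "y \<in> ideal_gen (box_prod n ?g ` D_box n ?d)"
      using ideal_gen_mono q(1) by blast
  qed
  moreover have "ideal_gen (box_prod n ?g ` D_box n ?d) \<subseteq> ideal_prod {1..n} (\<lambda>i. subspace_ideal scale bas (Vs i))"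
    unfolding ideal_prod_def
  proof (rule ideal_gen_mono, rule subsetI)
    fix y assume "y \<in> box_prod n ?g ` D_box n ?d"
    then obtain a where a: "a \<in> D_box n ?d" "y = box_prod n ?g a" by blast
    have "?l (f i (a i)) \<in> subspace_ideal scale bas (Vs i)" if i: "i \<in> {1..n}" for i
    proof -
      have "f i (a i) \<in> Vs i" using span_base[of "f i (a i)" "f i ` {1..?d i}"] D_box_mem[OF a(1) i] Vs[OF i] by blast
      then show ?thesis unfolding subspace_ideal_def by (intro ideal_gen_base imageI)
    qed
    then have "y = (\<Prod>i\<in>{1..n}. ?l (f i (a i))) \<and> (\<forall>i\<in>{1..n}. ?l (f i (a i)) \<in> subspace_ideal scale bas (Vs i))"
      by (simp add: a(2) box_prod_def)
    then show "y \<in> {\<Prod>i\<in>{1..n}. q i | q. \<forall>i\<in>{1..n}. q i \<in> subspace_ideal scale bas (Vs i)}"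
      by (intro CollectI exI[of _ "\<lambda>i. ?l (f i (a i))"])
  qed
  ultimately show ?thesis by blast
qed

lemma poset_ideal_D_arr: "poset_ideal n (dims s Vs) (D_arr s n Vs)"
  unfolding poset_ideal_def
proof (intro conjI ballI impI)
  show "D_arr s n Vs \<subseteq> D_box n (dims s Vs)" by (auto simp: D_arr_def)
  fix b a assume b: "b \<in> D_arr s n Vs" and a: "a \<in> D_box n (dims s Vs)" "a \<le> b"
  have "int (\<Sum>i\<in>T. a i) - int (card T) \<le> int (rk s Vs T) - 1" if T: "T \<noteq> {} \<and> T \<subseteq> {1..n}" for T
  proof -
    have "(\<Sum>i\<in>T. a i) \<le> (\<Sum>i\<in>T. b i)" using a(2) by (intro sum_mono) (simp add: le_fun_def)
    moreover have "int (\<Sum>i\<in>T. b i) - int (card T) \<le> int (rk s Vs T) - 1"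
      using b T unfolding D_arr_def by blast
    ultimately show ?thesis by linarith
  qed
  then show "a \<in> D_arr s n Vs" using a(1) unfolding D_arr_def by blast
qed

theorem theorem4p8:
  fixes s :: "'k::field \<Rightarrow> 'v::ab_group_add \<Rightarrow> 'v"
    and bas :: "'x::finite \<Rightarrow> 'v"
    and n :: nat
    and Vs :: "nat \<Rightarrow> 'v set"
    and f :: "nat \<Rightarrow> nat \<Rightarrow> 'v"
  assumes "infinite (UNIV :: 'k set)"
    and "vector_space s"
    and "vbasis s bas"
    and "n \<ge> 1"
    and "subspace_arrangement s n Vs"
    and "generic_bases s n Vs f"
  shows "minimal_free_resolution
    (base_change (T_to_S s bas f) (K_tilde n (dims s Vs) (D_arr s n Vs)))
    (ideal_prod {1..n} (\<lambda>i. subspace_ideal s bas (Vs i)))"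
proof -
  note bas = assms(3) and arr = assms(5) and gen = assms(6)
  interpret finite_dimensional_vector_space s "range bas"
    by (rule vbasis_finite_dimensional[OF assms(2,3)])
  let ?g = "\<lambda>(i, j). linear_form s bas (f i j)" and ?d = "dims s Vs" and ?D = "D_arr s n Vs"
  have g_eq: "?g = (\<lambda>e. linear_form s bas (case e of (i, j) \<Rightarrow> f i j))" by (simp add: fun_eq_iff split: prod.split)
  have D: "?D \<subseteq> D_box n ?d" by (auto simp: D_arr_def)
  have reg: "regular_family ?g (insert (i, a i) (below n a))" if a: "a \<in> ?D" and i: "i \<in> {1..n}" for a i
    unfolding g_eq using D_arr_independent[OF arr gen a i] by (rule linear_forms_regular_family[OF bas])
  have lower: "box_prod n ?g a \<in> ideal_gen (box_prod n ?g ` {b \<in> D_box n ?d. b < a})"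
    if a: "a \<in> D_box n ?d - ?D" for a
  proof -
    obtain T where T: "T \<subseteq> {1..n}" "T \<noteq> {}"
      "\<And>i. i \<in> T \<Longrightarrow> Vs i \<subseteq> span ((\<lambda>(i, j). f i j) ` Sigma T (\<lambda>k. {1..<a k}))"
      using not_D_arr_dependent[OF arr gen a] by metis
    have aD: "a \<in> D_box n ?d" using a by blast
    show ?thesis
    proof (rule box_prod_lower[OF aD T(1,2)])
      fix i assume i: "i \<in> T"
      then have "i \<in> {1..n}" using T(1) by blast
      then have "f i (a i) \<in> span (f i ` {1..?d i})" using D_box_mem[OF aD] by (intro span_base imageI)
      also have "span (f i ` {1..?d i}) = Vs i"
        using gen \<open>i \<in> {1..n}\<close> by (simp add: generic_bases_def collection_of_bases_def)
      finally have "f i (a i) \<in> span ((\<lambda>(i, j). f i j) ` Sigma T (\<lambda>k. {1..<a k}))" using T(3)[OF i] by blast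
      from linear_form_span[OF bas this]
      show "?g (i, a i) \<in> ideal_gen (?g ` Sigma T (\<lambda>k. {1..<a k}))"
        unfolding image_image g_eq by (simp only: prod.case)
    qed
  qed
  have "box_prod n ?g ` D_box n ?d \<subseteq> ideal_gen (box_prod n ?g ` ?D)"
    using box_prod_mem_ideal[OF lower] by blast
  then have "ideal_gen (box_prod n ?g ` D_box n ?d) = ideal_gen (box_prod n ?g ` ?D)"
    using D by (intro subset_antisym ideal_gen_subset ideal_gen_mono image_mono)
  moreover have "ideal_prod {1..n} (\<lambda>i. subspace_ideal s bas (Vs i)) = ideal_gen (box_prod n ?g ` D_box n ?d)"
    using gen by (intro ideal_prod_eq[OF bas]) (simp add: generic_bases_def)
  ultimately have J: "ideal_prod {1..n} (\<lambda>i. subspace_ideal s bas (Vs i)) = ideal_gen (box_prod n ?g ` ?D)" by simp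
  have C: "base_change (T_to_S s bas f) (K_tilde n ?d ?D) = K_tilde_at n ?d ?D ?g"
    by (simp add: K_tilde_at_def T_to_S_def)
  have "free_resolution_via (K_tilde_at n ?d ?D ?g) (ideal_gen (box_prod n ?g ` ?D)) (\<lambda>_. 1)"
    by (rule K_tilde_at_resolution[OF assms(4) poset_ideal_D_arr reg])
  then show ?thesis
    unfolding C J
    by (intro K_tilde_at_minimal[OF assms(4)])
      (auto intro: linear_form_homogeneous linear_form_irrelevant)
qed

end
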